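(* Let $G$ be an affine algebraic group and consider a (finite or infinite) system of equations $\{v_i(x_1,\dots,x_m)=1\}_{i\in I}$ over $G$ with finitely many unknowns $x_1,\dots,x_m$. If the rank of the matrix of this system is less than the number $m$ of unknowns, then the dimension of each irreducible component of the variety of solutions to this system in $G^m$ is at least the dimension of the centraliser in $G$ of the set of coefficients of the system.
   Context: Algebraic groups and varieties are over an algebraically closed field (of arbitrary characteristic); varieties are not necessarily irreducible, and the topology is the Zariski topology. An equation over a group $G$ in the unknowns $x_1,\dots,x_m$ is an expression $v(x_1,\dots,x_m)=1$, where $v$ is a word whose letters are unknowns, their inverses, and elements of $G$; these elements of $G$ occurring in the words are called the coefficients. So $v$ is an element of the free product $G*F(x_1,\dots,x_m)$ of $G$ and the free group $F(x_1,\dots,x_m)$. A solution to a system is a tuple in $G^m$ satisfying all equations; for an affine algebraic group $G$ the solutions form a closed subvariety of $G^m$. The matrix of the system of equations is the integer matrix (with $m$ columns and rows indexed by $I$) whose $(i,j)$ entry is the exponent sum of the $j$-th unknown $x_j$ in the $i$-th equation, i.e. in the word $v_i$. *)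

theory Defs
  imports "HOL-Analysis.Analysis" "HOL-Algebra.Group"
begin

section \<open>Affine space and the Zariski topology\<close>

text \<open>
  Affine space over \<^typ>\<open>'k\<close> with coordinates indexed by a type \<^typ>\<open>'i\<close> is the full
  function type \<^typ>\<open>'i \<Rightarrow> 'k\<close>; for finite \<^typ>\<open>'i\<close> this is the affine space of
  dimension \<open>CARD('i)\<close>.  Zero sets depend on polynomials only through the functions
  they induce, so polynomials are represented by polynomial functions.
\<close>

inductive_set poly_fun :: "(('i \<Rightarrow> 'k::comm_ring_1) \<Rightarrow> 'k) set" where
  const: "(\<lambda>_. c) \<in> poly_fun"
| coord: "(\<lambda>x. x i) \<in> poly_fun"
| add: "p \<in> poly_fun \<Longrightarrow> q \<in> poly_fun \<Longrightarrow> (\<lambda>x. p x + q x) \<in> poly_fun"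
| mult: "p \<in> poly_fun \<Longrightarrow> q \<in> poly_fun \<Longrightarrow> (\<lambda>x. p x * q x) \<in> poly_fun"

definition zero_locus :: "(('i \<Rightarrow> 'k::comm_ring_1) \<Rightarrow> 'k) set \<Rightarrow> ('i \<Rightarrow> 'k) set" where
  "zero_locus P = {x. \<forall>p\<in>P. p x = 0}"

definition zariski :: "('i \<Rightarrow> 'k::field) topology" where
  "zariski = topology (\<lambda>U. \<exists>P\<subseteq>poly_fun. U = - zero_locus P)"

lemma zero_locus_Un:
  fixes P Q :: "(('i \<Rightarrow> 'k::field) \<Rightarrow> 'k) set"
  shows "zero_locus P \<union> zero_locus Q = zero_locus {\<lambda>x. p x * q x | p q. p \<in> P \<and> q \<in> Q}"
  unfolding zero_locus_def by force

lemma istopology_zariski: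
  "istopology (\<lambda>U::('i \<Rightarrow> 'k::field) set. \<exists>P\<subseteq>poly_fun. U = - zero_locus P)"
  unfolding istopology_def
proof (intro conjI allI impI)
  fix S T :: "('i \<Rightarrow> 'k) set"
  assume "\<exists>P\<subseteq>poly_fun. S = - zero_locus P" and "\<exists>P\<subseteq>poly_fun. T = - zero_locus P"
  then obtain P Q where P: "P \<subseteq> poly_fun" "S = - zero_locus P"
    and Q: "Q \<subseteq> poly_fun" "T = - zero_locus Q" by blast
  have "{\<lambda>x. p x * q x | p q. p \<in> P \<and> q \<in> Q} \<subseteq> poly_fun"
    using P(1) Q(1) by (auto intro: poly_fun.mult)
  moreover have "S \<inter> T = - zero_locus {\<lambda>x. p x * q x | p q. p \<in> P \<and> q \<in> Q}"
    unfolding P(2) Q(2) zero_locus_Un[symmetric] by blast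
  ultimately show "\<exists>P\<subseteq>poly_fun. S \<inter> T = - zero_locus P" by blast
next
  fix \<K> :: "('i \<Rightarrow> 'k) set set"
  assume "\<forall>K\<in>\<K>. \<exists>P\<subseteq>poly_fun. K = - zero_locus P"
  then obtain P where P: "\<And>K. K \<in> \<K> \<Longrightarrow> P K \<subseteq> poly_fun \<and> K = - zero_locus (P K)" by metis
  have "\<Union>\<K> = (\<Union>K\<in>\<K>. - zero_locus (P K))" using P by blast
  also have "\<dots> = - zero_locus (\<Union>K\<in>\<K>. P K)" unfolding zero_locus_def by blast
  finally have "\<Union>\<K> = - zero_locus (\<Union>K\<in>\<K>. P K)" .
  moreover have "(\<Union>K\<in>\<K>. P K) \<subseteq> poly_fun" using P by blast
  ultimately show "\<exists>P\<subseteq>poly_fun. \<Union>\<K> = - zero_locus P" by blast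
qed

lemma openin_zariski: "openin zariski U \<longleftrightarrow> (\<exists>P\<subseteq>poly_fun. U = - zero_locus P)"
  unfolding zariski_def topology_inverse'[OF istopology_zariski] ..

lemma topspace_zariski [simp]: "topspace zariski = (UNIV :: ('i \<Rightarrow> 'k::field) set)"
proof -
  have "zero_locus {\<lambda>_. 1} = ({} :: ('i \<Rightarrow> 'k) set)" by (simp add: zero_locus_def)
  hence "openin zariski (UNIV :: ('i \<Rightarrow> 'k) set)"
    unfolding openin_zariski by (intro exI[of _ "{\<lambda>_. 1}"]) (auto intro: poly_fun.const)
  thus ?thesis by (meson openin_subset top.extremum_uniqueI)
qed

lemma closedin_zariski: "closedin zariski Z \<longleftrightarrow> (\<exists>P\<subseteq>poly_fun. Z = zero_locus P)"
  unfolding closedin_def openin_zariski by (auto simp: Compl_eq_Diff_UNIV[symmetric])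


section \<open>Irreducibility and dimension\<close>

definition irreducible_space :: "'a topology \<Rightarrow> bool" where
  "irreducible_space X \<longleftrightarrow> topspace X \<noteq> {} \<and>
     (\<forall>A B. closedin X A \<longrightarrow> closedin X B \<longrightarrow> topspace X = A \<union> B \<longrightarrow>
        A = topspace X \<or> B = topspace X)"

definition irreducible_in :: "'a topology \<Rightarrow> 'a set \<Rightarrow> bool" where
  "irreducible_in X S \<longleftrightarrow> S \<subseteq> topspace X \<and> irreducible_space (subtopology X S)"

definition irreducible_component_of :: "'a topology \<Rightarrow> 'a set \<Rightarrow> bool" where
  "irreducible_component_of X C \<longleftrightarrow>
     irreducible_in X C \<and> (\<forall>D. irreducible_in X D \<longrightarrow> C \<subseteq> D \<longrightarrow> D = C)"

text \<open>
  Krull dimension: the supremum of the lengths \<open>n\<close> of strictly increasing chains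
  \<open>Z 0 \<subset> \<dots> \<subset> Z n\<close> of irreducible closed subsets.  The empty space gets the value 0.
\<close>

definition krull_dim :: "'a topology \<Rightarrow> enat" where
  "krull_dim X = Sup {enat n | n. \<exists>Z :: nat \<Rightarrow> 'a set.
     (\<forall>i\<le>n. closedin X (Z i) \<and> irreducible_in X (Z i)) \<and> (\<forall>i<n. Z i \<subset> Z (Suc i))}"

abbreviation zariski_dim :: "('i \<Rightarrow> 'k::field) set \<Rightarrow> enat" where
  "zariski_dim S \<equiv> krull_dim (subtopology zariski S)"


section \<open>Affine algebraic groups\<close>

definition regular_map_on :: "('i \<Rightarrow> 'k::field) set \<Rightarrow> (('i \<Rightarrow> 'k) \<Rightarrow> ('j \<Rightarrow> 'k)) \<Rightarrow> bool" where
  "regular_map_on S f \<longleftrightarrow> (\<forall>j. \<exists>p\<in>poly_fun. \<forall>x\<in>S. f x j = p x)"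

text \<open>
  A Zariski closed subset of an affine space with a group structure given by regular maps.
  The product \<open>G \<times> G\<close> is the closed subset of the affine space with coordinates
  \<^typ>\<open>'n + 'n\<close> whose two halves \<open>z \<circ> Inl\<close> and \<open>z \<circ> Inr\<close> lie in \<open>G\<close>.
\<close>

locale affine_algebraic_group = group G
  for G :: "('n::finite \<Rightarrow> 'k::alg_closed_field) monoid" (structure) +
  assumes closed: "closedin zariski (carrier G)"
    and mult_regular:
      "regular_map_on {z :: 'n + 'n \<Rightarrow> 'k. z \<circ> Inl \<in> carrier G \<and> z \<circ> Inr \<in> carrier G}
         (\<lambda>z. (z \<circ> Inl) \<otimes> (z \<circ> Inr))"
    and inv_regular: "regular_map_on (carrier G) (\<lambda>x. inv x)"

definition centraliser :: "('g, 'b) monoid_scheme \<Rightarrow> 'g set \<Rightarrow> 'g set" where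
  "centraliser G S = {g \<in> carrier G. \<forall>s\<in>S. g \<otimes>\<^bsub>G\<^esub> s = s \<otimes>\<^bsub>G\<^esub> g}"


section \<open>Systems of equations over a group\<close>

datatype ('g, 'm) letter = Unknown 'm | Inv_Unknown 'm | Coeff 'g

fun letter_value ::
  "('g, 'b) monoid_scheme \<Rightarrow> ('m \<Rightarrow> 'g) \<Rightarrow> ('g, 'm) letter \<Rightarrow> 'g" where
  "letter_value G x (Unknown j) = x j"
| "letter_value G x (Inv_Unknown j) = inv\<^bsub>G\<^esub> (x j)"
| "letter_value G x (Coeff g) = g"

definition word_value ::
  "('g, 'b) monoid_scheme \<Rightarrow> ('m \<Rightarrow> 'g) \<Rightarrow> ('g, 'm) letter list \<Rightarrow> 'g" where
  "word_value G x w = foldr (\<lambda>l g. letter_value G x l \<otimes>\<^bsub>G\<^esub> g) w \<one>\<^bsub>G\<^esub>"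

definition word_coeffs :: "('g, 'm) letter list \<Rightarrow> 'g set" where
  "word_coeffs w = {g. Coeff g \<in> set w}"

definition exponent_sum :: "('g, 'm) letter list \<Rightarrow> 'm \<Rightarrow> int" where
  "exponent_sum w j = int (count_list w (Unknown j)) - int (count_list w (Inv_Unknown j))"

definition system_coeffs :: "'s set \<Rightarrow> ('s \<Rightarrow> ('g, 'm) letter list) \<Rightarrow> 'g set" where
  "system_coeffs I v = (\<Union>i\<in>I. word_coeffs (v i))"

definition system_matrix :: "('s \<Rightarrow> ('g, 'm) letter list) \<Rightarrow> 's \<Rightarrow> 'm \<Rightarrow> int" where
  "system_matrix v i j = exponent_sum (v i) j"

text \<open>
  Rank of an integer matrix with rows indexed by a possibly infinite set \<open>I\<close>: the dimension
  of the rational row space.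
\<close>

definition matrix_rank :: "'s set \<Rightarrow> ('s \<Rightarrow> 'm::finite \<Rightarrow> int) \<Rightarrow> nat" where
  "matrix_rank I A = vec.dim ((\<lambda>i. (\<chi> j. of_int (A i j)) :: rat ^ 'm) ` I)"

text \<open>
  \<open>G\<^sup>m\<close> is the subset of the affine space with coordinates \<^typ>\<open>'m \<times> 'n\<close> consisting of
  the points \<open>x\<close> all of whose blocks \<open>curry x j\<close> lie in \<open>G\<close>.
\<close>

definition solution_variety ::
  "('n \<Rightarrow> 'k) monoid \<Rightarrow> 's set \<Rightarrow> ('s \<Rightarrow> ('n \<Rightarrow> 'k, 'm) letter list) \<Rightarrow> ('m \<times> 'n \<Rightarrow> 'k) set" where
  "solution_variety G I v =
     {x. (\<forall>j. curry x j \<in> carrier G) \<and> (\<forall>i\<in>I. word_value G (curry x) (v i) = \<one>\<^bsub>G\<^esub>)}"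

end

theory Submission
  imports Defs "HOL-Library.Function_Algebras"
begin

text \<open>
  Choose a point \<open>x\<close> of the component \<open>C\<close> that lies on no other component.  The rank condition
  gives integer degrees \<open>a j\<close> of the unknowns, not all zero, for which all left-hand sides have
  degree \<open>0\<close>; after division by a common factor some element \<open>t\<close> of the group generated by the
  coefficients and the \<open>x j\<close> has degree \<open>1\<close>.  Let \<open>A\<close> be the centraliser of the values of degree
  \<open>0\<close>; it is contained in the centraliser \<open>H\<close> of the coefficients.  Two operations turn \<open>x\<close> into
  further solutions: the replacement of \<open>t\<close> by \<open>t \<otimes> b\<close> with \<open>b \<in> A\<close>, which keeps the values of
  degree \<open>0\<close>, and the conjugation by an element of \<open>H\<close>.  Together they give a regular map from
  \<open>H \<times> A\<close> to the solution variety whose fibres are images of \<open>A\<close>, so its image through \<open>x\<close> has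
  dimension at least \<open>dim H + dim A - dim A\<close>; since irreducible subsets through \<open>x\<close> lie in \<open>C\<close>,
  this bounds the dimension of \<open>C\<close>.

  The dimension theory is based on sets of coordinates without algebraic relations on a set \<open>X\<close>.
  A chain of irreducible closed sets gives as many independent functions as its length; a count of
  monomials shows that independent functions are no more numerous than a maximal set of independent
  coordinates; and, over an algebraically closed field, points of a coordinate projection lift
  generically, so that suitable hyperplane sections lower the number of independent coordinates by
  exactly one.
\<close>


section \<open>Polynomial functions\<close>

text \<open>Neither operation suffices alone. Conjugation by \<open>H\<close> loses the dimension of
  the stabiliser of \<open>x\<close>, which commutes with coefficients and unknowns and so lies in
  \<open>A\<close>; the twists by \<open>b\<close> in \<open>A\<close> pay for that loss.
  \<open>A\<close> is what makes \<open>t\<close> replaceable: \<open>t\<close> and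
  \<open>t \<otimes> b\<close> conjugate the values of degree 0 in the same way, and a value of
  degree \<open>d\<close> is one of degree 0 times \<open>t [^] d\<close>. This is why degree 1 must
  occur, and where the rank enters: for full rank only the zero degrees give every equation degree
  0. Two pairs with the same image differ by one element \<open>e\<close> of \<open>A\<close>:
  \<open>h' = h \<otimes> e\<close>, and \<open>b'\<close> is then forced. So \<open>dim A\<close>
  cancels without being computed. \<open>H\<close> and \<open>A\<close> may be reducible and the
  image of the parameter space need not be closed. Hence one chain of irreducible closed subsets of
  \<open>H\<close> is treated at a time, \<open>A\<close> is replaced by an irreducible closed piece
  carrying as many independent coordinates, and only independent coordinates are counted, which do
  not distinguish a set from its closure.\<close>

inductive_set poly_fun_in :: "'i set \<Rightarrow> (('i \<Rightarrow> 'k::comm_ring_1) \<Rightarrow> 'k) set" for F where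
  const: "(\<lambda>_. c) \<in> poly_fun_in F"
| coord: "i \<in> F \<Longrightarrow> (\<lambda>x. x i) \<in> poly_fun_in F"
| add: "p \<in> poly_fun_in F \<Longrightarrow> q \<in> poly_fun_in F \<Longrightarrow> (\<lambda>x. p x + q x) \<in> poly_fun_in F"
| mult: "p \<in> poly_fun_in F \<Longrightarrow> q \<in> poly_fun_in F \<Longrightarrow> (\<lambda>x. p x * q x) \<in> poly_fun_in F"

lemma poly_fun_in_UNIV: "poly_fun_in UNIV = poly_fun"
proof -
  have "p \<in> poly_fun_in UNIV \<Longrightarrow> p \<in> poly_fun" for p :: "('a \<Rightarrow> 'b) \<Rightarrow> 'b"
    by (induction rule: poly_fun_in.induct) (auto intro: poly_fun.intros)
  moreover have "p \<in> poly_fun \<Longrightarrow> p \<in> poly_fun_in UNIV" for p :: "('a \<Rightarrow> 'b) \<Rightarrow> 'b"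
    by (induction rule: poly_fun.induct) (auto intro: poly_fun_in.intros)
  ultimately show ?thesis by blast
qed

lemma poly_fun_in_mono:
  assumes "p \<in> poly_fun_in F" "F \<subseteq> F'"
  shows "p \<in> poly_fun_in F'"
  using assms(1)
proof (induction rule: poly_fun_in.induct)
  case (coord i)
  then show ?case using assms(2) by (intro poly_fun_in.coord) auto
qed (auto intro: poly_fun_in.intros)

lemma poly_fun_in_poly_fun: "p \<in> poly_fun_in F \<Longrightarrow> p \<in> poly_fun"
  using poly_fun_in_mono[of p F UNIV] by (simp add: poly_fun_in_UNIV)

lemma poly_fun_in_cong:
  assumes "p \<in> poly_fun_in F" "\<And>i. i \<in> F \<Longrightarrow> x i = y i"
  shows "p x = p y"
  using assms(1) by (induction rule: poly_fun_in.induct) (simp_all add: assms(2))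

lemma poly_fun_in_upd: "p \<in> poly_fun_in F \<Longrightarrow> i \<notin> F \<Longrightarrow> p (x(i := t)) = p x"
  by (rule poly_fun_in_cong[where F = F]) auto

lemma poly_fun_in_subst:
  assumes "p \<in> poly_fun_in F" "\<And>i. i \<in> F \<Longrightarrow> (\<lambda>x. s x i) \<in> poly_fun_in E"
  shows "(\<lambda>x. p (s x)) \<in> poly_fun_in E"
  using assms(1)
proof (induction rule: poly_fun_in.induct)
  case (coord i)
  then show ?case by (rule assms(2))
qed (auto intro: poly_fun_in.intros)

lemma poly_fun_subst:
  assumes "p \<in> poly_fun" "\<And>i. (\<lambda>x. s x i) \<in> poly_fun"
  shows "(\<lambda>x. p (s x)) \<in> poly_fun"
  using poly_fun_in_subst[of p UNIV s UNIV] assms by (simp add: poly_fun_in_UNIV)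

lemma poly_fun_in_plus: "p \<in> poly_fun_in F \<Longrightarrow> q \<in> poly_fun_in F \<Longrightarrow> p + q \<in> poly_fun_in F"
  unfolding plus_fun_def by (rule poly_fun_in.add)

lemma poly_fun_in_times: "p \<in> poly_fun_in F \<Longrightarrow> q \<in> poly_fun_in F \<Longrightarrow> p * q \<in> poly_fun_in F"
  unfolding times_fun_def by (rule poly_fun_in.mult)

lemma poly_fun_in_0: "0 \<in> poly_fun_in F"
  unfolding zero_fun_def by (rule poly_fun_in.const)

lemma poly_fun_in_1: "1 \<in> poly_fun_in F"
  unfolding one_fun_def by (rule poly_fun_in.const)

lemma poly_fun_in_uminus: "p \<in> poly_fun_in F \<Longrightarrow> - p \<in> poly_fun_in F"
  using poly_fun_in.mult[OF poly_fun_in.const[of "-1" F], of p] by (simp add: fun_Compl_def)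

lemma poly_fun_in_minus: "p \<in> poly_fun_in F \<Longrightarrow> q \<in> poly_fun_in F \<Longrightarrow> p - q \<in> poly_fun_in F"
  using poly_fun_in_plus[OF _ poly_fun_in_uminus, of p F q] by simp

lemma poly_fun_in_power: "p \<in> poly_fun_in F \<Longrightarrow> p ^ n \<in> poly_fun_in F"
  by (induction n) (auto intro: poly_fun_in_times poly_fun_in_1)

lemma poly_fun_in_sum: "(\<And>s. s \<in> S \<Longrightarrow> f s \<in> poly_fun_in F) \<Longrightarrow> sum f S \<in> poly_fun_in F"
  by (induction S rule: infinite_finite_induct) (auto intro: poly_fun_in_plus poly_fun_in_0)

lemma poly_fun_in_prod: "(\<And>s. s \<in> S \<Longrightarrow> f s \<in> poly_fun_in F) \<Longrightarrow> prod f S \<in> poly_fun_in F"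
  by (induction S rule: infinite_finite_induct) (auto intro: poly_fun_in_times poly_fun_in_1)

lemmas poly_fun_in_closed = poly_fun_in.const poly_fun_in.coord poly_fun_in_plus poly_fun_in_times
  poly_fun_in_0 poly_fun_in_1 poly_fun_in_uminus poly_fun_in_minus poly_fun_in_power
  poly_fun_in_sum poly_fun_in_prod

lemmas poly_fun_closed = poly_fun_in_closed[where F = UNIV, unfolded poly_fun_in_UNIV]

lemma sum_fun_apply: "sum f S x = (\<Sum>s\<in>S. f s x)"
  by (induction S rule: infinite_finite_induct) auto

lemma prod_fun_apply: "prod f S x = (\<Prod>s\<in>S. f s x)"
  by (induction S rule: infinite_finite_induct) auto

lemma power_fun_apply: "(f ^ n) x = f x ^ n"
  by (induction n) auto

lemma uminus_fun_apply: "(- f) x = - f x" by (simp add: fun_Compl_def)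


section \<open>Polynomials in one coordinate whose coefficients are functions of other
  coordinates\<close>

definition coeffs_in :: "'a::zero set \<Rightarrow> 'a poly set" where
  "coeffs_in A = {P. \<forall>k. coeff P k \<in> A}"

abbreviation eval_coeffs :: "'a \<Rightarrow> ('a \<Rightarrow> 'k::comm_ring_1) poly \<Rightarrow> 'k poly" where
  "eval_coeffs x \<equiv> map_poly (\<lambda>c. c x)"

abbreviation at_coord :: "(('i \<Rightarrow> 'k::comm_ring_1) \<Rightarrow> 'k) poly \<Rightarrow> 'i \<Rightarrow> ('i \<Rightarrow> 'k) \<Rightarrow> 'k" where
  "at_coord P i \<equiv> poly P (\<lambda>x. x i)"

lemma coeff_eval_coeffs [simp]: "coeff (eval_coeffs x P) k = coeff P k x"
  by (simp add: coeff_map_poly)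

lemma eval_coeffs_arith:
  "eval_coeffs x (P + Q) = eval_coeffs x P + eval_coeffs x Q"
  "eval_coeffs x (P - Q) = eval_coeffs x P - eval_coeffs x Q"
  "eval_coeffs x (P * Q) = eval_coeffs x P * eval_coeffs x Q"
  "eval_coeffs x (smult c P) = smult (c x) (eval_coeffs x P)"
  by (auto intro!: poly_eqI simp: coeff_mult sum_fun_apply)

lemma poly_fun_apply: "poly P f x = poly (eval_coeffs x P) (f x)"
  by (induction P) (auto simp: map_poly_pCons)

lemma coeffs_in_closed:
  "P \<in> coeffs_in (poly_fun_in F) \<Longrightarrow> Q \<in> coeffs_in (poly_fun_in F) \<Longrightarrow> P + Q \<in> coeffs_in (poly_fun_in F)"
  "P \<in> coeffs_in (poly_fun_in F) \<Longrightarrow> Q \<in> coeffs_in (poly_fun_in F) \<Longrightarrow> P - Q \<in> coeffs_in (poly_fun_in F)"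
  "P \<in> coeffs_in (poly_fun_in F) \<Longrightarrow> Q \<in> coeffs_in (poly_fun_in F) \<Longrightarrow> P * Q \<in> coeffs_in (poly_fun_in F)"
  "c \<in> poly_fun_in F \<Longrightarrow> P \<in> coeffs_in (poly_fun_in F) \<Longrightarrow> smult c P \<in> coeffs_in (poly_fun_in F)"
  "c \<in> poly_fun_in F \<Longrightarrow> monom c n \<in> coeffs_in (poly_fun_in F)"
  "c \<in> poly_fun_in F \<Longrightarrow> [:c:] \<in> coeffs_in (poly_fun_in F)"
  "0 \<in> coeffs_in (poly_fun_in F)"
  "1 \<in> coeffs_in (poly_fun_in F)"
  by (auto simp: coeffs_in_def coeff_mult coeff_pCons intro!: poly_fun_in_closed split: nat.splits)

lemma at_coord_poly_fun_in:
  assumes "P \<in> coeffs_in (poly_fun_in F)"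
  shows "at_coord P i \<in> poly_fun_in (insert i F)"
  using assms unfolding poly_altdef coeffs_in_def
  by (intro poly_fun_in_closed) (auto intro: poly_fun_in_mono)

lemma poly_fun_in_insertE:
  assumes "p \<in> poly_fun_in (insert i F)"
  obtains P where "P \<in> coeffs_in (poly_fun_in F)" "p = at_coord P i"
proof -
  have "\<exists>P\<in>coeffs_in (poly_fun_in F). p = at_coord P i"
    using assms
  proof (induction rule: poly_fun_in.induct)
    case (const c)
    show ?case by (rule bexI[of _ "[:\<lambda>_. c:]"]) (auto intro: coeffs_in_closed poly_fun_in.const)
  next
    case (coord j)
    show ?case
    proof (cases "j = i")
      case True
      show ?thesis
        by (rule bexI[of _ "monom 1 1"])
          (auto simp: True poly_monom intro: coeffs_in_closed poly_fun_in_1)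
    next
      case False
      with coord show ?thesis
        by (intro bexI[of _ "[:\<lambda>x. x j:]"]) (auto intro: coeffs_in_closed poly_fun_in.coord)
    qed
  next
    case (add p q)
    then obtain P Q where "P \<in> coeffs_in (poly_fun_in F)" "p = at_coord P i"
      "Q \<in> coeffs_in (poly_fun_in F)" "q = at_coord Q i" by blast
    then show ?case
      by (intro bexI[of _ "P + Q"]) (auto simp: fun_eq_iff intro: coeffs_in_closed)
  next
    case (mult p q)
    then obtain P Q where "P \<in> coeffs_in (poly_fun_in F)" "p = at_coord P i"
      "Q \<in> coeffs_in (poly_fun_in F)" "q = at_coord Q i" by blast
    then show ?case
      by (intro bexI[of _ "P * Q"]) (auto simp: fun_eq_iff intro: coeffs_in_closed)
  qed
  then show ?thesis using that by blast
qed

text \<open>If \<open>P\<close> vanished everywhere, \<open>P * monom 1 1 + 1\<close> would have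
  positive degree and take only the value 1.\<close>

lemma alg_closed_nonroot:
  fixes P :: "'k::alg_closed_field poly"
  assumes "P \<noteq> 0"
  shows "\<exists>t. poly P t \<noteq> 0"
proof (rule ccontr)
  assume "\<nexists>t. poly P t \<noteq> 0"
  moreover have "degree (P * monom 1 1 + 1) > 0"
    using assms by (simp add: degree_add_eq_left degree_mult_eq degree_monom_eq)
  then obtain t where "poly (P * monom 1 1 + 1) t = 0" using alg_closed_imp_poly_has_root by blast
  ultimately show False by simp
qed

section \<open>Irreducibility as primality of the vanishing ideal\<close>

abbreviation vanishes_on :: "'a set \<Rightarrow> ('a \<Rightarrow> 'k::zero) \<Rightarrow> bool" where
  "vanishes_on X p \<equiv> \<forall>x\<in>X. p x = 0"

text \<open>Nonempty sets with prime vanishing ideal. This form applies directly to images of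
  regular maps, which need not be closed; \<open>irreducible_in_zariski\<close> shows that it agrees
  with topological irreducibility.\<close>

definition irr :: "('i \<Rightarrow> 'k::field) set \<Rightarrow> bool" where
  "irr X \<longleftrightarrow> X \<noteq> {} \<and> (\<forall>p\<in>poly_fun. \<forall>q\<in>poly_fun.
     vanishes_on X (\<lambda>x. p x * q x) \<longrightarrow> vanishes_on X p \<or> vanishes_on X q)"

lemma irr_mult:
  assumes "irr X" "p \<in> poly_fun" "q \<in> poly_fun" "\<not> vanishes_on X p" "\<not> vanishes_on X q"
  obtains x where "x \<in> X" "p x \<noteq> 0" "q x \<noteq> 0"
proof -
  have "\<not> vanishes_on X (\<lambda>x. p x * q x)" using assms unfolding irr_def by blast
  then show ?thesis using that by auto
qed

lemma irr_times:
  assumes "irr X" "p \<in> poly_fun" "q \<in> poly_fun" "\<not> vanishes_on X p" "\<not> vanishes_on X q"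
  shows "\<not> vanishes_on X (p * q)"
proof -
  obtain x where "x \<in> X" "p x \<noteq> 0" "q x \<noteq> 0" by (rule irr_mult[OF assms])
  then show ?thesis by auto
qed

lemma irr_power:
  assumes "irr X" "p \<in> poly_fun" "\<not> vanishes_on X p"
  shows "\<not> vanishes_on X (p ^ n)"
  using assms by (auto simp: power_fun_apply)

lemma irr_prod:
  assumes "irr X" "finite S" "\<And>s. s \<in> S \<Longrightarrow> f s \<in> poly_fun"
    "\<And>s. s \<in> S \<Longrightarrow> \<not> vanishes_on X (f s)"
  shows "\<not> vanishes_on X (prod f S)"
  using assms(2,3,4)
proof (induction S rule: finite_induct)
  case empty
  show ?case using assms(1) by (auto simp: irr_def)
next
  case (insert s S)
  have "prod f S \<in> poly_fun" by (rule poly_fun_closed) (simp add: insert.prems)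
  moreover have "f s \<in> poly_fun" "\<not> vanishes_on X (f s)" using insert.prems by blast+
  moreover have "\<not> vanishes_on X (prod f S)" using insert.IH insert.prems by blast
  ultimately have "\<not> vanishes_on X (f s * prod f S)" by (intro irr_times[OF assms(1)])
  then show ?case using insert.hyps by simp
qed

text \<open>Leading coefficients are not invertible, so each division step first multiplies
  \<open>Q\<close> by \<open>lead_coeff P\<close> and then cancels the leading term. The bound on
  the degree of \<open>S\<close> serves later to show that the quotient of a shortest relation by a
  polynomial of positive degree is too short to be a nontrivial relation.\<close>

lemma pseudo_division:
  fixes P Q :: "(('i \<Rightarrow> 'k::comm_ring_1) \<Rightarrow> 'k) poly"
  assumes P: "P \<in> coeffs_in (poly_fun_in F)" "degree P > 0"
    and Q: "Q \<in> coeffs_in (poly_fun_in F)"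
  obtains n S R where "S \<in> coeffs_in (poly_fun_in F)" "R \<in> coeffs_in (poly_fun_in F)"
    "smult (lead_coeff P ^ n) Q = S * P + R" "degree R < degree P" "degree S \<le> degree Q - degree P"
proof -
  have "\<exists>n S R. S \<in> coeffs_in (poly_fun_in F) \<and> R \<in> coeffs_in (poly_fun_in F) \<and>
    smult (lead_coeff P ^ n) Q = S * P + R \<and> degree R < degree P \<and> degree S \<le> degree Q - degree P"
    using Q
  proof (induction "degree Q" arbitrary: Q rule: less_induct)
    case less
    show ?case
    proof (cases "degree Q < degree P")
      case True
      then show ?thesis using less.prems
        by (intro exI[of _ 0] exI[of _ 0] exI[of _ Q]) (auto intro: coeffs_in_closed)
    next
      case False
      define d e where "d = degree Q" and "e = degree P"
      have le: "e \<le> d" "0 < e" using False P by (auto simp: d_def e_def)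
      define M where "M = monom (lead_coeff Q) (d - e)"
      define Q' where "Q' = smult (lead_coeff P) Q - M * P"
      have lc: "lead_coeff Q \<in> poly_fun_in F" "lead_coeff P \<in> poly_fun_in F"
        using less.prems P by (auto simp: coeffs_in_def)
      have M: "M \<in> coeffs_in (poly_fun_in F)" unfolding M_def using lc by (intro coeffs_in_closed)
      have Q': "Q' \<in> coeffs_in (poly_fun_in F)" unfolding Q'_def
        using M P less.prems lc by (intro coeffs_in_closed)
      have "degree Q' < d"
      proof -
        have "coeff Q' k = 0" if "k \<ge> d" for k
        proof (cases "k = d")
          case True
          have "coeff (M * P) d = lead_coeff Q * lead_coeff P"
            using le by (simp add: M_def coeff_monom_mult e_def)
          then show ?thesis by (simp add: True Q'_def d_def mult.commute)
        next
          case False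
          with that have "k > d" by simp
          moreover from this have "coeff P (k - (d - e)) = 0"
            using le by (intro coeff_eq_0) (auto simp: e_def)
          ultimately show ?thesis
            by (simp add: Q'_def M_def coeff_monom_mult d_def coeff_eq_0)
        qed
        then have "degree Q' \<le> d - 1" using le by (intro degree_le) auto
        then show ?thesis using le by linarith
      qed
      from less.hyps[OF this[unfolded d_def] Q'] obtain n S R where IH:
        "S \<in> coeffs_in (poly_fun_in F)" "R \<in> coeffs_in (poly_fun_in F)"
        "smult (lead_coeff P ^ n) Q' = S * P + R" "degree R < e" "degree S \<le> degree Q' - e"
        unfolding e_def by blast
      have "smult (lead_coeff P ^ Suc n) Q = smult (lead_coeff P ^ n) (Q' + M * P)"
        by (simp add: Q'_def mult.commute)
      also have "\<dots> = S * P + R + smult (lead_coeff P ^ n) M * P"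
        by (simp only: smult_add_right IH(3) mult_smult_left)
      also have "\<dots> = (S + smult (lead_coeff P ^ n) M) * P + R"
        by (simp only: distrib_right add_ac)
      finally have eq: "smult (lead_coeff P ^ Suc n) Q = (S + smult (lead_coeff P ^ n) M) * P + R" .
      have "degree (S + smult (lead_coeff P ^ n) M) \<le> d - e"
      proof (rule degree_add_le)
        show "degree S \<le> d - e" using IH(5) \<open>degree Q' < d\<close> by linarith
        show "degree (smult (lead_coeff P ^ n) M) \<le> d - e"
          unfolding M_def by (metis degree_monom_le degree_smult_le order_trans)
      qed
      moreover have "S + smult (lead_coeff P ^ n) M \<in> coeffs_in (poly_fun_in F)"
        using IH M lc by (intro coeffs_in_closed poly_fun_in_closed)
      ultimately show ?thesis using eq IH unfolding d_def e_def by blast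
    qed
  qed
  then show ?thesis using that by blast
qed


section \<open>Lifting points of coordinate projections\<close>

lemma at_coord_upd:
  assumes "P \<in> coeffs_in (poly_fun_in F)" "i \<notin> F"
  shows "at_coord P i (p(i := t)) = poly (eval_coeffs p P) t"
proof -
  have "eval_coeffs (p(i := t)) P = eval_coeffs p P"
    using assms by (intro poly_eqI) (auto simp: coeffs_in_def poly_fun_in_upd[of _ F])
  then show ?thesis by (simp add: poly_fun_apply)
qed

lemma at_coord_eq_on:
  assumes "\<And>k. coeff P k x = coeff Q k x"
  shows "at_coord P i x = at_coord Q i x"
proof -
  have "eval_coeffs x P = eval_coeffs x Q" using assms by (intro poly_eqI) auto
  then show ?thesis by (simp add: poly_fun_apply)
qed

text \<open>The formal leading coefficient may vanish on \<open>X\<close>. Removing such a term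
  changes no coefficient as a function on \<open>X\<close>, and the process stops because some
  coefficient survives.\<close>

lemma drop_vanishing_leading_terms:
  assumes "P \<in> coeffs_in (poly_fun_in F)" "\<exists>k. \<not> vanishes_on X (coeff P k)"
  shows "\<exists>P'\<in>coeffs_in (poly_fun_in F). \<not> vanishes_on X (lead_coeff P') \<and>
    degree P' \<le> degree P \<and> (\<forall>k. \<forall>x\<in>X. coeff P' k x = coeff P k x)"
  using assms
proof (induction "degree P" arbitrary: P rule: less_induct)
  case less
  show ?case
  proof (cases "vanishes_on X (lead_coeff P)")
    case False
    with less.prems show ?thesis by blast
  next
    case True
    define P1 where "P1 = P - monom (lead_coeff P) (degree P)"
    have P1: "P1 \<in> coeffs_in (poly_fun_in F)"
      unfolding P1_def using less.prems(1)
      by (intro coeffs_in_closed) (auto simp: coeffs_in_def)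
    have eq: "coeff P1 k x = coeff P k x" if "x \<in> X" for k x
      using True that by (auto simp: P1_def)
    have nz: "\<exists>k. \<not> vanishes_on X (coeff P1 k)"
      using less.prems(2) eq by auto
    have c0: "coeff P1 k = 0" if "k \<ge> degree P" for k
      using that by (cases "k = degree P") (auto simp: P1_def coeff_eq_0)
    have "degree P \<noteq> 0"
    proof
      assume "degree P = 0"
      then have "coeff P1 k = 0" for k using c0[of k] by simp
      then show False using nz by auto
    qed
    then have "degree P1 < degree P"
      using degree_le[of "degree P - 1" P1] c0 by fastforce
    from less.hyps[OF this P1 nz] obtain P' where "P' \<in> coeffs_in (poly_fun_in F)"
      "\<not> vanishes_on X (lead_coeff P')" "degree P' \<le> degree P1"
      "\<forall>k. \<forall>x\<in>X. coeff P' k x = coeff P1 k x" by blast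
    then show ?thesis using eq \<open>degree P1 < degree P\<close> by (intro bexI[of _ P']) auto
  qed
qed

lemma vanishing_at_coord_coeff:
  assumes "\<not> vanishes_on X (at_coord P i)"
  shows "\<exists>k. \<not> vanishes_on X (coeff P k)"
proof (rule ccontr)
  assume "\<nexists>k. \<not> vanishes_on X (coeff P k)"
  then have "at_coord P i x = at_coord 0 i x" if "x \<in> X" for x
    using that by (intro at_coord_eq_on) auto
  then show False using assms by auto
qed

text \<open>The points whose \<open>F\<close>-coordinates lie in the Zariski closure of the projection of \<open>X\<close>
  to the \<open>F\<close>-coordinates.\<close>

definition proj_closure :: "'i set \<Rightarrow> ('i \<Rightarrow> 'k::comm_ring_1) set \<Rightarrow> ('i \<Rightarrow> 'k) set" where
  "proj_closure F X = {p. \<forall>q\<in>poly_fun_in F. vanishes_on X q \<longrightarrow> q p = 0}"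

lemma proj_closureD:
  "p \<in> proj_closure F X \<Longrightarrow> q \<in> poly_fun_in F \<Longrightarrow> vanishes_on X q \<Longrightarrow> q p = 0"
  by (auto simp: proj_closure_def)

text \<open>Without relations for the \<open>i\<close>-th coordinate, every \<open>t\<close> is
  compatible with the functions vanishing on \<open>X\<close>. Only \<open>v\<close> restricts
  \<open>t\<close>: with \<open>u\<close> a coefficient of \<open>v\<close> as a polynomial in that
  coordinate, \<open>v\<close> stays a nonzero polynomial in \<open>t\<close>.\<close>

lemma extend_point_transcendental:
  fixes X :: "('i \<Rightarrow> 'k::alg_closed_field) set"
  assumes "i \<notin> F" "v \<in> poly_fun_in (insert i F)" "\<not> vanishes_on X v"
    and tr: "\<And>P k. P \<in> coeffs_in (poly_fun_in F) \<Longrightarrow> vanishes_on X (at_coord P i) \<Longrightarrow>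
      vanishes_on X (coeff P k)"
  shows "\<exists>u\<in>poly_fun_in F. \<not> vanishes_on X u \<and>
    (\<forall>p\<in>proj_closure F X. u p \<noteq> 0 \<longrightarrow>
      (\<exists>t. p(i := t) \<in> proj_closure (insert i F) X \<and> v (p(i := t)) \<noteq> 0))"
proof -
  obtain V where V: "V \<in> coeffs_in (poly_fun_in F)" "v = at_coord V i"
    using assms(2) by (rule poly_fun_in_insertE)
  obtain k where k: "\<not> vanishes_on X (coeff V k)"
    using vanishing_at_coord_coeff[of X V i] assms(3)[unfolded V(2)] by blast
  have "\<exists>t. p(i := t) \<in> proj_closure (insert i F) X \<and> v (p(i := t)) \<noteq> 0"
    if p: "p \<in> proj_closure F X" "coeff V k p \<noteq> 0" for p
  proof -
    have "eval_coeffs p V \<noteq> 0"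
    proof
      assume "eval_coeffs p V = 0"
      from arg_cong[OF this, of "\<lambda>q. coeff q k"] show False using p(2) by simp
    qed
    then obtain t where t: "poly (eval_coeffs p V) t \<noteq> 0" using alg_closed_nonroot by blast
    have "p(i := t) \<in> proj_closure (insert i F) X"
      unfolding proj_closure_def
    proof safe
      fix q assume q: "q \<in> poly_fun_in (insert i F)" "vanishes_on X q"
      obtain Q where Q: "Q \<in> coeffs_in (poly_fun_in F)" "q = at_coord Q i"
        using q(1) by (rule poly_fun_in_insertE)
      have "coeff Q k p = 0" for k
        using tr[OF Q(1), of k] q(2) Q p(1) by (auto simp: coeffs_in_def intro: proj_closureD)
      then have "eval_coeffs p Q = 0" by (intro poly_eqI) auto
      then show "q (p(i := t)) = 0" using Q assms(1) by (simp add: at_coord_upd)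
    qed
    moreover have "v (p(i := t)) \<noteq> 0" using V t assms(1) by (simp add: at_coord_upd)
    ultimately show ?thesis by blast
  qed
  moreover have "coeff V k \<in> poly_fun_in F" using V by (auto simp: coeffs_in_def)
  ultimately show ?thesis using k by blast
qed

lemma lead_coeff_in: "P \<in> coeffs_in A \<Longrightarrow> lead_coeff P \<in> A"
  by (auto simp: coeffs_in_def)

text \<open>A relation \<open>P\<close> of least degree acts as a minimal polynomial: any other
  relation, times a power of the leading coefficient \<open>p0\<close>, is a multiple of
  \<open>P\<close> up to a remainder whose coefficients vanish on \<open>X\<close>. Hence a root of
  \<open>P\<close> at \<open>p\<close> satisfies all relations if \<open>p0 p \<noteq> 0\<close>.
  The second factor \<open>r\<close> of \<open>u\<close> keeps \<open>v\<close> nonzero at the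
  root.\<close>

lemma extend_point_algebraic:
  fixes X :: "('i \<Rightarrow> 'k::alg_closed_field) set"
  assumes irr: "irr X" and i: "i \<notin> F" and v: "v \<in> poly_fun_in (insert i F)" "\<not> vanishes_on X v"
    and alg: "P0 \<in> coeffs_in (poly_fun_in F)" "vanishes_on X (at_coord P0 i)"
      "\<not> vanishes_on X (coeff P0 k0)"
  shows "\<exists>u\<in>poly_fun_in F. \<not> vanishes_on X u \<and>
    (\<forall>p\<in>proj_closure F X. u p \<noteq> 0 \<longrightarrow>
      (\<exists>t. p(i := t) \<in> proj_closure (insert i F) X \<and> v (p(i := t)) \<noteq> 0))"
proof -
  let ?A = "coeffs_in (poly_fun_in F)"
  note pf = poly_fun_in_poly_fun[of _ F] poly_fun_in_poly_fun[of _ "insert i F"]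
  obtain V where V: "V \<in> ?A" "v = at_coord V i"
    using v(1) by (rule poly_fun_in_insertE)
  define S where "S = {P\<in>?A. vanishes_on X (at_coord P i) \<and> (\<exists>k. \<not> vanishes_on X (coeff P k))}"
  have "P0 \<in> S" using alg by (auto simp: S_def)
  then obtain P1 where P1: "P1 \<in> S" "\<And>Q. Q \<in> S \<Longrightarrow> degree P1 \<le> degree Q"
    using ex_has_least_nat[of "\<lambda>P. P \<in> S" P0 degree] by blast
  then have "P1 \<in> ?A" "\<exists>k. \<not> vanishes_on X (coeff P1 k)" by (auto simp: S_def)
  from drop_vanishing_leading_terms[OF this]
  obtain P where P: "P \<in> ?A" "\<not> vanishes_on X (lead_coeff P)"
    "degree P \<le> degree P1" "\<forall>k. \<forall>x\<in>X. coeff P k x = coeff P1 k x" by blast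
  have P0: "at_coord P i x = 0" if "x \<in> X" for x
    using at_coord_eq_on[of P x P1 i] P(4) P1(1) that by (auto simp: S_def)
  have min: "vanishes_on X (coeff Q k)" if "Q \<in> ?A" "vanishes_on X (at_coord Q i)"
    "degree Q < degree P" for Q k
    using P1(2)[of Q] P(3) that by (auto simp: S_def)
  define p0 where "p0 = lead_coeff P"
  have p0: "p0 \<in> poly_fun_in F" "\<not> vanishes_on X p0" using P lead_coeff_in by (auto simp: p0_def)
  have degP: "degree P > 0"
  proof (rule ccontr)
    assume "\<not> degree P > 0"
    then obtain c where "P = [:c:]" by (auto elim: degree_eq_zeroE)
    then show False using P0 P(2) by auto
  qed

  \<comment> \<open>An element of least degree in the ideal of \<open>v\<close> modulo the relations of \<open>x\<^sub>i\<close> turns out to be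
    constant in \<open>x\<^sub>i\<close>; where it does not vanish, \<open>v\<close> does not vanish at the roots of \<open>P\<close>.\<close>
  define M where "M = {R\<in>?A. \<not> vanishes_on X (at_coord R i) \<and>
    (\<exists>T\<in>?A. \<forall>x\<in>X. at_coord R i x = at_coord T i x * v x)}"
  have "V \<in> M" using V v(2) by (auto simp: M_def intro!: bexI[of _ 1] coeffs_in_closed)
  then obtain R1 where R1: "R1 \<in> M" "\<And>Q. Q \<in> M \<Longrightarrow> degree R1 \<le> degree Q"
    using ex_has_least_nat[of "\<lambda>P. P \<in> M" V degree] by blast
  then have "R1 \<in> ?A" "\<exists>k. \<not> vanishes_on X (coeff R1 k)"
    using vanishing_at_coord_coeff[of X R1 i] by (auto simp: M_def)
  from drop_vanishing_leading_terms[OF this]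
  obtain R where R: "R \<in> ?A" "\<not> vanishes_on X (lead_coeff R)"
    "degree R \<le> degree R1" "\<forall>k. \<forall>x\<in>X. coeff R k x = coeff R1 k x" by blast
  have "at_coord R i x = at_coord R1 i x" if "x \<in> X" for x
    using at_coord_eq_on[of R x R1 i] R(4) that by auto
  then have RM: "R \<in> M" and Rmin: "\<And>Q. Q \<in> M \<Longrightarrow> degree R \<le> degree Q"
    using R1 R(1,3) by (auto simp: M_def intro: le_trans)
  obtain T where T: "T \<in> ?A" "\<And>x. x \<in> X \<Longrightarrow> at_coord R i x = at_coord T i x * v x"
    using RM by (auto simp: M_def)
  have Rnz: "\<not> vanishes_on X (at_coord R i)" using RM by (auto simp: M_def)
  have at_R: "at_coord Q i \<in> poly_fun" if "Q \<in> ?A" for Q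
    using at_coord_poly_fun_in[OF that, of i] pf(2) by blast
  have vP: "v \<in> poly_fun" using v(1) pf(2) by blast

  \<comment> \<open>Reduction modulo \<open>P\<close> multiplies the values on \<open>X\<close> by a
    power of \<open>p0\<close> and stays in \<open>M\<close>, so an element of least degree is
    already reduced.\<close>
  have RP: "degree R < degree P"
  proof -
    obtain n S' R' where d: "S' \<in> ?A" "R' \<in> ?A" "smult (p0 ^ n) R = S' * P + R'"
      "degree R' < degree P"
      using pseudo_division[OF P(1) degP R(1)] unfolding p0_def by metis
    have eq: "at_coord R' i x = p0 x ^ n * at_coord R i x" if "x \<in> X" for x
      using arg_cong[OF d(3), of "\<lambda>Q. at_coord Q i x"] P0[OF that] by (simp add: power_fun_apply)
    have "\<not> vanishes_on X (p0 ^ n * at_coord R i)"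
      using p0 R(1) Rnz pf(1) at_R
      by (intro irr_times[OF irr] irr_power[OF irr] poly_fun_closed) auto
    then have "\<not> vanishes_on X (at_coord R' i)" using eq by (auto simp: power_fun_apply)
    moreover have "smult (p0 ^ n) T \<in> ?A"
      using p0 T by (intro coeffs_in_closed poly_fun_in_closed)
    moreover have "\<forall>x\<in>X. at_coord R' i x = at_coord (smult (p0 ^ n) T) i x * v x"
      using eq T(2) by (simp add: power_fun_apply)
    ultimately have "R' \<in> M" unfolding M_def using d by blast
    then show ?thesis using Rmin d(4) by fastforce
  qed

  \<comment> \<open>Otherwise dividing \<open>P\<close> by \<open>R\<close> leaves a remainder of
    smaller degree that is a multiple of \<open>v\<close> on \<open>X\<close>; by minimality it
    vanishes on \<open>X\<close>. Then the quotient is a relation shorter than \<open>P\<close>, so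
    its coefficients vanish on \<open>X\<close>, and comparing the coefficients of degree
    \<open>degree P\<close> is contradictory.\<close>
  have R0: "degree R = 0"
  proof (rule ccontr)
    assume "degree R \<noteq> 0"
    then have "degree R > 0" by simp
    from pseudo_division[OF R(1) this P(1)] obtain n S' R' where d:
      "S' \<in> ?A" "R' \<in> ?A" "smult (lead_coeff R ^ n) P = S' * R + R'"
      "degree R' < degree R" "degree S' \<le> degree P - degree R" by metis
    have eq: "at_coord R' i x = - at_coord S' i x * at_coord R i x" if "x \<in> X" for x
      using arg_cong[OF d(3), of "\<lambda>Q. at_coord Q i x"] P0[OF that]
      by (simp add: power_fun_apply eq_neg_iff_add_eq_0 add.commute)
    have "R' \<notin> M" using Rmin d(4) by fastforce
    moreover have "0 - S' * T \<in> ?A" using d T by (intro coeffs_in_closed)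
    moreover have "\<forall>x\<in>X. at_coord R' i x = at_coord (0 - S' * T) i x * v x"
      using eq T(2) by (simp add: uminus_fun_apply)
    ultimately have "vanishes_on X (at_coord R' i)" using d(2) unfolding M_def by blast
    then have "vanishes_on X (\<lambda>x. at_coord S' i x * at_coord R i x)" using eq by auto
    then have "vanishes_on X (at_coord S' i)"
      using irr at_R[OF d(1)] at_R[OF R(1)] Rnz unfolding irr_def by blast
    then have S0: "vanishes_on X (coeff S' k)" for k
      using d(1,5) \<open>degree R > 0\<close> degP by (intro min) auto
    have "coeff (S' * R) k x = 0" if "x \<in> X" for k x
      using S0 that by (auto simp: coeff_mult sum_fun_apply)
    moreover have "coeff R' (degree P) = 0" using d(4) RP by (intro coeff_eq_0) simp
    ultimately have "(lead_coeff R ^ n * p0) x = 0" if "x \<in> X" for x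
      using arg_cong[OF d(3), of "\<lambda>Q. coeff Q (degree P) x"] that by (simp add: p0_def)
    moreover have "lead_coeff R \<in> poly_fun" "p0 \<in> poly_fun"
      using lead_coeff_in[OF R(1)] p0 pf(1) by blast+
    then have "\<not> vanishes_on X (lead_coeff R ^ n * p0)"
      using R(2) p0(2) by (intro irr_times[OF irr] irr_power[OF irr] poly_fun_closed) auto
    ultimately show False by blast
  qed
  define r where "r = lead_coeff R"
  have Rr: "R = [:r:]" using R0 unfolding r_def by (auto elim: degree_eq_zeroE)
  have r: "r \<in> poly_fun_in F" "\<not> vanishes_on X r" using lead_coeff_in[OF R(1)] R(2) by (auto simp: r_def)

  have "\<exists>t. p(i := t) \<in> proj_closure (insert i F) X \<and> v (p(i := t)) \<noteq> 0"
    if p: "p \<in> proj_closure F X" "(p0 * r) p \<noteq> 0" for p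
  proof -
    have nz: "p0 p \<noteq> 0" "r p \<noteq> 0" using p by auto
    have "coeff (eval_coeffs p P) (degree P) \<noteq> 0" using nz by (simp add: p0_def)
    then have "degree (eval_coeffs p P) > 0" using le_degree degP by (blast intro: less_le_trans)
    then obtain t where t: "poly (eval_coeffs p P) t = 0"
      using alg_closed_imp_poly_has_root by blast
    have rel: "at_coord Q i (p(i := t)) = 0" if Q: "Q \<in> ?A" "vanishes_on X (at_coord Q i)" for Q
    proof -
      obtain n S' R' where d: "S' \<in> ?A" "R' \<in> ?A" "smult (p0 ^ n) Q = S' * P + R'"
        "degree R' < degree P"
        using pseudo_division[OF P(1) degP Q(1)] unfolding p0_def by metis
      have R'0: "vanishes_on X (at_coord R' i)"
      proof
        fix x assume x: "x \<in> X"
        show "at_coord R' i x = 0"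
          using arg_cong[OF d(3), of "\<lambda>Q. at_coord Q i x"] P0[OF x] Q(2) x by simp
      qed
      have "vanishes_on X (coeff R' k)" for k by (rule min[OF d(2) R'0 d(4)])
      then have "coeff R' k p = 0" for k
        using d(2) p(1) by (auto simp: coeffs_in_def intro: proj_closureD)
      then have "eval_coeffs p R' = 0" by (intro poly_eqI) auto
      then have "p0 p ^ n * poly (eval_coeffs p Q) t = 0"
        using arg_cong[OF d(3), of "\<lambda>Q. poly (eval_coeffs p Q) t"] t
        by (simp add: eval_coeffs_arith power_fun_apply)
      then show ?thesis using nz Q i by (simp add: at_coord_upd)
    qed
    have "p(i := t) \<in> proj_closure (insert i F) X"
      unfolding proj_closure_def
    proof safe
      fix q assume q: "q \<in> poly_fun_in (insert i F)" "vanishes_on X q"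
      obtain Q where Q: "Q \<in> ?A" "q = at_coord Q i"
        using q(1) by (rule poly_fun_in_insertE)
      then show "q (p(i := t)) = 0" using rel q by blast
    qed
    \<comment> \<open>The identity \<open>r = T * v\<close> on \<open>X\<close> is itself a
      relation, so it persists at the new point, where \<open>r\<close> still has the value
      \<open>r p \<noteq> 0\<close>.\<close>
    moreover have "at_coord (R - T * V) i (p(i := t)) = 0"
    proof (rule rel)
      show "R - T * V \<in> ?A" using R T V by (intro coeffs_in_closed)
      show "vanishes_on X (at_coord (R - T * V) i)" using T(2) V(2) by simp
    qed
    then have "at_coord T i (p(i := t)) * v (p(i := t)) = r (p(i := t))"
      using V(2) by (simp add: Rr)
    then have "v (p(i := t)) \<noteq> 0" using nz r(1) i by (auto simp: poly_fun_in_upd[of _ F])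
    ultimately show ?thesis by blast
  qed
  moreover have "p0 * r \<in> poly_fun_in F" using p0 r by (intro poly_fun_in_closed)
  moreover have "\<not> vanishes_on X (p0 * r)" using p0 r pf(1) by (intro irr_times[OF irr]) auto
  ultimately show ?thesis by blast
qed

lemma extend_point_step:
  fixes X :: "('i \<Rightarrow> 'k::alg_closed_field) set"
  assumes "irr X" "i \<notin> F" "v \<in> poly_fun_in (insert i F)" "\<not> vanishes_on X v"
  shows "\<exists>u\<in>poly_fun_in F. \<not> vanishes_on X u \<and>
    (\<forall>p\<in>proj_closure F X. u p \<noteq> 0 \<longrightarrow>
      (\<exists>t. p(i := t) \<in> proj_closure (insert i F) X \<and> v (p(i := t)) \<noteq> 0))"
  using extend_point_algebraic[OF assms] extend_point_transcendental[OF assms(2-4)] by blast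

text \<open>For closed \<open>X\<close> this is Chevalley's theorem in the form needed: the
  projection contains a nonempty open part of its closure, even after the zeros of \<open>v\<close>
  are removed. Coordinates are added one at a time, and the nonvanishing condition found for
  \<open>insert i F\<close> takes the place of \<open>v\<close> in the step from
  \<open>F\<close>.\<close>

lemma extend_point:
  fixes X :: "('i::finite \<Rightarrow> 'k::alg_closed_field) set"
  assumes "irr X" "v \<in> poly_fun" "\<not> vanishes_on X v"
  shows "\<exists>u\<in>poly_fun_in F. \<not> vanishes_on X u \<and>
    (\<forall>p\<in>proj_closure F X. u p \<noteq> 0 \<longrightarrow>
      (\<exists>p'\<in>proj_closure UNIV X. (\<forall>i\<in>F. p' i = p i) \<and> v p' \<noteq> 0))"
proof -
  have "finite (- F)" by simp
  then show ?thesis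
  proof (induction "- F" arbitrary: F rule: finite_induct)
    case empty
    then have "F = UNIV" by auto
    then show ?case using assms by (intro bexI[of _ v]) (auto simp: poly_fun_in_UNIV)
  next
    case (insert i E)
    have i: "i \<notin> F" and E: "E = - insert i F" using insert.hyps(2,4) by auto
    from insert.hyps(3)[OF E] obtain w where w: "w \<in> poly_fun_in (insert i F)"
      "\<not> vanishes_on X w" and ext: "\<forall>p\<in>proj_closure (insert i F) X. w p \<noteq> 0 \<longrightarrow>
      (\<exists>p'\<in>proj_closure UNIV X. (\<forall>j\<in>insert i F. p' j = p j) \<and> v p' \<noteq> 0)" by blast
    obtain u where u: "u \<in> poly_fun_in F" "\<not> vanishes_on X u" "\<forall>p\<in>proj_closure F X. u p \<noteq> 0 \<longrightarrow>
      (\<exists>t. p(i := t) \<in> proj_closure (insert i F) X \<and> w (p(i := t)) \<noteq> 0)"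
      using extend_point_step[OF assms(1) i w] by blast
    have "\<exists>p'\<in>proj_closure UNIV X. (\<forall>j\<in>F. p' j = p j) \<and> v p' \<noteq> 0"
      if p: "p \<in> proj_closure F X" "u p \<noteq> 0" for p
    proof -
      obtain t where t: "p(i := t) \<in> proj_closure (insert i F) X" "w (p(i := t)) \<noteq> 0"
        using u(3) p by blast
      then obtain p' where "p' \<in> proj_closure UNIV X" "\<forall>j\<in>insert i F. p' j = (p(i := t)) j"
        "v p' \<noteq> 0" using ext by blast
      moreover from this have "\<forall>j\<in>F. p' j = p j" using i by (metis fun_upd_other insertCI)
      ultimately show ?thesis by blast
    qed
    then show ?case using u by blast
  qed
qed


section \<open>Hilbert's basis theorem\<close>

inductive_set ideal_gen :: "'a::comm_ring_1 set \<Rightarrow> 'a set \<Rightarrow> 'a set" for A S where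
  zero: "0 \<in> ideal_gen A S"
| step: "a \<in> A \<Longrightarrow> s \<in> S \<Longrightarrow> x \<in> ideal_gen A S \<Longrightarrow> a * s + x \<in> ideal_gen A S"

lemma ideal_gen_add:
  assumes "x \<in> ideal_gen A S" "y \<in> ideal_gen A S"
  shows "x + y \<in> ideal_gen A S"
  using assms(1)
proof (induction rule: ideal_gen.induct)
  case zero
  then show ?case using assms(2) by simp
next
  case (step a s x)
  then have "a * s + (x + y) \<in> ideal_gen A S" by (intro ideal_gen.step)
  then show ?case by (simp add: add.assoc)
qed

lemma ideal_gen_base: "1 \<in> A \<Longrightarrow> s \<in> S \<Longrightarrow> s \<in> ideal_gen A S"
  using ideal_gen.step[of 1 A s S 0] ideal_gen.zero by fastforce

lemma ideal_gen_mono: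
  assumes "x \<in> ideal_gen A S" "S \<subseteq> T"
  shows "x \<in> ideal_gen A T"
  using assms(1)
proof (induction rule: ideal_gen.induct)
  case (step a s x)
  then show ?case using assms(2) by (intro ideal_gen.step) auto
qed (rule ideal_gen.zero)

lemma ideal_gen_finite:
  assumes "x \<in> ideal_gen A S"
  shows "\<exists>T\<subseteq>S. finite T \<and> x \<in> ideal_gen A T"
  using assms
proof (induction rule: ideal_gen.induct)
  case zero
  show ?case by (intro exI[of _ "{}"]) (auto intro: ideal_gen.zero)
next
  case (step a s x)
  then obtain T where "T \<subseteq> S" "finite T" "x \<in> ideal_gen A T" by blast
  moreover from this have "x \<in> ideal_gen A (insert s T)"
    by (auto intro: ideal_gen_mono)
  ultimately show ?case using step.hyps
    by (intro exI[of _ "insert s T"]) (auto intro: ideal_gen.step)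
qed

text \<open>The finite generating set is taken from \<open>S\<close> itself, which suits descending
  chains: each generator already vanishes on some member of the chain.\<close>

definition noetherian_in :: "'a::comm_ring_1 set \<Rightarrow> bool" where
  "noetherian_in A \<longleftrightarrow> (\<forall>S\<subseteq>A. \<exists>T\<subseteq>S. finite T \<and> S \<subseteq> ideal_gen A T)"

context
  fixes F :: "'i set" and A :: "(('i \<Rightarrow> 'k::comm_ring_1) \<Rightarrow> 'k) set"
  assumes A: "A = poly_fun_in F"
begin

lemma ideal_gen_mult:
  assumes "x \<in> ideal_gen A S" "c \<in> A"
  shows "c * x \<in> ideal_gen A S"
  using assms(1)
proof (induction rule: ideal_gen.induct)
  case zero
  show ?case by (simp only: mult_zero_right ideal_gen.zero)
next
  case (step a s x)
  have "c * a \<in> A" using step.hyps(1) assms(2) unfolding A by (rule poly_fun_in_closed(4)[rotated])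
  then have "(c * a) * s + c * x \<in> ideal_gen A S" using step by (intro ideal_gen.step)
  then show ?case by (simp only: distrib_left mult.assoc)
qed

lemma ideal_gen_minus:
  assumes "x \<in> ideal_gen A S" "y \<in> ideal_gen A S"
  shows "x - y \<in> ideal_gen A S"
proof -
  have "- 1 \<in> A" unfolding A by (intro poly_fun_in_closed)
  from ideal_gen_add[OF assms(1) ideal_gen_mult[OF assms(2) this]] show ?thesis by simp
qed

lemma ideal_gen_sum:
  "(\<And>s. s \<in> J \<Longrightarrow> f s \<in> ideal_gen A S) \<Longrightarrow> sum f J \<in> ideal_gen A S"
  by (induction J rule: infinite_finite_induct) (auto intro: ideal_gen_add ideal_gen.zero)

lemma ideal_gen_trans:
  assumes "x \<in> ideal_gen A S" "S \<subseteq> ideal_gen A T"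
  shows "x \<in> ideal_gen A T"
  using assms(1)
proof (induction rule: ideal_gen.induct)
  case (step a s x)
  have "s \<in> ideal_gen A T" using step.hyps assms(2) by blast
  from ideal_gen_mult[OF this step.hyps(1)] show ?case using step.IH by (rule ideal_gen_add)
qed (rule ideal_gen.zero)

lemma ideal_gen_trans_finite:
  assumes "finite T" "T \<subseteq> ideal_gen A S"
  shows "\<exists>T'\<subseteq>S. finite T' \<and> T \<subseteq> ideal_gen A T'"
  using assms
proof (induction T rule: finite_induct)
  case empty
  show ?case by (intro exI[of _ "{}"]) auto
next
  case (insert x T)
  then obtain T' where T': "T' \<subseteq> S" "finite T'" "T \<subseteq> ideal_gen A T'" by auto
  obtain U where U: "U \<subseteq> S" "finite U" "x \<in> ideal_gen A U"
    using insert.prems ideal_gen_finite[of x A S] by auto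
  have "insert x T \<subseteq> ideal_gen A (T' \<union> U)"
    using T'(3) U(3) ideal_gen_mono[of _ A T' "T' \<union> U"] ideal_gen_mono[of _ A U "T' \<union> U"] by blast
  then show ?case using T' U by (intro exI[of _ "T' \<union> U"]) auto
qed

lemma ideal_gen_image_sum:
  fixes a :: "nat \<Rightarrow> ('i \<Rightarrow> 'k) \<Rightarrow> 'k"
  assumes "x \<in> ideal_gen A (a ` {..<N})"
  shows "\<exists>r. (\<forall>i. r i \<in> A) \<and> x = (\<Sum>i<N. r i * a i)"
  using assms
proof (induction rule: ideal_gen.induct)
  case zero
  show ?case by (intro exI[of _ "\<lambda>_. 0"]) (auto simp: A intro: poly_fun_in_closed)
next
  case (step c s x)
  then obtain r j where r: "\<forall>i. r i \<in> A" "x = (\<Sum>i<N. r i * a i)" and j: "j < N" "s = a j" by blast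
  define r' where "r' = (\<lambda>i. if i = j then c + r i else r i)"
  have "(\<Sum>i<N. r' i * a i) = (\<Sum>i<N. (if i = j then c * a j else 0) + r i * a i)"
    by (intro sum.cong) (auto simp: r'_def distrib_right)
  also have "\<dots> = c * s + x" using j by (simp add: sum.distrib r(2))
  finally have "c * s + x = (\<Sum>i<N. r' i * a i)" by simp
  moreover have "r' i \<in> A" for i
    using r(1) step.hyps(1) by (auto simp: r'_def A intro: poly_fun_in_closed)
  ultimately show ?case by blast
qed

end

lemma noetherian_poly_fun_in_empty:
  "noetherian_in (poly_fun_in {} :: (('i \<Rightarrow> 'k::field) \<Rightarrow> 'k) set)"
proof -
  have const: "\<exists>c. p = (\<lambda>_. c)" if "p \<in> poly_fun_in {}" for p :: "('i \<Rightarrow> 'k) \<Rightarrow> 'k"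
    using that by (induction rule: poly_fun_in.induct) auto
  have "\<exists>T\<subseteq>S. finite T \<and> S \<subseteq> ideal_gen (poly_fun_in {}) T" if S: "S \<subseteq> poly_fun_in {}"
    for S :: "(('i \<Rightarrow> 'k) \<Rightarrow> 'k) set"
  proof (cases "S \<subseteq> {0}")
    case True
    then show ?thesis by (intro exI[of _ "{}"]) (auto intro: ideal_gen.zero)
  next
    case False
    then obtain s where s: "s \<in> S" "s \<noteq> 0" by auto
    obtain c where c: "s = (\<lambda>_. c)" using const s S by blast
    with s have c0: "c \<noteq> 0" by (auto simp: zero_fun_def)
    have "x \<in> ideal_gen (poly_fun_in {}) {s}" if x: "x \<in> S" for x
    proof -
      obtain d where d: "x = (\<lambda>_. d)" using const x S by blast
      have "(\<lambda>_. d / c) * s + 0 \<in> ideal_gen (poly_fun_in {}) {s}"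
        by (intro ideal_gen.step ideal_gen.zero poly_fun_in.const) simp
      also have "(\<lambda>_. d / c) * s + 0 = x" by (simp add: fun_eq_iff c d c0)
      finally show ?thesis .
    qed
    then show ?thesis using s by (intro exI[of _ "{s}"]) auto
  qed
  then show ?thesis by (auto simp: noetherian_in_def)
qed

text \<open>Hilbert's argument: if no finite subset generates, choose successively polynomials of
  least degree outside the ideal of the earlier ones. Finitely many of their leading coefficients
  generate all of them, which allows a leading term to be cancelled against the choice of least
  degree.\<close>

lemma noetherian_poly_fun_in_insert:
  fixes F :: "'i set"
  assumes noeth: "noetherian_in (poly_fun_in F :: (('i \<Rightarrow> 'k::field) \<Rightarrow> 'k) set)"
  shows "noetherian_in (poly_fun_in (insert i F) :: (('i \<Rightarrow> 'k) \<Rightarrow> 'k) set)"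
  unfolding noetherian_in_def
proof (intro allI impI, rule ccontr)
  let ?A = "poly_fun_in F :: (('i \<Rightarrow> 'k) \<Rightarrow> 'k) set"
  let ?B = "poly_fun_in (insert i F) :: (('i \<Rightarrow> 'k) \<Rightarrow> 'k) set"
  fix S assume S: "S \<subseteq> ?B" and nfg: "\<nexists>T. T \<subseteq> S \<and> finite T \<and> S \<subseteq> ideal_gen ?B T"
  define I where "I = ideal_gen ?B S"
  have SI: "S \<subseteq> I" unfolding I_def by (auto intro: ideal_gen_base poly_fun_in_closed)
  have IB: "x \<in> ?B" if "x \<in> I" for x
    using that unfolding I_def
  proof (induction rule: ideal_gen.induct)
    case zero
    show ?case by (rule poly_fun_in_0)
  next
    case (step a s x)
    then show ?case using S by (intro poly_fun_in_plus poly_fun_in_times) auto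
  qed
  \<comment> \<open>A finite set generating \<open>I\<close> would involve only finitely many
    members of \<open>S\<close>, and these would generate \<open>S\<close>.\<close>
  have ex: "\<exists>P\<in>coeffs_in ?A. at_coord P i \<in> I \<and> at_coord P i \<notin> ideal_gen ?B T"
    if T: "finite T" "T \<subseteq> I" for T
  proof (rule ccontr)
    assume *: "\<not> ?thesis"
    have "I \<subseteq> ideal_gen ?B T"
    proof
      fix x assume x: "x \<in> I"
      obtain P where "P \<in> coeffs_in ?A" "x = at_coord P i"
        using IB[OF x] by (rule poly_fun_in_insertE)
      then show "x \<in> ideal_gen ?B T" using * x by blast
    qed
    moreover obtain T' where "T' \<subseteq> S" "finite T'" "T \<subseteq> ideal_gen ?B T'"
      using ideal_gen_trans_finite[OF refl T(1) T(2)[unfolded I_def]] by blast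
    ultimately show False using nfg SI ideal_gen_trans[OF refl, of _ "insert i F" T T'] by blast
  qed
  define Pr where "Pr = (\<lambda>f (n::nat) r. r \<in> coeffs_in ?A \<and> at_coord r i \<in> I \<and>
    at_coord r i \<notin> ideal_gen ?B ((\<lambda>P. at_coord P i) ` f ` {..<n}) \<and>
    (\<forall>Q\<in>coeffs_in ?A. at_coord Q i \<in> I \<longrightarrow>
      at_coord Q i \<notin> ideal_gen ?B ((\<lambda>P. at_coord P i) ` f ` {..<n}) \<longrightarrow> degree r \<le> degree Q))"
  have "\<exists>f. \<forall>n. Pr f n (f n)"
  proof (rule dependent_wellorder_choice)
    fix r and f g :: "nat \<Rightarrow> (('i \<Rightarrow> 'k) \<Rightarrow> 'k) poly" and n :: nat
    assume "\<And>m. m < n \<Longrightarrow> f m = g m"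
    then have "f ` {..<n} = g ` {..<n}" by auto
    then show "Pr f n r = Pr g n r" by (simp add: Pr_def)
  next
    fix n :: nat and f assume *: "\<And>m. m < n \<Longrightarrow> Pr f m (f m)"
    let ?T = "(\<lambda>P. at_coord P i) ` f ` {..<n}"
    let ?Q = "\<lambda>P. P \<in> coeffs_in ?A \<and> at_coord P i \<in> I \<and> at_coord P i \<notin> ideal_gen ?B ?T"
    have "?T \<subseteq> I" using * by (auto simp: Pr_def)
    moreover have "finite ?T" by simp
    ultimately obtain P where "?Q P" using ex[of ?T] by blast
    from ex_has_least_nat[of ?Q, OF this, of degree]
    obtain r where "?Q r" "\<forall>P. ?Q P \<longrightarrow> degree r \<le> degree P" by blast
    then show "\<exists>r. Pr f n r" unfolding Pr_def by blast
  qed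
  then obtain f where f: "\<And>n. Pr f n (f n)" by blast
  define a where "a = (\<lambda>n. lead_coeff (f n))"
  have fA: "f n \<in> coeffs_in ?A" for n using f by (auto simp: Pr_def)
  have "range a \<subseteq> ?A" using fA by (auto simp: a_def intro: lead_coeff_in)
  from noeth[unfolded noetherian_in_def, rule_format, OF this]
  obtain T where T: "T \<subseteq> range a" "finite T" "range a \<subseteq> ideal_gen ?A T"
    by (elim exE conjE)
  from finite_subset_image[OF T(2,1)] obtain C where C: "finite C" "T = a ` C"
    by (elim exE conjE)
  obtain N where "C \<subseteq> {..<N}" using finite_nat_iff_bounded C(1) by blast
  then have "a N \<in> ideal_gen ?A (a ` {..<N})"
    using T(3) C(2) ideal_gen_mono[of "a N" ?A T "a ` {..<N}"] by blast
  from ideal_gen_image_sum[OF refl this] obtain r where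
    r: "\<forall>i. r i \<in> ?A" "a N = (\<Sum>i<N. r i * a i)" by blast
  have mono: "degree (f m) \<le> degree (f N)" if "m < N" for m
  proof -
    have le: "(\<lambda>P. at_coord P i) ` f ` {..<m} \<subseteq> (\<lambda>P. at_coord P i) ` f ` {..<N}"
      using that by (intro image_mono) auto
    have "at_coord (f N) i \<notin> ideal_gen ?B ((\<lambda>P. at_coord P i) ` f ` {..<m})"
      using f[of N] ideal_gen_mono[OF _ le] unfolding Pr_def by blast
    then show ?thesis using f[of m] f[of N] unfolding Pr_def by blast
  qed
  define d where "d = degree (f N)"
  \<comment> \<open>Shifting each \<open>f m\<close> to degree \<open>d\<close> makes the leading
    coefficients add up to \<open>a N\<close>. So \<open>g\<close> loses the leading term, but since
    \<open>h\<close> comes from the earlier polynomials, it stays outside their ideal.\<close>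
  define h where "h = (\<Sum>m<N. monom (r m) (d - degree (f m)) * f m)"
  define g where "g = f N - h"
  have h_ideal: "at_coord h i \<in> ideal_gen ?B ((\<lambda>P. at_coord P i) ` f ` {..<N})"
  proof -
    have "at_coord (monom (r m) (d - degree (f m))) i * at_coord (f m) i
      \<in> ideal_gen ?B ((\<lambda>P. at_coord P i) ` f ` {..<N})" if "m < N" for m
    proof (rule ideal_gen_mult[OF refl])
      show "at_coord (f m) i \<in> ideal_gen ?B ((\<lambda>P. at_coord P i) ` f ` {..<N})"
        using that by (intro ideal_gen_base poly_fun_in_closed) auto
      show "at_coord (monom (r m) (d - degree (f m))) i \<in> ?B"
        using r(1) by (intro at_coord_poly_fun_in coeffs_in_closed) auto
    qed
    then show ?thesis unfolding h_def poly_sum poly_mult by (intro ideal_gen_sum[OF refl]) auto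
  qed
  have "coeff g k = 0" if "k \<ge> d" for k
  proof (cases "k = d")
    case True
    have "coeff h d = (\<Sum>m<N. r m * a m)"
      unfolding h_def coeff_sum
      using mono by (intro sum.cong) (auto simp: coeff_monom_mult a_def d_def)
    then show ?thesis using True r(2) by (simp add: g_def a_def d_def)
  next
    case False
    then have k: "k > d" using that by simp
    have "coeff h k = 0"
      unfolding h_def coeff_sum
    proof (intro sum.neutral ballI)
      fix m assume "m \<in> {..<N}"
      then have "coeff (f m) (k - (d - degree (f m))) = 0"
        using mono[of m] k by (intro coeff_eq_0) (auto simp: d_def)
      then show "coeff (monom (r m) (d - degree (f m)) * f m) k = 0"
        by (simp add: coeff_monom_mult)
    qed
    then show ?thesis using k by (simp add: g_def d_def coeff_eq_0)
  qed
  then have "g = 0 \<or> degree g < d"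
    using degree_le[of "d - 1" g] leading_coeff_0_iff[of g] by (metis not_le)
  have IN: "ideal_gen ?B ((\<lambda>P. at_coord P i) ` f ` {..<N}) \<subseteq> I"
    using f ideal_gen_trans[OF refl, of _ "insert i F" "(\<lambda>P. at_coord P i) ` f ` {..<N}" S]
    unfolding I_def Pr_def by blast
  have fN: "at_coord (f N) i \<notin> ideal_gen ?B ((\<lambda>P. at_coord P i) ` f ` {..<N})"
    using f[of N] by (auto simp: Pr_def)
  have gv: "at_coord g i = at_coord (f N) i - at_coord h i" by (simp add: g_def)
  have "at_coord g i \<notin> ideal_gen ?B ((\<lambda>P. at_coord P i) ` f ` {..<N})"
  proof
    assume "at_coord g i \<in> ideal_gen ?B ((\<lambda>P. at_coord P i) ` f ` {..<N})"
    from ideal_gen_add[OF this h_ideal] show False using fN gv by simp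
  qed
  moreover have "at_coord g i \<in> I" unfolding gv I_def
    using f[of N] IN h_ideal by (intro ideal_gen_minus[OF refl]) (auto simp: Pr_def I_def)
  moreover have "g \<in> coeffs_in ?A"
  proof -
    have "h \<in> coeffs_in ?A" unfolding h_def
    proof (induction N)
      case 0
      show ?case by (simp add: coeffs_in_closed)
    next
      case (Suc n)
      then show ?case using r(1) fA by (auto intro!: coeffs_in_closed)
    qed
    then show ?thesis unfolding g_def using fA by (intro coeffs_in_closed)
  qed
  ultimately have "degree (f N) \<le> degree g" and "g \<noteq> 0"
    using f[of N] ideal_gen.zero[of ?B "(\<lambda>P. at_coord P i) ` f ` {..<N}"] by (auto simp: Pr_def)
  then show False using \<open>g = 0 \<or> degree g < d\<close> by (simp add: d_def)
qed

lemma noetherian_poly_fun: "noetherian_in (poly_fun :: (('i::finite \<Rightarrow> 'k::field) \<Rightarrow> 'k) set)"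
proof -
  have "noetherian_in (poly_fun_in F :: (('i \<Rightarrow> 'k) \<Rightarrow> 'k) set)" if "finite F" for F
    using that
    by (induction F rule: finite_induct)
      (auto intro: noetherian_poly_fun_in_empty noetherian_poly_fun_in_insert)
  from this[of UNIV] show ?thesis by (simp add: poly_fun_in_UNIV)
qed


section \<open>Irreducible closed sets and independent coordinates\<close>

lemma irrD:
  assumes "irr X" "p \<in> poly_fun" "q \<in> poly_fun" "vanishes_on X (\<lambda>x. p x * q x)"
  shows "vanishes_on X p \<or> vanishes_on X q"
  using irr_mult[OF assms(1-3)] assms(4) by (metis mult_eq_0_iff)

section \<open>Zariski closed sets and the descending chain condition\<close>

lemma closedin_zariski_iff:
  "closedin zariski Z \<longleftrightarrow> (\<forall>x. (\<forall>p\<in>poly_fun. vanishes_on Z p \<longrightarrow> p x = 0) \<longrightarrow> x \<in> Z)"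
proof
  assume "closedin zariski Z"
  then obtain P where "P \<subseteq> poly_fun" "Z = zero_locus P" by (auto simp: closedin_zariski)
  then show "\<forall>x. (\<forall>p\<in>poly_fun. vanishes_on Z p \<longrightarrow> p x = 0) \<longrightarrow> x \<in> Z"
    by (auto simp: zero_locus_def)
next
  assume *: "\<forall>x. (\<forall>p\<in>poly_fun. vanishes_on Z p \<longrightarrow> p x = 0) \<longrightarrow> x \<in> Z"
  have "Z = zero_locus {p\<in>poly_fun. vanishes_on Z p}"
  proof (intro equalityI subsetI)
    fix x assume "x \<in> zero_locus {p\<in>poly_fun. vanishes_on Z p}"
    then have "\<forall>p\<in>poly_fun. vanishes_on Z p \<longrightarrow> p x = 0" by (simp add: zero_locus_def)
    with spec[OF *, of x] show "x \<in> Z" by (rule mp)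
  qed (simp add: zero_locus_def)
  then show "closedin zariski Z" unfolding closedin_zariski by (intro exI[of _ "{p\<in>poly_fun. vanishes_on Z p}"]) auto
qed

lemma closed_separate:
  assumes "closedin zariski Z" "x \<notin> Z"
  obtains p where "p \<in> poly_fun" "vanishes_on Z p" "p x \<noteq> 0"
proof -
  have "\<not> (\<forall>p\<in>poly_fun. vanishes_on Z p \<longrightarrow> p x = 0)"
    using spec[OF assms(1)[unfolded closedin_zariski_iff], of x] assms(2) by blast
  then show ?thesis using that by blast
qed

lemma proj_closure_closed:
  assumes "closedin zariski Z"
  shows "proj_closure UNIV Z = Z"
proof (intro equalityI subsetI)
  fix x assume x: "x \<in> proj_closure UNIV Z"
  show "x \<in> Z"
  proof (rule ccontr)
    assume "x \<notin> Z"
    from closed_separate[OF assms this] obtain p where "p \<in> poly_fun" "vanishes_on Z p" "p x \<noteq> 0" .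
    then show False using x by (simp add: proj_closure_def poly_fun_in_UNIV)
  qed
qed (simp add: proj_closure_def)

lemma closedin_zariski_vanishing: "p \<in> poly_fun \<Longrightarrow> closedin zariski {x. p x = 0}"
  unfolding closedin_zariski by (intro exI[of _ "{p}"]) (auto simp: zero_locus_def)

text \<open>Along an infinite descending chain, the functions vanishing on some member are generated
  by finitely many, which all vanish on one member \<open>f N\<close>; then \<open>f N\<close> is
  contained in its successor.\<close>

lemma minimal_closed:
  fixes \<C> :: "('i::finite \<Rightarrow> 'k::field) set set"
  assumes "Z0 \<in> \<C>" "\<And>Z. Z \<in> \<C> \<Longrightarrow> closedin zariski Z"
  obtains Z where "Z \<in> \<C>" "\<And>Y. Y \<in> \<C> \<Longrightarrow> \<not> Y \<subset> Z"
proof -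
  define R where "R = {(Y, Z). closedin zariski Y \<and> closedin zariski Z \<and> Y \<subset> (Z :: ('i \<Rightarrow> 'k) set)}"
  have "wf R"
    unfolding wf_iff_no_infinite_down_chain
  proof
    assume "\<exists>f. \<forall>n. (f (Suc n), f n) \<in> R"
    then obtain f where fR: "\<forall>n. (f (Suc n), f n) \<in> R" by (elim exE)
    have f: "closedin zariski (f n)" "f (Suc n) \<subset> f n" for n
      using spec[OF fR, of n] by (simp_all add: R_def)
    have dec: "f n \<subseteq> f m" if "m \<le> n" for m n
      using f(2) by (intro lift_Suc_antimono_le[OF _ that]) blast
    define S where "S = {p\<in>poly_fun. \<exists>n. vanishes_on (f n) p}"
    have "S \<subseteq> poly_fun" by (auto simp: S_def)
    from noetherian_poly_fun[unfolded noetherian_in_def, rule_format, OF this]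
    obtain T where T: "T \<subseteq> S" "finite T" "S \<subseteq> ideal_gen poly_fun T"
      by (elim exE conjE)
    have "\<forall>p\<in>T. \<exists>n. vanishes_on (f n) p" using T(1) by (auto simp: S_def)
    then obtain \<nu> where \<nu>: "\<And>p. p \<in> T \<Longrightarrow> vanishes_on (f (\<nu> p)) p" by metis
    obtain N where N: "\<nu> ` T \<subseteq> {..N}"
      using finite_nat_iff_bounded_le[of "\<nu> ` T"] T(2) by blast
    have van: "vanishes_on (f N) p" if "p \<in> ideal_gen poly_fun T" for p
      using that
    proof (induction rule: ideal_gen.induct)
      case (step a s x)
      have "vanishes_on (f N) s" using \<nu>[OF step.hyps(2)] dec[of "\<nu> s" N] N step.hyps(2) by auto
      then show ?case using step.IH by simp
    qed simp
    have "f N \<subseteq> f (Suc N)"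
    proof
      fix x assume x: "x \<in> f N"
      show "x \<in> f (Suc N)"
      proof (rule ccontr)
        assume "x \<notin> f (Suc N)"
        from closed_separate[OF f(1) this] obtain p where p: "p \<in> poly_fun" "vanishes_on (f (Suc N)) p" "p x \<noteq> 0" .
        then have "p \<in> S" unfolding S_def by blast
        then have "vanishes_on (f N) p" using T(3) by (intro van) auto
        then show False using x p(3) by simp
      qed
    qed
    then show False using f(2)[of N] by blast
  qed
  from wfE_min[OF this assms(1)] obtain Z where Z: "Z \<in> \<C>" "\<And>Y. (Y, Z) \<in> R \<Longrightarrow> Y \<notin> \<C>" by blast
  have "\<not> Y \<subset> Z" if Y: "Y \<in> \<C>" for Y
  proof
    assume "Y \<subset> Z"
    then have "(Y, Z) \<in> R" using assms(2)[OF Y] assms(2)[OF Z(1)] unfolding R_def by simp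
    then show False using Z(2) Y by blast
  qed
  then show ?thesis by (rule that[OF Z(1)])
qed

section \<open>Irreducible sets: images, products, decomposition\<close>

lemma irreducible_in_zariski: "irreducible_in zariski S \<longleftrightarrow> irr S"
proof
  assume "irreducible_in zariski S"
  then have S: "S \<noteq> {}" and A: "\<And>A B. closedin (subtopology zariski S) A \<Longrightarrow>
      closedin (subtopology zariski S) B \<Longrightarrow> S = A \<union> B \<Longrightarrow> A = S \<or> B = S"
    by (auto simp: irreducible_in_def irreducible_space_def)
  show "irr S" unfolding irr_def
  proof (intro conjI ballI impI S)
    fix p q :: "('a \<Rightarrow> 'b) \<Rightarrow> 'b"
    assume pq: "p \<in> poly_fun" "q \<in> poly_fun" "vanishes_on S (\<lambda>x. p x * q x)"
    have "{x. p x = 0} \<inter> S = S \<or> {x. q x = 0} \<inter> S = S"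
      using pq(3) by (intro A) (auto simp: closedin_subtopology intro: closedin_zariski_vanishing pq)
    then show "vanishes_on S p \<or> vanishes_on S q" by auto
  qed
next
  assume S: "irr S"
  then have "S \<noteq> {}" by (simp add: irr_def)
  have "A = S \<or> B = S" if A: "closedin (subtopology zariski S) A"
    and B: "closedin (subtopology zariski S) B" and U: "S = A \<union> B" for A B
  proof (rule ccontr)
    assume neg: "\<not> (A = S \<or> B = S)"
    obtain A' B' where A': "closedin zariski A'" "A = A' \<inter> S" and B': "closedin zariski B'" "B = B' \<inter> S"
      using A B by (auto simp: closedin_subtopology)
    obtain a b where ab: "a \<in> S" "a \<notin> A'" "b \<in> S" "b \<notin> B'" using neg U A' B' by blast
    obtain p where p: "p \<in> poly_fun" "vanishes_on A' p" "p a \<noteq> 0"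
      by (rule closed_separate[OF A'(1) ab(2)])
    obtain q where q: "q \<in> poly_fun" "vanishes_on B' q" "q b \<noteq> 0"
      by (rule closed_separate[OF B'(1) ab(4)])
    have "\<not> vanishes_on S p" "\<not> vanishes_on S q" using p q ab by auto
    from irr_mult[OF S p(1) q(1) this] obtain x where x: "x \<in> S" "p x \<noteq> 0" "q x \<noteq> 0" .
    then have "x \<in> A' \<or> x \<in> B'" using U A'(2) B'(2) by blast
    then show False using p(2) q(2) x(2,3) by auto
  qed
  then show "irreducible_in zariski S"
    using \<open>S \<noteq> {}\<close> unfolding irreducible_in_def irreducible_space_def by simp metis
qed

lemma irreducible_in_subtopology_zariski:
  "irreducible_in (subtopology zariski V) S \<longleftrightarrow> S \<subseteq> V \<and> irr S"
  using irreducible_in_zariski[of S]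
  by (auto simp: irreducible_in_def subtopology_subtopology inf_absorb2)

lemma irr_image:
  assumes "irr X" "\<And>i. \<exists>p\<in>poly_fun. \<forall>x\<in>X. f x i = p x"
  shows "irr (f ` X)"
proof -
  obtain s where s: "\<And>i. s i \<in> poly_fun" "\<And>i x. x \<in> X \<Longrightarrow> f x i = s i x"
    using assms(2) by metis
  have f: "f x = (\<lambda>i. s i x)" if "x \<in> X" for x using s(2)[OF that] by auto
  have sub: "(\<lambda>x. p (\<lambda>i. s i x)) \<in> poly_fun" if "p \<in> poly_fun" for p
    using that by (rule poly_fun_subst) (simp add: s(1))
  show ?thesis unfolding irr_def
  proof (intro conjI ballI impI)
    show "f ` X \<noteq> {}" using assms(1) by (auto simp: irr_def)
    fix p q :: "('c \<Rightarrow> 'b) \<Rightarrow> 'b"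
    assume pq: "p \<in> poly_fun" "q \<in> poly_fun" and v: "vanishes_on (f ` X) (\<lambda>x. p x * q x)"
    have "vanishes_on X (\<lambda>x. p (\<lambda>i. s i x) * q (\<lambda>i. s i x))" using v f by auto
    then have "vanishes_on X (\<lambda>x. p (\<lambda>i. s i x)) \<or> vanishes_on X (\<lambda>x. q (\<lambda>i. s i x))"
      by (rule irrD[OF assms(1) sub[OF pq(1)] sub[OF pq(2)]])
    then show "vanishes_on (f ` X) p \<or> vanishes_on (f ` X) q" using f by auto
  qed
qed

text \<open>Given points where \<open>p\<close> and \<open>q\<close> do not vanish, irreducibility
  of \<open>B\<close>, applied to two slices, makes the second component common; then irreducibility
  of \<open>Z\<close> does the same for the first.\<close>

lemma irr_Times:
  fixes Z :: "('i \<Rightarrow> 'k::field) set" and B :: "('j \<Rightarrow> 'k) set"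
  assumes "irr Z" "irr B"
  shows "irr {z :: 'i + 'j \<Rightarrow> 'k. z \<circ> Inl \<in> Z \<and> z \<circ> Inr \<in> B}" (is "irr ?X")
proof -
  have X: "case_sum a b \<in> ?X \<longleftrightarrow> a \<in> Z \<and> b \<in> B" for a b
    by (simp add: comp_def)
  have split: "z = case_sum (z \<circ> Inl) (z \<circ> Inr)" for z :: "'i + 'j \<Rightarrow> 'k"
    by (auto simp: fun_eq_iff split: sum.splits)
  have s1: "(\<lambda>b. p (case_sum a b)) \<in> poly_fun" if "p \<in> poly_fun" for p a
    using that
  proof (rule poly_fun_subst)
    show "(\<lambda>b. case_sum a b i) \<in> poly_fun" for i
      by (cases i) (auto intro: poly_fun.intros)
  qed
  have s2: "(\<lambda>a. p (case_sum a b)) \<in> poly_fun" if "p \<in> poly_fun" for p b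
    using that
  proof (rule poly_fun_subst)
    show "(\<lambda>a. case_sum a b i) \<in> poly_fun" for i
      by (cases i) (auto intro: poly_fun.intros)
  qed
  show ?thesis unfolding irr_def
  proof (intro conjI ballI impI)
    obtain a b where "a \<in> Z" "b \<in> B" using assms by (auto simp: irr_def)
    then show "?X \<noteq> {}" using X[of a b] by blast
    fix p q :: "('i + 'j \<Rightarrow> 'k) \<Rightarrow> 'k"
    assume pq: "p \<in> poly_fun" "q \<in> poly_fun" "vanishes_on ?X (\<lambda>x. p x * q x)"
    show "vanishes_on ?X p \<or> vanishes_on ?X q"
    proof (rule ccontr)
      assume "\<not> ?thesis"
      then obtain z w where z: "z \<in> ?X" "p z \<noteq> 0" and w: "w \<in> ?X" "q w \<noteq> 0" by blast
      define zl zr wl wr where "zl = z \<circ> Inl" and "zr = z \<circ> Inr" and "wl = w \<circ> Inl" and "wr = w \<circ> Inr"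
      have e: "p (case_sum zl zr) \<noteq> 0" "q (case_sum wl wr) \<noteq> 0" "zl \<in> Z" "zr \<in> B" "wl \<in> Z" "wr \<in> B"
        using z w split by (auto simp: zl_def zr_def wl_def wr_def)
      obtain b where b: "b \<in> B" "p (case_sum zl b) \<noteq> 0" "q (case_sum wl b) \<noteq> 0"
        using irr_mult[OF assms(2) s1[OF pq(1), of zl] s1[OF pq(2), of wl]] e by blast
      obtain a where "a \<in> Z" "p (case_sum a b) \<noteq> 0" "q (case_sum a b) \<noteq> 0"
        using irr_mult[OF assms(1) s2[OF pq(1), of b] s2[OF pq(2), of b]] e b by blast
      moreover from this have "case_sum a b \<in> ?X" using b X by blast
      ultimately show False using pq(3) by auto
    qed
  qed
qed

text \<open>A point where \<open>p\<close> is nonzero and one where \<open>q\<close> is nonzero are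
  joined by a line, on which both become nonzero polynomials in one variable.\<close>

lemma irr_UNIV: "irr (UNIV :: ('i \<Rightarrow> 'k::alg_closed_field) set)"
proof -
  have line: "\<exists>P. \<forall>t. p (\<lambda>i. a i + t * (b i - a i)) = poly P t" if "p \<in> poly_fun"
    for p and a b :: "'i \<Rightarrow> 'k"
    using that
  proof (induction rule: poly_fun.induct)
    case (const c)
    show ?case by (rule exI[of _ "[:c:]"]) simp
  next
    case (coord i)
    show ?case by (rule exI[of _ "[:a i, b i - a i:]"]) simp
  next
    case (add p q)
    then obtain P Q where "\<forall>t. p (\<lambda>i. a i + t * (b i - a i)) = poly P t"
      "\<forall>t. q (\<lambda>i. a i + t * (b i - a i)) = poly Q t" by blast
    then show ?case by (intro exI[of _ "P + Q"]) simp
  next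
    case (mult p q)
    then obtain P Q where "\<forall>t. p (\<lambda>i. a i + t * (b i - a i)) = poly P t"
      "\<forall>t. q (\<lambda>i. a i + t * (b i - a i)) = poly Q t" by blast
    then show ?case by (intro exI[of _ "P * Q"]) simp
  qed
  show ?thesis unfolding irr_def
  proof (intro conjI ballI impI)
    fix p q :: "('i \<Rightarrow> 'k) \<Rightarrow> 'k"
    assume pq: "p \<in> poly_fun" "q \<in> poly_fun" "vanishes_on UNIV (\<lambda>x. p x * q x)"
    show "vanishes_on UNIV p \<or> vanishes_on UNIV q"
    proof (rule ccontr)
      assume "\<not> ?thesis"
      then obtain a b where ab: "p a \<noteq> 0" "q b \<noteq> 0" by blast
      obtain P where P: "\<forall>t. p (\<lambda>i. a i + t * (b i - a i)) = poly P t"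
        using line[OF pq(1)] by blast
      obtain Q where Q: "\<forall>t. q (\<lambda>i. a i + t * (b i - a i)) = poly Q t"
        using line[OF pq(2)] by blast
      have "poly P 0 \<noteq> 0" "poly Q 1 \<noteq> 0"
        using ab P[rule_format, of 0] Q[rule_format, of 1] by auto
      then have "P \<noteq> 0" "Q \<noteq> 0" by auto
      then obtain t where "poly (P * Q) t \<noteq> 0" using alg_closed_nonroot[of "P * Q"] by auto
      then have "poly P t \<noteq> 0" "poly Q t \<noteq> 0" by simp_all
      moreover have "p (\<lambda>i. a i + t * (b i - a i)) * q (\<lambda>i. a i + t * (b i - a i)) = 0"
        using pq(3) by blast
      ultimately show False using P Q by simp
    qed
  qed simp
qed

lemma poly_fun_no_zero_divisors:
  fixes p q :: "('i \<Rightarrow> 'k::alg_closed_field) \<Rightarrow> 'k"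
  assumes "p \<in> poly_fun" "q \<in> poly_fun" "p \<noteq> 0" "q \<noteq> 0"
  obtains x where "p x \<noteq> 0" "q x \<noteq> 0"
proof -
  have "\<not> vanishes_on UNIV p" "\<not> vanishes_on UNIV q" using assms by (auto simp: fun_eq_iff)
  from irr_mult[OF irr_UNIV assms(1,2) this] show ?thesis using that by blast
qed

text \<open>Noetherian induction: a minimal closed set without a decomposition is nonempty and
  reducible, hence a union of two smaller closed sets that have one.\<close>

lemma irreducible_decomposition:
  fixes Z :: "('i::finite \<Rightarrow> 'k::field) set"
  assumes "closedin zariski Z"
  shows "\<exists>\<V>. finite \<V> \<and> (\<forall>V\<in>\<V>. closedin zariski V \<and> irr V) \<and> Z = \<Union>\<V>"
proof (rule ccontr)
  let ?dec = "\<lambda>Z. \<exists>\<V>. finite \<V> \<and> (\<forall>V\<in>\<V>. closedin zariski V \<and> irr V) \<and> Z = \<Union>\<V>"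
  assume "\<not> ?thesis"
  define \<B> where "\<B> = {Z :: ('i \<Rightarrow> 'k) set. closedin zariski Z \<and> \<not> ?dec Z}"
  have "Z \<in> \<B>" using \<open>\<not> ?dec Z\<close> assms unfolding \<B>_def by blast
  then obtain M where "M \<in> \<B>" and min: "\<And>Y. Y \<in> \<B> \<Longrightarrow> \<not> Y \<subset> M"
    by (rule minimal_closed) (simp add: \<B>_def, blast)
  then have M: "closedin zariski M" "\<not> ?dec M" by (simp_all add: \<B>_def)
  have min': "?dec Y" if "closedin zariski Y" "Y \<subset> M" for Y
    using min[of Y] that unfolding \<B>_def by blast
  have "\<not> irr M"
  proof
    assume "irr M"
    then have "?dec M" using M(1) by (intro exI[of _ "{M}"]) simp
    then show False using M(2) by (rule notE[rotated])
  qed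
  moreover have "M \<noteq> {}"
  proof
    assume "M = {}"
    then have "?dec M" by (intro exI[of _ "{}"]) simp
    then show False using M(2) by (rule notE[rotated])
  qed
  ultimately obtain p q where pq: "p \<in> poly_fun" "q \<in> poly_fun" "vanishes_on M (\<lambda>x. p x * q x)"
    "\<not> vanishes_on M p" "\<not> vanishes_on M q" unfolding irr_def by blast
  have cl: "closedin zariski (M \<inter> {x. p x = 0})" "closedin zariski (M \<inter> {x. q x = 0})"
    using M pq by (auto intro!: closedin_Int closedin_zariski_vanishing)
  obtain \<V> where V: "finite \<V>" "\<forall>V\<in>\<V>. closedin zariski V \<and> irr V" "M \<inter> {x. p x = 0} = \<Union>\<V>"
    using min'[OF cl(1)] pq(4) by blast
  obtain \<W> where W: "finite \<W>" "\<forall>V\<in>\<W>. closedin zariski V \<and> irr V" "M \<inter> {x. q x = 0} = \<Union>\<W>"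
    using min'[OF cl(2)] pq(5) by blast
  have "M = (M \<inter> {x. p x = 0}) \<union> (M \<inter> {x. q x = 0})" using pq(3) by auto
  also have "\<dots> = \<Union>(\<V> \<union> \<W>)" unfolding V(3) W(3) by blast
  finally have "?dec M" using V W by (intro exI[of _ "\<V> \<union> \<W>"]) auto
  then show False using M(2) by (rule notE[rotated])
qed

text \<open>For each \<open>V\<close> not containing \<open>T\<close> take a function vanishing on
  \<open>V\<close> but not on \<open>T\<close>; by irreducibility their product does not vanish on
  \<open>T\<close>.\<close>

lemma irr_subset_Union:
  assumes "irr T" "finite \<V>" "\<And>V. V \<in> \<V> \<Longrightarrow> closedin zariski V" "T \<subseteq> \<Union>\<V>"
  shows "\<exists>V\<in>\<V>. T \<subseteq> V"
proof (rule ccontr)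
  assume "\<not> ?thesis"
  then have nsub: "\<not> T \<subseteq> V" if "V \<in> \<V>" for V using that by blast
  have "\<forall>V\<in>\<V>. \<exists>p. p \<in> poly_fun \<and> vanishes_on V p \<and> \<not> vanishes_on T p"
  proof
    fix V assume V: "V \<in> \<V>"
    obtain x where x: "x \<in> T" "x \<notin> V" using nsub[OF V] by blast
    from closed_separate[OF assms(3)[OF V] x(2)]
    obtain p where "p \<in> poly_fun" "vanishes_on V p" "p x \<noteq> 0" .
    then show "\<exists>p. p \<in> poly_fun \<and> vanishes_on V p \<and> \<not> vanishes_on T p" using x(1) by blast
  qed
  from bchoice[OF this] obtain p where
    p: "\<forall>V\<in>\<V>. p V \<in> poly_fun \<and> vanishes_on V (p V) \<and> \<not> vanishes_on T (p V)"
    by (elim exE)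
  have "\<not> vanishes_on T (prod p \<V>)" using p assms(1,2) by (intro irr_prod) auto
  then obtain x where x: "x \<in> T" "prod p \<V> x \<noteq> 0" by blast
  then obtain V where "V \<in> \<V>" "x \<in> V" using assms(4) by blast
  then show False using x(2) p assms(2) by (auto simp: prod_fun_apply)
qed

text \<open>Geometric form of the fact that an ideal maximal among those disjoint from a
  multiplicative set is prime: a minimal closed set on which no member of \<open>M\<close> vanishes
  is irreducible.\<close>

lemma minimal_closed_irr:
  fixes Y :: "('i::finite \<Rightarrow> 'k::field) set"
  assumes Y: "closedin zariski Y" and M: "M \<subseteq> poly_fun" "M \<noteq> {}"
    "\<And>a b. a \<in> M \<Longrightarrow> b \<in> M \<Longrightarrow> a * b \<in> M" "\<And>m. m \<in> M \<Longrightarrow> \<not> vanishes_on Y m"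
  obtains X where "X \<subseteq> Y" "closedin zariski X" "irr X" "\<And>m. m \<in> M \<Longrightarrow> \<not> vanishes_on X m"
proof -
  let ?C = "{X. X \<subseteq> Y \<and> closedin zariski X \<and> (\<forall>m\<in>M. \<not> vanishes_on X m)}"
  have "Y \<in> ?C" using Y M by blast
  then obtain X where X: "X \<in> ?C" and min: "\<And>X'. X' \<in> ?C \<Longrightarrow> \<not> X' \<subset> X"
    by (rule minimal_closed) blast+
  have sub: "\<exists>m\<in>M. vanishes_on (X \<inter> {x. p x = 0}) m"
    if "p \<in> poly_fun" "\<not> vanishes_on X p" for p
  proof -
    have "closedin zariski (X \<inter> {x. p x = 0})"
      using X that by (auto intro!: closedin_Int closedin_zariski_vanishing)
    moreover have "X \<inter> {x. p x = 0} \<subset> X" using that(2) by blast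
    ultimately show ?thesis using min[of "X \<inter> {x. p x = 0}"] X by blast
  qed
  have "irr X" unfolding irr_def
  proof (intro conjI ballI impI)
    show "X \<noteq> {}" using X M(2) by blast
    fix p q :: "('i \<Rightarrow> 'k) \<Rightarrow> 'k"
    assume pq: "p \<in> poly_fun" "q \<in> poly_fun" "vanishes_on X (\<lambda>x. p x * q x)"
    show "vanishes_on X p \<or> vanishes_on X q"
    proof (rule ccontr)
      assume "\<not> ?thesis"
      then have nz: "\<not> vanishes_on X p" "\<not> vanishes_on X q" by blast+
      from sub[OF pq(1) nz(1)] sub[OF pq(2) nz(2)]
      obtain a b where ab: "a \<in> M" "b \<in> M" "vanishes_on (X \<inter> {x. p x = 0}) a"
        "vanishes_on (X \<inter> {x. q x = 0}) b" by (elim bexE)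
      have "vanishes_on X (a * b)" using ab pq(3) by auto
      then show False using M(3)[OF ab(1,2)] X by blast
    qed
  qed
  then show ?thesis using X that by blast
qed

text \<open>Equivalently, the projection of \<open>X\<close> to the \<open>F\<close>-coordinates is
  Zariski dense. Over an infinite field, equality of functions in \<open>q = 0\<close> amounts to
  equality of polynomials.\<close>

definition independent_coords :: "'i set \<Rightarrow> ('i \<Rightarrow> 'k::comm_ring_1) set \<Rightarrow> bool" where
  "independent_coords F X \<longleftrightarrow> (\<forall>q\<in>poly_fun_in F. vanishes_on X q \<longrightarrow> q = 0)"

lemma independent_coordsD:
  "independent_coords F X \<Longrightarrow> q \<in> poly_fun_in F \<Longrightarrow> q \<noteq> 0 \<Longrightarrow> \<not> vanishes_on X q"
  by (auto simp: independent_coords_def)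

lemma independent_coords_mono:
  assumes "independent_coords F X" "F' \<subseteq> F" "X \<subseteq> X'"
  shows "independent_coords F' X'"
  unfolding independent_coords_def
proof (intro ballI impI)
  fix q assume "q \<in> poly_fun_in F'" "vanishes_on X' q"
  then show "q = 0" using assms poly_fun_in_mono[of q F' F] unfolding independent_coords_def by blast
qed

lemma independent_coords_proj_closure:
  "independent_coords F X \<Longrightarrow> p \<in> proj_closure F X"
  by (auto simp: independent_coords_def proj_closure_def)

lemma independent_coords_empty: "X \<noteq> {} \<Longrightarrow> independent_coords {} X"
  unfolding independent_coords_def
proof (intro ballI impI ext)
  fix q and y :: "'a \<Rightarrow> 'b" assume "X \<noteq> {}" and q: "q \<in> poly_fun_in {}" "vanishes_on X q"
  then obtain x where "x \<in> X" by blast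
  moreover have "q y = q x" using q(1) by (rule poly_fun_in_cong) simp
  ultimately show "q y = 0 y" using q(2) by simp
qed

text \<open>\<open>X'\<close> is a minimal closed subset of the section on which no
  \<open>q * v ^ n\<close> vanishes, where \<open>q\<close> is a nonzero function of the
  \<open>F\<close>-coordinates. No such product vanishes on the whole section, because generic
  points of the projection lift to points of \<open>X\<close> with \<open>v\<close> nonzero.\<close>

lemma hyperplane_section:
  fixes X :: "('i::finite \<Rightarrow> 'k::alg_closed_field) set"
  assumes X: "closedin zariski X" "irr X" and i: "i \<notin> F" and ind: "independent_coords (insert i F) X"
    and v: "v \<in> poly_fun" "\<not> vanishes_on X v"
  obtains c X' where "X' \<subseteq> X" "closedin zariski X'" "irr X'" "\<forall>x\<in>X'. x i = c"
    "independent_coords F X'" "\<not> vanishes_on X' v"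
proof -
  obtain u where u: "u \<in> poly_fun_in (insert i F)" "\<not> vanishes_on X u"
    and ext: "\<And>p. u p \<noteq> 0 \<Longrightarrow> \<exists>p'\<in>X. (\<forall>j\<in>insert i F. p' j = p j) \<and> v p' \<noteq> 0"
    using extend_point[OF X(2) v, of "insert i F"] independent_coords_proj_closure[OF ind]
    unfolding proj_closure_closed[OF X(1)] by blast
  obtain x0 where x0: "x0 \<in> X" "u x0 \<noteq> 0" using u by blast
  \<comment> \<open>Taking the coordinate of a point where \<open>u\<close> is nonzero keeps
    \<open>u\<close> from becoming zero when \<open>c\<close> is substituted for the
    \<open>i\<close>-th coordinate.\<close>
  define c where "c = x0 i"
  define uc where "uc = (\<lambda>x. u (x(i := c)))"
  have uc: "uc \<in> poly_fun_in F" unfolding uc_def using u(1)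
  proof (rule poly_fun_in_subst)
    show "(\<lambda>x. (x(i := c)) j) \<in> poly_fun_in F" if "j \<in> insert i F" for j
      using that by (cases "j = i") (auto intro: poly_fun_in.intros)
  qed
  have "x0(i := c) = x0" by (simp add: c_def)
  then have "uc x0 \<noteq> 0" using x0(2) by (simp add: uc_def)
  then have uc0: "uc \<noteq> 0" by auto
  define Y where "Y = X \<inter> {x. x i - c = 0}"
  have "(\<lambda>x. x i - c) \<in> poly_fun"
    using poly_fun.add[OF poly_fun.coord[of i] poly_fun.const[of "- c"]] by simp
  then have Y: "closedin zariski Y" unfolding Y_def
    by (intro closedin_Int X closedin_zariski_vanishing)
  define M where "M = {q * v ^ n | q n. q \<in> poly_fun_in F \<and> q \<noteq> 0}"
  have MY: "\<not> vanishes_on Y m" if m: "m \<in> M" for m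
  proof -
    obtain q n where q: "q \<in> poly_fun_in F" "q \<noteq> 0" "m = q * v ^ n" using m by (auto simp: M_def)
    obtain p where p: "q p \<noteq> 0" "uc p \<noteq> 0"
      by (rule poly_fun_no_zero_divisors[OF _ _ q(2) uc0])
        (use q uc poly_fun_in_poly_fun in blast)+
    obtain p' where p': "p' \<in> X" "\<forall>j\<in>insert i F. p' j = (p(i := c)) j" "v p' \<noteq> 0"
      using ext[of "p(i := c)"] p(2) unfolding uc_def by blast
    have "p' i = c" using p'(2) by simp
    moreover have "q p' = q p" using i p'(2) by (intro poly_fun_in_cong[OF q(1)]) auto
    ultimately have "p' \<in> Y" "m p' \<noteq> 0" using p p' by (auto simp: Y_def q(3) power_fun_apply)
    then show ?thesis by blast
  qed
  have M_poly: "M \<subseteq> poly_fun" unfolding M_def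
    using v(1) by (auto intro!: poly_fun_closed(4,9) dest: poly_fun_in_poly_fun)
  have M1: "1 * v ^ 0 \<in> M" unfolding M_def
    by (rule CollectI, rule exI[of _ 1], rule exI[of _ 0]) (auto intro: poly_fun_in_1)
  have M_mult: "a * b \<in> M" if ab: "a \<in> M" "b \<in> M" for a b
  proof -
    obtain q n r k where e: "q \<in> poly_fun_in F" "q \<noteq> 0" "a = q * v ^ n"
      "r \<in> poly_fun_in F" "r \<noteq> 0" "b = r * v ^ k" using ab by (auto simp: M_def)
    obtain x where "q x \<noteq> 0" "r x \<noteq> 0"
      by (rule poly_fun_no_zero_divisors[OF _ _ e(2,5)]) (use e poly_fun_in_poly_fun in blast)+
    then have "(q * r) x \<noteq> 0" by simp
    then have "q * r \<noteq> 0" by (metis zero_fun_apply)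
    moreover have "a * b = (q * r) * v ^ (n + k)" by (simp only: e power_add mult_ac)
    moreover have "q * r \<in> poly_fun_in F" using e by (intro poly_fun_in_times)
    ultimately show ?thesis unfolding M_def by blast
  qed
  obtain X' where X': "X' \<subseteq> Y" "closedin zariski X'" "irr X'" "\<And>m. m \<in> M \<Longrightarrow> \<not> vanishes_on X' m"
    by (rule minimal_closed_irr[OF Y M_poly _ M_mult MY]) (use M1 in blast)+
  show ?thesis
  proof (rule that[OF _ X'(2,3)])
    show "X' \<subseteq> X" "\<forall>x\<in>X'. x i = c" using X'(1) by (auto simp: Y_def)
    show "independent_coords F X'" unfolding independent_coords_def
    proof (intro ballI impI, rule ccontr)
      fix q assume "q \<in> poly_fun_in F" "vanishes_on X' q" "q \<noteq> 0"
      moreover from this have "q * v ^ 0 \<in> M" unfolding M_def by blast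
      ultimately show False using X'(4)[of "q * v ^ 0"] by simp
    qed
    have "1 * v ^ 1 \<in> M" unfolding M_def
      by (rule CollectI, rule exI[of _ 1], rule exI[of _ 1]) (auto intro: poly_fun_in_1)
    from X'(4)[OF this] show "\<not> vanishes_on X' v" by simp
  qed
qed

lemma hyperplane_sections:
  fixes X :: "('i::finite \<Rightarrow> 'k::alg_closed_field) set"
  assumes "closedin zariski X" "irr X" "E \<inter> F = {}" "independent_coords (E \<union> F) X"
    and v: "v \<in> poly_fun" "\<not> vanishes_on X v"
  shows "\<exists>X'\<subseteq>X. closedin zariski X' \<and> irr X' \<and> (\<forall>i\<in>E. \<forall>x\<in>X'. \<forall>y\<in>X'. x i = y i) \<and>
    independent_coords F X' \<and> \<not> vanishes_on X' v"
proof -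
  have "finite E" by simp
  then show ?thesis using assms
  proof (induction E arbitrary: X rule: finite_induct)
    case empty
    then show ?case by (intro exI[of _ X]) auto
  next
    case (insert i E)
    have "i \<notin> E \<union> F" "independent_coords (insert i (E \<union> F)) X"
      using insert.hyps insert.prems by auto
    from hyperplane_section[OF insert.prems(1,2) this v(1) insert.prems(6)]
    obtain c X1 where X1: "X1 \<subseteq> X" "closedin zariski X1" "irr X1" "\<forall>x\<in>X1. x i = c"
      "independent_coords (E \<union> F) X1" "\<not> vanishes_on X1 v" .
    have "E \<inter> F = {}" using insert.prems by auto
    from insert.IH[OF X1(2,3) this X1(5) v(1) X1(6)] obtain X' where X': "X' \<subseteq> X1" "closedin zariski X'" "irr X'"
      "\<forall>i\<in>E. \<forall>x\<in>X'. \<forall>y\<in>X'. x i = y i" "independent_coords F X'" "\<not> vanishes_on X' v" by blast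
    have "x i = c" if "x \<in> X'" for x using X'(1) X1(4) that by blast
    then have "\<forall>x\<in>X'. \<forall>y\<in>X'. x i = y i" by metis
    then have "\<forall>j\<in>insert i E. \<forall>x\<in>X'. \<forall>y\<in>X'. x j = y j" using X'(4) by simp
    moreover have "X' \<subseteq> X" using X'(1) X1(1) by blast
    ultimately show ?case using X'(2,3,5,6) by (intro exI[of _ X'] conjI) auto
  qed
qed

text \<open>The lower bound for the Krull dimension. Each section is proper because
  \<open>x i - c\<close> vanishes on it but, by independence, not on \<open>X\<close>.\<close>

lemma chain_of_independent_coords:
  fixes X :: "('i::finite \<Rightarrow> 'k::alg_closed_field) set"
  assumes "closedin zariski X" "irr X" "independent_coords F X"
  shows "\<exists>Z. (\<forall>j\<le>card F. closedin zariski (Z j) \<and> irr (Z j)) \<and> (\<forall>j<card F. Z j \<subset> Z (Suc j)) \<and>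
    Z (card F) = X"
proof -
  have "finite F" by simp
  then show ?thesis using assms
  proof (induction F arbitrary: X rule: finite_induct)
    case empty
    then show ?case by (intro exI[of _ "\<lambda>_. X"]) auto
  next
    case (insert i F)
    have "\<not> vanishes_on X (1 :: _ \<Rightarrow> 'k)" using insert.prems(2) by (auto simp: irr_def)
    from hyperplane_section[OF insert.prems(1,2) insert.hyps(2) insert.prems(3) poly_fun_closed(6) this]
    obtain c X1 where X1: "X1 \<subseteq> X" "closedin zariski X1" "irr X1" "\<forall>x\<in>X1. x i = c"
      "independent_coords F X1" .
    obtain Z where Z: "\<forall>j\<le>card F. closedin zariski (Z j) \<and> irr (Z j)"
      "\<forall>j<card F. Z j \<subset> Z (Suc j)" "Z (card F) = X1"
      using insert.IH[OF X1(2,3,5)] by blast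
    have "X1 \<noteq> X"
    proof
      assume "X1 = X"
      then have "vanishes_on X (\<lambda>x. x i + (- c))" using X1(4) by auto
      moreover have "(\<lambda>x. x i + (- c)) \<in> poly_fun_in (insert i F)" by (intro poly_fun_in.intros) simp
      ultimately have "(\<lambda>x. x i + (- c)) = 0"
        using insert.prems(3) by (auto simp: independent_coords_def)
      from fun_cong[OF this, of "\<lambda>_. c + 1"] show False by simp
    qed
    then have "X1 \<subset> X" using X1(1) by blast
    then show ?case using Z insert.prems(1,2) insert.hyps
      by (intro exI[of _ "Z(Suc (card F) := X)"]) (auto simp: le_Suc_eq less_Suc_eq)
  qed
qed

lemma factor_out_var:
  fixes P :: "'a::comm_ring_1 poly"
  assumes "P \<noteq> 0"
  shows "\<exists>k Q. P = monom 1 k * Q \<and> coeff Q 0 \<noteq> 0 \<and> (\<forall>j. coeff Q j = coeff P (j + k))"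
  using assms
proof (induction P)
  case (pCons a P)
  show ?case
  proof (cases "a = 0")
    case False
    then show ?thesis by (intro exI[of _ 0] exI[of _ "pCons a P"]) auto
  next
    case True
    with pCons have "P \<noteq> 0" by auto
    with pCons obtain k Q where "P = monom 1 k * Q" "coeff Q 0 \<noteq> 0" "\<forall>j. coeff Q j = coeff P (j + k)"
      by blast
    then show ?thesis using True
      by (intro exI[of _ "Suc k"] exI[of _ Q]) (auto simp: monom_Suc)
  qed
qed simp

text \<open>Each strict inclusion supplies a function \<open>g\<close> vanishing on
  \<open>Z n\<close> but not on \<open>Z (Suc n)\<close>. In a relation involving \<open>g\<close>,
  a power of \<open>g\<close> is cancelled by irreducibility of \<open>Z (Suc n)\<close>; on
  \<open>Z n\<close> the remaining nonzero constant term is then a relation among the earlier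
  functions.\<close>

lemma independent_functions_of_chain:
  fixes Z :: "nat \<Rightarrow> ('i \<Rightarrow> 'k::alg_closed_field) set"
  assumes "\<forall>j\<le>n. closedin zariski (Z j) \<and> irr (Z j)" "\<forall>j<n. Z j \<subset> Z (Suc j)"
  shows "\<exists>y. (\<forall>j::nat. y j \<in> poly_fun) \<and> independent_coords {..<n} ((\<lambda>x j. y j x) ` Z n)"
  using assms
proof (induction n)
  case 0
  then have "Z 0 \<noteq> {}" by (auto simp: irr_def)
  then show ?case
    by (intro exI[of _ "\<lambda>_ _. 0"]) (auto intro!: independent_coords_empty poly_fun.const)
next
  case (Suc n)
  then obtain y where y: "\<And>j. y j \<in> poly_fun" "independent_coords {..<n} ((\<lambda>x j. y j x) ` Z n)"
    by auto
  obtain x where x: "x \<in> Z (Suc n)" "x \<notin> Z n" using Suc.prems(2) by blast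
  have "closedin zariski (Z n)" using Suc.prems(1) by simp
  from closed_separate[OF this x(2)] obtain g where g: "g \<in> poly_fun" "vanishes_on (Z n) g" "g x \<noteq> 0" .
  define y' where "y' = y(n := g)"
  have y': "y' j \<in> poly_fun" for j using y g by (simp add: y'_def)
  have "q = 0" if q: "q \<in> poly_fun_in {..<Suc n}"
    "vanishes_on ((\<lambda>x j. y' j x) ` Z (Suc n)) q" for q :: "(nat \<Rightarrow> 'k) \<Rightarrow> 'k"
  proof -
    have "q \<in> poly_fun_in (insert n {..<n})" using q(1) by (simp add: lessThan_Suc)
    then obtain P where P: "P \<in> coeffs_in (poly_fun_in {..<n})" "q = at_coord P n"
      by (rule poly_fun_in_insertE)
    have "P = 0"
    proof (rule ccontr)
      assume "P \<noteq> 0"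
      then obtain k Q where Q: "P = monom 1 k * Q" "coeff Q 0 \<noteq> 0" "\<forall>j. coeff Q j = coeff P (j + k)"
        using factor_out_var by blast
      have QA: "Q \<in> coeffs_in (poly_fun_in {..<n})" using P Q(3) by (auto simp: coeffs_in_def)
      have sub: "(\<lambda>x. at_coord Q n (\<lambda>j. y' j x)) \<in> poly_fun"
        by (rule poly_fun_subst[OF poly_fun_in_poly_fun[OF at_coord_poly_fun_in[OF QA]]]) (simp add: y')
      have Zir: "irr (Z (Suc n))" using Suc.prems(1) by blast
      have g': "\<not> vanishes_on (Z (Suc n)) (g ^ k)"
        using g x by (intro irr_power[OF Zir]) auto
      have "vanishes_on (Z (Suc n)) (\<lambda>z. (g ^ k) z * at_coord Q n (\<lambda>j. y' j z))"
      proof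
        fix z assume "z \<in> Z (Suc n)"
        then have "q (\<lambda>j. y' j z) = 0" using q(2) by auto
        then show "(g ^ k) z * at_coord Q n (\<lambda>j. y' j z) = 0"
          by (simp add: P(2) Q(1) poly_monom power_fun_apply y'_def)
      qed
      then have van: "vanishes_on (Z (Suc n)) (\<lambda>z. at_coord Q n (\<lambda>j. y' j z))"
        using irrD[OF Zir poly_fun_closed(9)[OF g(1)] sub] g' by blast
      have "coeff Q 0 w = 0" if w: "w \<in> (\<lambda>x j. y j x) ` Z n" for w
      proof -
        obtain z where z: "z \<in> Z n" "w = (\<lambda>j. y j z)" using w by blast
        have "z \<in> Z (Suc n)" using z Suc.prems(2) by blast
        then have "poly (eval_coeffs (\<lambda>j. y' j z) Q) (g z) = 0"
          using van by (simp add: poly_fun_apply y'_def)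
        then have "coeff Q 0 (\<lambda>j. y' j z) = 0" using g(2) z by (simp add: poly_0_coeff_0)
        moreover have "coeff Q 0 (\<lambda>j. y' j z) = coeff Q 0 (\<lambda>j. y j z)"
        proof (rule poly_fun_in_cong[of "coeff Q 0" "{..<n}"])
          show "coeff Q 0 \<in> poly_fun_in {..<n}" using QA by (auto simp: coeffs_in_def)
        qed (auto simp: y'_def)
        ultimately show ?thesis using z by simp
      qed
      then have "coeff Q 0 = 0"
        using y(2) QA unfolding independent_coords_def coeffs_in_def by blast
      then show False using Q(2) by blast
    qed
    then show ?thesis using P by simp
  qed
  then show ?case using y' by (intro exI[of _ y']) (auto simp: independent_coords_def)
qed


section \<open>Counting monomials\<close>

text \<open>Gaussian elimination: the equation \<open>t\<close> is solved for the coefficient at a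
  pivot \<open>b\<close> and substituted into the others.\<close>

lemma nontrivial_relation:
  fixes M :: "'a \<Rightarrow> 'b \<Rightarrow> 'k::field"
  assumes "finite T" "finite S" "card T < card S"
  shows "\<exists>l. (\<exists>a\<in>S. l a \<noteq> 0) \<and> (\<forall>t\<in>T. (\<Sum>a\<in>S. l a * M a t) = 0)"
  using assms
proof (induction T arbitrary: S M rule: finite_induct)
  case empty
  then have "S \<noteq> {}" by auto
  then show ?case by (intro exI[of _ "\<lambda>_. 1"]) auto
next
  case (insert t T)
  show ?case
  proof (cases "\<forall>a\<in>S. M a t = 0")
    case True
    have "card T < card S" using insert by simp
    then obtain l where "\<exists>a\<in>S. l a \<noteq> 0" "\<forall>t\<in>T. (\<Sum>a\<in>S. l a * M a t) = 0"
      using insert.IH[OF insert.prems(1), of M] by blast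
    then show ?thesis using True by (intro exI[of _ l]) auto
  next
    case False
    then obtain b where b: "b \<in> S" "M b t \<noteq> 0" by blast
    have "card T < card (S - {b})" using insert b by simp
    from insert.IH[OF _ this, of "\<lambda>a s. M a s - M a t / M b t * M b s"] insert.prems(1)
    obtain l where l: "\<exists>a\<in>S - {b}. l a \<noteq> 0"
      "\<forall>s\<in>T. (\<Sum>a\<in>S - {b}. l a * (M a s - M a t / M b t * M b s)) = 0" by auto
    define c where "c = - (\<Sum>a\<in>S - {b}. l a * M a t / M b t)"
    define l' where "l' = l(b := c)"
    have split: "(\<Sum>a\<in>S. l' a * M a s) = c * M b s + (\<Sum>a\<in>S - {b}. l a * M a s)" for s
    proof -
      have "(\<Sum>a\<in>S. l' a * M a s) = l' b * M b s + (\<Sum>a\<in>S - {b}. l' a * M a s)"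
        using insert.prems(1) b(1) by (rule sum.remove)
      also have "(\<Sum>a\<in>S - {b}. l' a * M a s) = (\<Sum>a\<in>S - {b}. l a * M a s)"
        by (intro sum.cong) (auto simp: l'_def)
      finally show ?thesis by (simp add: l'_def)
    qed
    have "(\<Sum>a\<in>S. l' a * M a s) = 0" if "s \<in> insert t T" for s
    proof (cases "s = t")
      case True
      show ?thesis unfolding split True using b(2)
        by (simp add: c_def sum_divide_distrib[symmetric])
    next
      case False
      then have "s \<in> T" using that by simp
      then have "(\<Sum>a\<in>S - {b}. l a * M a s) - (\<Sum>a\<in>S - {b}. l a * M a t / M b t) * M b s = 0"
        using l(2) by (simp add: right_diff_distrib sum_subtractf sum_distrib_right mult.assoc)
      then show ?thesis unfolding split c_def by simp
    qed
    moreover have "\<exists>a\<in>S. l' a \<noteq> 0" using l(1) by (auto simp: l'_def)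
    ultimately show ?thesis by blast
  qed
qed

text \<open>One unknown at a time: with the others fixed, the sum is a polynomial in
  \<open>w j\<close> that vanishes everywhere, so its coefficients are zero.\<close>

lemma monomials_independent:
  fixes c :: "('j \<Rightarrow> nat) \<Rightarrow> 'k::alg_closed_field"
  assumes "finite J" "\<And>w. (\<Sum>\<alpha>\<in>PiE J (\<lambda>_. {..t}). c \<alpha> * (\<Prod>j\<in>J. w j ^ \<alpha> j)) = 0"
    "\<alpha> \<in> PiE J (\<lambda>_. {..t})"
  shows "c \<alpha> = 0"
  using assms
proof (induction J arbitrary: c \<alpha> rule: finite_induct)
  case empty
  then show ?case by simp
next
  case (insert j J)
  let ?E = "PiE J (\<lambda>_. {..t})"
  have sum_eq: "(\<Sum>\<alpha>\<in>PiE (insert j J) (\<lambda>_. {..t}). f \<alpha>) = (\<Sum>a\<le>t. \<Sum>\<alpha>\<in>?E. f (\<alpha>(j := a)))"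
    for f :: "_ \<Rightarrow> 'k"
  proof -
    have "(\<Sum>\<alpha>\<in>PiE (insert j J) (\<lambda>_. {..t}). f \<alpha>) =
        (\<Sum>(a, \<alpha>)\<in>{..t} \<times> ?E. f (\<alpha>(j := a)))"
      unfolding PiE_insert_eq using inj_combinator[OF insert.hyps(2), of "\<lambda>_. {..t}"]
      by (subst sum.reindex) (auto simp: case_prod_unfold)
    then show ?thesis by (simp add: sum.cartesian_product)
  qed
  have *: "(\<Sum>\<alpha>\<in>?E. c (\<alpha>(j := a)) * (\<Prod>i\<in>J. w i ^ \<alpha> i)) = 0" if "a \<le> t" for a w
  proof -
    define d where "d = (\<lambda>a. \<Sum>\<alpha>\<in>?E. c (\<alpha>(j := a)) * (\<Prod>i\<in>J. w i ^ \<alpha> i))"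
    define P where "P = (\<Sum>a\<le>t. monom (d a) a)"
    have "poly P s = 0" for s
    proof -
      have pr: "(\<Prod>i\<in>J. (w(j := s)) i ^ (\<alpha>(j := a)) i) = (\<Prod>i\<in>J. w i ^ \<alpha> i)" for \<alpha> a
        using insert.hyps(2) by (intro prod.cong) auto
      have "0 = (\<Sum>a\<le>t. \<Sum>\<alpha>\<in>?E. c (\<alpha>(j := a)) * (\<Prod>i\<in>insert j J. (w(j := s)) i ^ (\<alpha>(j := a)) i))"
        using insert.prems(1)[of "w(j := s)"] unfolding sum_eq by simp
      also have "\<dots> = (\<Sum>a\<le>t. d a * s ^ a)"
        unfolding prod.insert[OF insert.hyps] pr
        by (simp add: d_def sum_distrib_right sum_distrib_left mult_ac)
      finally show ?thesis by (simp add: P_def poly_sum poly_monom)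
    qed
    then have "P = 0" using alg_closed_nonroot[of P] by blast
    moreover have "coeff P a = d a" using that by (simp add: P_def coeff_sum)
    ultimately show ?thesis by (simp add: d_def)
  qed
  obtain a \<beta> where ab: "a \<le> t" "\<beta> \<in> ?E" "\<alpha> = \<beta>(j := a)"
    using insert.prems(2) unfolding PiE_insert_eq by auto
  have "(\<lambda>\<beta>. c (\<beta>(j := a))) \<beta> = 0"
    by (rule insert.IH[of "\<lambda>\<beta>. c (\<beta>(j := a))" \<beta>, OF *[OF ab(1)] ab(2)])
  then show ?case by (simp only: ab(3))
qed

text \<open>The rule \<open>cong\<close> makes this the linear span of the restrictions to
  \<open>X\<close>, so that relations valid only on \<open>X\<close> can be used for
  rewriting.\<close>

inductive_set span_on :: "'a set \<Rightarrow> ('a \<Rightarrow> 'k::comm_ring_1) set \<Rightarrow> ('a \<Rightarrow> 'k) set" for X S where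
  zero: "0 \<in> span_on X S"
| base: "s \<in> S \<Longrightarrow> s \<in> span_on X S"
| add: "g \<in> span_on X S \<Longrightarrow> h \<in> span_on X S \<Longrightarrow> g + h \<in> span_on X S"
| scale: "g \<in> span_on X S \<Longrightarrow> (\<lambda>_. c) * g \<in> span_on X S"
| cong: "g \<in> span_on X S \<Longrightarrow> (\<And>x. x \<in> X \<Longrightarrow> h x = g x) \<Longrightarrow> h \<in> span_on X S"

lemma span_on_mult:
  assumes "g \<in> span_on X S" "\<And>s. s \<in> S \<Longrightarrow> f * s \<in> span_on X S'"
  shows "f * g \<in> span_on X S'"
  using assms(1)
proof (induction rule: span_on.induct)
  case zero
  show ?case unfolding mult_zero_right by (rule span_on.zero)
next
  case (base s)
  then show ?case by (rule assms(2))
next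
  case (add g h)
  then show ?case unfolding distrib_left by (intro span_on.add)
next
  case (scale g c)
  have "(\<lambda>_. c) * (f * g) \<in> span_on X S'" by (rule span_on.scale[OF scale.IH])
  then show ?case by (simp only: mult.left_commute)
next
  case (cong g h)
  show ?case by (rule span_on.cong[OF cong.IH]) (simp add: cong.hyps(2))
qed

lemma span_on_mono:
  assumes "g \<in> span_on X S" "S \<subseteq> S'"
  shows "g \<in> span_on X S'"
  using span_on_mult[OF assms(1), of 1 S'] assms(2) by (auto intro: span_on.base)

lemma span_on_sum: "(\<And>i. i \<in> I \<Longrightarrow> f i \<in> span_on X S) \<Longrightarrow> sum f I \<in> span_on X S"
  by (induction I rule: infinite_finite_induct) (auto intro: span_on.zero span_on.add)

lemma span_on_coeffs:
  assumes "finite S" "g \<in> span_on X S"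
  shows "\<exists>c. \<forall>x\<in>X. g x = (\<Sum>s\<in>S. c s * s x)"
  using assms(2)
proof (induction rule: span_on.induct)
  case zero
  show ?case by (intro exI[of _ "\<lambda>_. 0"]) simp
next
  case (base s)
  have "(\<Sum>u\<in>S. (if u = s then 1 else 0) * u x) = s x" for x
  proof -
    have "(\<Sum>u\<in>S. (if u = s then 1 else 0) * u x) = (\<Sum>u\<in>S. if u = s then u x else 0)"
      by (intro sum.cong) auto
    also have "\<dots> = s x" using assms(1) base by (simp add: sum.delta)
    finally show ?thesis .
  qed
  then show ?case by (intro exI[of _ "\<lambda>u. if u = s then 1 else 0"]) simp
next
  case (add g h)
  from add.IH obtain c d where cd: "\<forall>x\<in>X. g x = (\<Sum>s\<in>S. c s * s x)"
    "\<forall>x\<in>X. h x = (\<Sum>s\<in>S. d s * s x)" by (elim exE)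
  then show ?case by (intro exI[of _ "\<lambda>s. c s + d s"]) (simp add: distrib_right sum.distrib)
next
  case (scale g k)
  from scale.IH obtain c where c: "\<forall>x\<in>X. g x = (\<Sum>s\<in>S. c s * s x)" by (elim exE)
  then show ?case by (intro exI[of _ "\<lambda>s. k * c s"]) (simp add: sum_distrib_left mult.assoc)
next
  case (cong g h)
  from cong.IH obtain c where c: "\<forall>x\<in>X. g x = (\<Sum>s\<in>S. c s * s x)" by (elim exE)
  then show ?case using cong.hyps(2) by (intro exI[of _ c]) simp
qed

definition monomial :: "('i::finite \<Rightarrow> nat) \<Rightarrow> ('i \<Rightarrow> 'k::comm_ring_1) \<Rightarrow> 'k" where
  "monomial \<alpha> x = (\<Prod>i\<in>UNIV. x i ^ \<alpha> i)"

lemma monomial_upd: "monomial \<alpha> x = x i ^ \<alpha> i * monomial (\<alpha>(i := 0)) x"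
proof -
  have "monomial \<alpha> x = x i ^ \<alpha> i * (\<Prod>j\<in>UNIV - {i}. x j ^ \<alpha> j)"
    unfolding monomial_def by (rule prod.remove) auto
  moreover have "monomial (\<alpha>(i := 0)) x = (\<Prod>j\<in>UNIV - {i}. x j ^ \<alpha> j)"
    unfolding monomial_def by (subst prod.remove[of _ i]) auto
  ultimately show ?thesis by simp
qed

lemma monomial_upd': "monomial (\<alpha>(i := k)) x = x i ^ k * monomial (\<alpha>(i := 0)) x"
  using monomial_upd[of "\<alpha>(i := k)" x i] by simp

text \<open>The first factor holds free powers of the \<open>F\<close>-coordinates up to
  \<open>B\<close>, the second the powers below the degrees of the relations. The
  \<open>F\<close>-coordinates occur in both, so products may coincide; this does no harm to an
  upper bound for their number.\<close>

definition box_monomials ::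
  "('i::finite \<Rightarrow> nat) \<Rightarrow> 'i set \<Rightarrow> nat \<Rightarrow> (('i \<Rightarrow> 'k::comm_ring_1) \<Rightarrow> 'k) set" where
  "box_monomials D F B = (\<lambda>(\<beta>, \<gamma>). monomial \<beta> * monomial \<gamma>) `
     (PiE UNIV (\<lambda>i. if i \<in> F then {..B} else {0}) \<times> PiE UNIV (\<lambda>i. {..<D i}))"

lemma box_monomialsE:
  assumes "s \<in> box_monomials D F B"
  obtains \<beta> \<gamma> where "s = monomial \<beta> * monomial \<gamma>" "\<And>i. i \<in> F \<Longrightarrow> \<beta> i \<le> B"
    "\<And>i. i \<notin> F \<Longrightarrow> \<beta> i = 0" "\<And>i. \<gamma> i < D i"
proof -
  obtain \<beta> \<gamma> where *: "s = monomial \<beta> * monomial \<gamma>"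
    "\<beta> \<in> PiE UNIV (\<lambda>i. if i \<in> F then {..B} else {0})" "\<gamma> \<in> PiE UNIV (\<lambda>i. {..<D i})"
    using assms unfolding box_monomials_def by auto
  show ?thesis
  proof (rule that[OF *(1)])
    show "\<beta> i \<le> B" if "i \<in> F" for i using PiE_mem[OF *(2), of i] that by simp
    show "\<beta> i = 0" if "i \<notin> F" for i using PiE_mem[OF *(2), of i] that by simp
    show "\<gamma> i < D i" for i using PiE_mem[OF *(3), of i] by simp
  qed
qed

lemma box_monomialsI:
  assumes "\<And>i. i \<in> F \<Longrightarrow> \<beta> i \<le> B" "\<And>i. i \<notin> F \<Longrightarrow> \<beta> i = 0" "\<And>i. \<gamma> i < D i"
  shows "monomial \<beta> * monomial \<gamma> \<in> box_monomials D F B"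
proof -
  have "(\<beta>, \<gamma>) \<in> PiE UNIV (\<lambda>i. if i \<in> F then {..B} else {0}) \<times> PiE UNIV (\<lambda>i. {..<D i})"
    using assms by auto
  from imageI[OF this, of "\<lambda>(\<beta>, \<gamma>). monomial \<beta> * monomial \<gamma>"]
  show ?thesis unfolding box_monomials_def by (simp only: prod.case)
qed

lemma finite_box_monomials: "finite (box_monomials D F B)"
  unfolding box_monomials_def by (intro finite_imageI finite_cartesian_product finite_PiE) auto

lemma card_box_monomials_le:
  "card (box_monomials D F B) \<le> (B + 1) ^ card F * (\<Prod>i\<in>UNIV. D i)"
proof -
  have fin: "finite (PiE UNIV (\<lambda>i. if i \<in> F then {..B} else {0}) \<times> PiE UNIV (\<lambda>i. {..<D i}))"
    by (intro finite_cartesian_product finite_PiE) auto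
  have "card (PiE UNIV (\<lambda>i. if i \<in> F then {..B} else {0})) = (\<Prod>i\<in>UNIV. card (if i \<in> F then {..B} else {0}))"
    by (rule card_PiE) simp
  also have "\<dots> = (\<Prod>i\<in>UNIV. if i \<in> F then B + 1 else 1)"
    by (intro prod.cong) auto
  also have "\<dots> = (B + 1) ^ card F"
    by (simp add: prod.If_cases)
  finally show ?thesis
    unfolding box_monomials_def using card_image_le[OF fin]
    by (simp add: card_cartesian_product card_PiE)
qed

text \<open>
  If every coordinate \<open>x\<^sub>i\<close> is a root on \<open>X\<close> of a polynomial \<open>P i\<close> over the functions of the
  \<open>F\<close>-coordinates, then every polynomial function, multiplied by a power of the product of the
  leading coefficients, maps the span of \<open>box_monomials D F B\<close> to that of
  \<open>box_monomials D F (B + e)\<close>.  The number of these monomials grows like \<open>B ^ card F\<close>, which leaves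
  no room for the monomials in more than \<open>card F\<close> independent functions.
\<close>

context
  fixes X :: "('i::finite \<Rightarrow> 'k::alg_closed_field) set" and F :: "'i set"
    and P :: "'i \<Rightarrow> (('i \<Rightarrow> 'k) \<Rightarrow> 'k) poly"
  assumes irr: "irr X" and P_in: "\<And>i. P i \<in> coeffs_in (poly_fun_in F)"
    and P_rel: "\<And>i. vanishes_on X (at_coord (P i) i)"
    and P_lead: "\<And>i. \<not> vanishes_on X (lead_coeff (P i))"
    and P_deg: "\<And>i. degree (P i) > 0"
begin

abbreviation (input) "box_span B \<equiv> span_on X (box_monomials (\<lambda>i. degree (P i)) F B)"

lemma box_span_mono: "g \<in> box_span B \<Longrightarrow> B \<le> B' \<Longrightarrow> g \<in> box_span B'"
proof (erule span_on_mono, rule subsetI)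
  fix s :: "('i \<Rightarrow> 'k) \<Rightarrow> 'k" assume "B \<le> B'" "s \<in> box_monomials (\<lambda>i. degree (P i)) F B"
  then show "s \<in> box_monomials (\<lambda>i. degree (P i)) F B'"
    by (elim box_monomialsE) (auto intro!: box_monomialsI intro: le_trans)
qed

text \<open>A coordinate in \<open>F\<close> raises one exponent of the free factor by one, so the
  box merely grows; \<open>e\<close> is in effect a crude degree bound for \<open>b\<close>.\<close>

lemma box_span_mult_base:
  assumes "b \<in> poly_fun_in F"
  shows "\<exists>e. \<forall>B. \<forall>g\<in>box_span B. b * g \<in> box_span (B + e)"
  using assms
proof (induction rule: poly_fun_in.induct)
  case (const c)
  show ?case by (intro exI[of _ 0] allI ballI) (simp only: add_0_right span_on.scale)
next
  case (coord j)
  have "(\<lambda>x. x j) * g \<in> box_span (B + 1)" if g: "g \<in> box_span B" for g B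
    using g
  proof (rule span_on_mult)
    fix s :: "('i \<Rightarrow> 'k) \<Rightarrow> 'k" assume "s \<in> box_monomials (\<lambda>i. degree (P i)) F B"
    then obtain \<beta> \<gamma> where s: "s = monomial \<beta> * monomial \<gamma>" "\<And>i. i \<in> F \<Longrightarrow> \<beta> i \<le> B"
      "\<And>i. i \<notin> F \<Longrightarrow> \<beta> i = 0" "\<And>i. \<gamma> i < degree (P i)" by (elim box_monomialsE) blast
    have "(\<lambda>x :: 'i \<Rightarrow> 'k. x j) * monomial \<beta> = monomial (\<beta>(j := \<beta> j + 1))"
    proof (rule ext)
      fix x :: "'i \<Rightarrow> 'k"
      show "((\<lambda>x. x j) * monomial \<beta>) x = monomial (\<beta>(j := \<beta> j + 1)) x"
        unfolding monomial_upd'[of \<beta> j "\<beta> j + 1"] by (simp add: monomial_upd[of \<beta> x j])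
    qed
    then have eq: "(\<lambda>x. x j) * s = monomial (\<beta>(j := \<beta> j + 1)) * monomial \<gamma>"
      unfolding s(1) by (simp only: mult.assoc[symmetric])
    show "(\<lambda>x. x j) * s \<in> box_span (B + 1)"
      unfolding eq using s coord by (intro span_on.base box_monomialsI) (auto intro: le_SucI)
  qed
  then show ?case by blast
next
  case (add p q)
  then obtain e e' where e: "\<forall>B. \<forall>g\<in>box_span B. p * g \<in> box_span (B + e)" "\<forall>B. \<forall>g\<in>box_span B. q * g \<in> box_span (B + e')"
    by (elim exE)
  have "(\<lambda>x. p x + q x) * g \<in> box_span (B + (e + e'))" if "g \<in> box_span B" for g B
  proof -
    have "p * g \<in> box_span (B + (e + e'))" by (rule box_span_mono[OF e(1)[rule_format, OF that]]) simp
    moreover have "q * g \<in> box_span (B + (e + e'))" by (rule box_span_mono[OF e(2)[rule_format, OF that]]) simp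
    ultimately have "p * g + q * g \<in> box_span (B + (e + e'))" by (rule span_on.add)
    then show ?thesis by (rule span_on.cong) (simp add: distrib_right)
  qed
  then show ?case by blast
next
  case (mult p q)
  then obtain e e' where e: "\<forall>B. \<forall>g\<in>box_span B. p * g \<in> box_span (B + e)" "\<forall>B. \<forall>g\<in>box_span B. q * g \<in> box_span (B + e')"
    by (elim exE)
  have "(\<lambda>x. p x * q x) * g \<in> box_span (B + (e' + e))" if "g \<in> box_span B" for g B
  proof -
    have "p * (q * g) \<in> box_span (B + e' + e)" using e that by blast
    then show ?thesis unfolding add.assoc by (rule span_on.cong) (simp add: mult.assoc)
  qed
  then show ?case by blast
qed

lemma lead_in: "lead_coeff (P i) \<in> poly_fun_in F"
  using lead_coeff_in[OF P_in] .

lemma prod_lead_coeff_in: "(\<Prod>i\<in>I. lead_coeff (P i)) \<in> poly_fun_in F"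
  by (rule poly_fun_in_prod) (rule lead_in)

abbreviation (input) "lead_prod \<equiv> \<Prod>i\<in>UNIV. lead_coeff (P i)"

text \<open>The new exponent in the bounded factor either stays below \<open>degree (P i)\<close> or
  equals it. In the second case the relation \<open>P i\<close>, times the remaining monomial
  \<open>m 0\<close>, expresses the product with the leading coefficient through lower powers of the
  \<open>i\<close>-th coordinate.\<close>

lemma box_span_mult_lead_coord_monomial:
  assumes e: "\<And>k. \<forall>B. \<forall>g\<in>box_span B. coeff (P i) k * g \<in> box_span (B + e k)"
    and s: "s \<in> box_monomials (\<lambda>i. degree (P i)) F B"
  shows "lead_coeff (P i) * ((\<lambda>x. x i) * s) \<in> box_span (B + (\<Sum>k\<le>degree (P i). e k))"
proof -
  define d where "d = degree (P i)"
  have e': "coeff (P i) k * g \<in> box_span (B + (\<Sum>k\<le>d. e k))" if "g \<in> box_span B" "k \<le> d" for g k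
  proof -
    have "e k \<le> (\<Sum>k\<le>d. e k)" using that(2) by (intro member_le_sum) auto
    then show ?thesis by (intro box_span_mono[OF e[of k, rule_format, OF that(1)]]) simp
  qed
  obtain \<beta> \<gamma> where \<beta>\<gamma>: "s = monomial \<beta> * monomial \<gamma>" "\<And>i. i \<in> F \<Longrightarrow> \<beta> i \<le> B"
    "\<And>i. i \<notin> F \<Longrightarrow> \<beta> i = 0" "\<And>i. \<gamma> i < degree (P i)" using s by (elim box_monomialsE) blast
  define m where "m = (\<lambda>k. monomial \<beta> * (monomial (\<gamma>(i := k)) :: ('i \<Rightarrow> 'k) \<Rightarrow> 'k))"
  have m: "m k \<in> box_span B" if "k < d" for k
    unfolding m_def using \<beta>\<gamma> that by (intro span_on.base box_monomialsI) (auto simp: d_def)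
  have m_eq: "m k x = x i ^ k * m 0 x" for k x
    by (simp add: m_def monomial_upd'[of \<gamma> i k x] mult_ac)
  have xs: "(\<lambda>x. x i) * s = m (\<gamma> i + 1)"
  proof (rule ext)
    fix x :: "'i \<Rightarrow> 'k"
    have "s x = m (\<gamma> i) x" by (simp add: m_def \<beta>\<gamma>(1))
    then show "((\<lambda>x. x i) * s) x = m (\<gamma> i + 1) x"
      using m_eq[of "\<gamma> i" x] m_eq[of "\<gamma> i + 1" x] by simp
  qed
  show ?thesis
  proof (cases "\<gamma> i + 1 < d")
    case True
    show ?thesis using e'[OF m[OF True], of d] by (simp add: xs d_def)
  next
    case False
    then have \<gamma>d: "\<gamma> i + 1 = d" using \<beta>\<gamma>(4)[of i] by (simp add: d_def)
    have "- (\<Sum>k<d. coeff (P i) k * m k) = (\<lambda>_. - 1) * (\<Sum>k<d. coeff (P i) k * m k)"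
      by (rule ext) simp
    also have "\<dots> \<in> box_span (B + (\<Sum>k\<le>d. e k))"
      by (intro span_on.scale span_on_sum e' m) auto
    finally have "- (\<Sum>k<d. coeff (P i) k * m k) \<in> box_span (B + (\<Sum>k\<le>d. e k))" .
    then have "lead_coeff (P i) * m d \<in> box_span (B + (\<Sum>k\<le>d. e k))"
    proof (rule span_on.cong)
      fix x assume x: "x \<in> X"
      have "0 = (\<Sum>k\<le>d. coeff (P i) k x * x i ^ k) * m 0 x"
        using P_rel[of i] x by (simp add: poly_altdef sum_fun_apply power_fun_apply d_def)
      also have "\<dots> = (\<Sum>k\<le>d. coeff (P i) k x * m k x)"
        by (simp add: sum_distrib_right mult.assoc m_eq[symmetric])
      also have "\<dots> = (\<Sum>k<d. coeff (P i) k x * m k x) + coeff (P i) d x * m d x"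
        by (simp add: lessThan_Suc_atMost[symmetric])
      finally show "(lead_coeff (P i) * m d) x = (- (\<Sum>k<d. coeff (P i) k * m k)) x"
        by (simp add: sum_fun_apply d_def eq_neg_iff_add_eq_0 add.commute)
    qed
    then show ?thesis unfolding xs \<gamma>d d_def .
  qed
qed

lemma box_span_mult_coord: "\<exists>e. \<forall>B. \<forall>g\<in>box_span B. lead_prod * ((\<lambda>x. x i) * g) \<in> box_span (B + e)"
proof -
  have "\<exists>e. \<forall>B. \<forall>g\<in>box_span B. coeff (P i) k * g \<in> box_span (B + e)" for k
    using P_in[of i] by (intro box_span_mult_base) (auto simp: coeffs_in_def)
  then obtain e where e: "\<And>k. \<forall>B. \<forall>g\<in>box_span B. coeff (P i) k * g \<in> box_span (B + e k)" by metis
  define L where "L = (\<Prod>j\<in>UNIV - {i}. lead_coeff (P j))"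
  have lead_prod: "lead_prod = L * lead_coeff (P i)"
    unfolding L_def by (subst prod.remove[of _ i]) (auto simp: mult.commute)
  obtain e' where e': "\<forall>B. \<forall>g\<in>box_span B. L * g \<in> box_span (B + e')"
    using box_span_mult_base[OF prod_lead_coeff_in[of "UNIV - {i}"]] unfolding L_def by (elim exE)
  have "lead_prod * ((\<lambda>x. x i) * g) \<in> box_span (B + ((\<Sum>k\<le>degree (P i). e k) + e'))" if "g \<in> box_span B" for g B
  proof -
    have "(lead_coeff (P i) * (\<lambda>x. x i)) * g \<in> box_span (B + (\<Sum>k\<le>degree (P i). e k))"
      using that
    proof (rule span_on_mult)
      fix s :: "('i \<Rightarrow> 'k) \<Rightarrow> 'k" assume "s \<in> box_monomials (\<lambda>i. degree (P i)) F B"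
      from box_span_mult_lead_coord_monomial[OF e this]
      show "(lead_coeff (P i) * (\<lambda>x. x i)) * s \<in> box_span (B + (\<Sum>k\<le>degree (P i). e k))"
        by (simp only: mult.assoc)
    qed
    then have "L * ((lead_coeff (P i) * (\<lambda>x. x i)) * g) \<in> box_span (B + (\<Sum>k\<le>degree (P i). e k) + e')"
      using e' by blast
    then show ?thesis unfolding lead_prod by (simp only: mult.assoc add.assoc)
  qed
  then show ?thesis by blast
qed

text \<open>Surplus factors \<open>lead_prod\<close> enlarge the box only linearly, which allows
  different powers of it to be brought to a common one.\<close>

lemma box_span_mult_lead: "\<exists>e. \<forall>n B. \<forall>g\<in>box_span B. lead_prod ^ n * g \<in> box_span (B + n * e)"
proof -
  obtain e where e: "\<forall>B. \<forall>g\<in>box_span B. lead_prod * g \<in> box_span (B + e)"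
    using box_span_mult_base[OF prod_lead_coeff_in[of UNIV]] by (elim exE)
  have "lead_prod ^ n * g \<in> box_span (B + n * e)" if "g \<in> box_span B" for n g B
  proof (induction n)
    case 0
    show ?case using that by simp
  next
    case (Suc n)
    then have "lead_prod * (lead_prod ^ n * g) \<in> box_span (B + n * e + e)" using e by blast
    moreover have "B + n * e + e = B + Suc n * e" by simp
    ultimately show ?case by (simp only: power_Suc mult.assoc)
  qed
  then show ?thesis by blast
qed

lemma box_span_mult_poly_fun:
  assumes "z \<in> poly_fun"
  shows "\<exists>n e. \<forall>B. \<forall>g\<in>box_span B. lead_prod ^ n * (z * g) \<in> box_span (B + e)"
proof -
  obtain ea where ea: "\<forall>n B. \<forall>g\<in>box_span B. lead_prod ^ n * g \<in> box_span (B + n * ea)"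
    using box_span_mult_lead by (elim exE)
  show ?thesis
    using assms
  proof (induction rule: poly_fun.induct)
    case (const c)
    show ?case by (intro exI[of _ 0] exI[of _ 0] allI ballI)
      (simp only: add_0_right power_0 mult_1_left span_on.scale)
  next
    case (coord i)
    from box_span_mult_coord[of i] obtain e where "\<forall>B. \<forall>g\<in>box_span B. lead_prod * ((\<lambda>x. x i) * g) \<in> box_span (B + e)"
      by (elim exE)
    then show ?case by (intro exI[of _ 1] exI[of _ e]) (simp only: power_one_right)
  next
    case (add p q)
    then obtain n e n' e' where e: "\<forall>B. \<forall>g\<in>box_span B. lead_prod ^ n * (p * g) \<in> box_span (B + e)"
      "\<forall>B. \<forall>g\<in>box_span B. lead_prod ^ n' * (q * g) \<in> box_span (B + e')" by (elim exE)
    define E where "E = e + e' + (n + n') * ea"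
    have "lead_prod ^ (n + n') * ((\<lambda>x. p x + q x) * g) \<in> box_span (B + E)" if g: "g \<in> box_span B" for g B
    proof -
      have "lead_prod ^ n' * (lead_prod ^ n * (p * g)) \<in> box_span (B + E)"
        by (rule box_span_mono[OF ea[rule_format, OF e(1)[rule_format, OF g]]])
          (simp add: E_def algebra_simps)
      moreover have "lead_prod ^ n * (lead_prod ^ n' * (q * g)) \<in> box_span (B + E)"
        by (rule box_span_mono[OF ea[rule_format, OF e(2)[rule_format, OF g]]])
          (simp add: E_def algebra_simps)
      ultimately have "lead_prod ^ n' * (lead_prod ^ n * (p * g)) + lead_prod ^ n * (lead_prod ^ n' * (q * g)) \<in> box_span (B + E)"
        by (rule span_on.add)
      then show ?thesis by (rule span_on.cong) (simp add: power_add algebra_simps)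
    qed
    then show ?case by blast
  next
    case (mult p q)
    then obtain n e n' e' where e: "\<forall>B. \<forall>g\<in>box_span B. lead_prod ^ n * (p * g) \<in> box_span (B + e)"
      "\<forall>B. \<forall>g\<in>box_span B. lead_prod ^ n' * (q * g) \<in> box_span (B + e')" by (elim exE)
    have "lead_prod ^ (n + n') * ((\<lambda>x. p x * q x) * g) \<in> box_span (B + (e' + e))" if g: "g \<in> box_span B" for g B
    proof -
      have "lead_prod ^ n * (p * (lead_prod ^ n' * (q * g))) \<in> box_span (B + e' + e)" using e g by blast
      then show ?thesis unfolding add.assoc
        by (rule span_on.cong) (simp add: power_add algebra_simps)
    qed
    then show ?case by blast
  qed
qed

text \<open>With \<open>N = card J\<close>, the \<open>(t + 1) ^ N\<close> monomials in the
  \<open>y j\<close> with exponents up to \<open>t\<close>, all multiplied by the same power of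
  \<open>lead_prod\<close>, lie in a span of box monomials whose number is of order
  \<open>t ^ card F\<close>. If \<open>N\<close> were larger than \<open>card F\<close>, a linear
  relation for large \<open>t\<close> would contradict independence.\<close>

lemma card_le_of_algebraic:
  fixes y :: "'j \<Rightarrow> ('i \<Rightarrow> 'k) \<Rightarrow> 'k"
  assumes J: "finite J" and y: "\<And>j. y j \<in> poly_fun"
    and ind: "independent_coords J ((\<lambda>x j. y j x) ` X)"
  shows "card J \<le> card F"
proof (rule ccontr)
  assume "\<not> card J \<le> card F"
  then have less: "card F + 1 \<le> card J" by simp
  obtain ea where ea: "\<forall>n B. \<forall>g\<in>box_span B. lead_prod ^ n * g \<in> box_span (B + n * ea)"
    using box_span_mult_lead by (elim exE)
  have "\<forall>j. \<exists>n e. \<forall>B. \<forall>g\<in>box_span B. lead_prod ^ n * (y j * g) \<in> box_span (B + e)"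
    by (rule allI) (rule box_span_mult_poly_fun[OF y])
  from choice[OF this] obtain \<nu> where
    "\<forall>j. \<exists>e. \<forall>B. \<forall>g\<in>box_span B. lead_prod ^ \<nu> j * (y j * g) \<in> box_span (B + e)" by (elim exE)
  from choice[OF this] obtain \<epsilon> where
    \<nu>: "\<forall>j B. \<forall>g\<in>box_span B. lead_prod ^ \<nu> j * (y j * g) \<in> box_span (B + \<epsilon> j)" by (elim exE)
  \<comment> \<open>Sums over \<open>J\<close> give one power and one growth constant that serve for
    multiplication by any \<open>y j\<close> as well as by no \<open>y j\<close> at all.\<close>
  define n where "n = (\<Sum>j\<in>J. \<nu> j)"
  define e where "e = (\<Sum>j\<in>J. \<epsilon> j) + n * ea"
  have n0: "lead_prod ^ n * g \<in> box_span (B + e)" if "g \<in> box_span B" for g B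
    by (rule box_span_mono[OF ea[rule_format, OF that]]) (simp add: e_def)
  have n1: "lead_prod ^ n * (y j * g) \<in> box_span (B + e)" if "g \<in> box_span B" "j \<in> J" for g B j
  proof -
    have le: "\<nu> j \<le> n" "\<epsilon> j \<le> (\<Sum>j\<in>J. \<epsilon> j)" unfolding n_def using that J by (auto intro: member_le_sum)
    have "lead_prod ^ (n - \<nu> j) * (lead_prod ^ \<nu> j * (y j * g)) \<in> box_span (B + \<epsilon> j + (n - \<nu> j) * ea)"
      using \<nu> ea that by blast
    also have "lead_prod ^ (n - \<nu> j) * (lead_prod ^ \<nu> j * (y j * g)) = lead_prod ^ n * (y j * g)"
      using le by (simp only: mult.assoc[symmetric] power_add[symmetric]) simp
    finally show ?thesis
      by (rule box_span_mono) (use le in \<open>auto simp: e_def intro!: add_mono mult_le_mono\<close>)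
  qed
  have pow: "lead_prod ^ (n * t) * (y j ^ k * g) \<in> box_span (B + e * t)" if "k \<le> t" "g \<in> box_span B" "j \<in> J" for k t g B j
    using that
  proof (induction t arbitrary: k)
    case 0
    then show ?case by simp
  next
    case (Suc t)
    show ?case
    proof (cases "k \<le> t")
      case True
      from n0[OF Suc.IH[OF this Suc.prems(2,3)]] show ?thesis
        by (rule span_on.cong[OF box_span_mono]) (simp_all add: power_add algebra_simps)
    next
      case False
      then have k: "k = Suc t" using Suc.prems by simp
      from n1[OF Suc.IH[OF le_refl Suc.prems(2,3)] Suc.prems(3)] show ?thesis
        by (rule span_on.cong[OF box_span_mono]) (simp_all add: k power_add algebra_simps)
    qed
  qed
  have prods: "lead_prod ^ (n * t * card I) * (\<Prod>j\<in>I. y j ^ \<alpha> j) \<in> box_span (e * t * card I)"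
    if I: "I \<subseteq> J" and \<alpha>: "\<And>j. j \<in> I \<Longrightarrow> \<alpha> j \<le> t" for I \<alpha> t
    using finite_subset[OF I J] I \<alpha>
  proof (induction I rule: finite_induct)
    case empty
    have "monomial (\<lambda>_. 0) * monomial (\<lambda>_. 0) \<in> box_span 0"
      using P_deg by (intro span_on.base box_monomialsI) auto
    then show ?case by (rule span_on.cong[OF box_span_mono]) (simp_all add: monomial_def)
  next
    case (insert j I)
    then have "\<alpha> j \<le> t" "j \<in> J" "lead_prod ^ (n * t * card I) * (\<Prod>j\<in>I. y j ^ \<alpha> j) \<in> box_span (e * t * card I)"
      by blast+
    from pow[OF this(1,3,2)]
    have "lead_prod ^ (n * t) * (y j ^ \<alpha> j * (lead_prod ^ (n * t * card I) * (\<Prod>j\<in>I. y j ^ \<alpha> j))) \<in> box_span (e * t * card I + e * t)" .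
    then have "lead_prod ^ (n * t) * (y j ^ \<alpha> j * (lead_prod ^ (n * t * card I) * (\<Prod>j\<in>I. y j ^ \<alpha> j)))
      \<in> box_span (e * t * card (insert j I))"
      by (rule box_span_mono) (simp add: insert.hyps algebra_simps)
    also have "lead_prod ^ (n * t) * (y j ^ \<alpha> j * (lead_prod ^ (n * t * card I) * (\<Prod>j\<in>I. y j ^ \<alpha> j))) =
      lead_prod ^ (n * t + n * t * card I) * (y j ^ \<alpha> j * (\<Prod>j\<in>I. y j ^ \<alpha> j))"
      by (simp only: power_add mult_ac)
    also have "\<dots> = lead_prod ^ (n * t * card (insert j I)) * (\<Prod>j\<in>insert j I. y j ^ \<alpha> j)"
      using insert.hyps by simp
    finally show ?case .
  qed
  define Q where "Q = (\<Prod>i\<in>UNIV. degree (P i))"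
  define N where "N = card J"
  \<comment> \<open>Since \<open>e * t * N + 1 \<le> (e * N + 1) * (t + 1)\<close>, this value
    bounds the number of box monomials by \<open>(t + 1) ^ card F * t\<close>, just below
    \<open>(t + 1) ^ (card F + 1)\<close>.\<close>
  define t where "t = (e * N + 1) ^ card F * Q"
  define S where "S = PiE J (\<lambda>_. {..t})"
  define T where "T = (box_monomials (\<lambda>i. degree (P i)) F (e * t * N) :: (('i \<Rightarrow> 'k) \<Rightarrow> 'k) set)"
  have finS: "finite S" unfolding S_def using J by (intro finite_PiE) auto
  have finT: "finite T" unfolding T_def by (rule finite_box_monomials)
  have "card T \<le> (e * t * N + 1) ^ card F * Q"
    unfolding T_def Q_def by (rule card_box_monomials_le)
  also have "\<dots> \<le> ((e * N + 1) * (t + 1)) ^ card F * Q"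
    by (intro mult_right_mono power_mono) (auto simp: algebra_simps)
  also have "\<dots> = (t + 1) ^ card F * t" by (simp only: t_def power_mult_distrib mult_ac)
  also have "\<dots> < (t + 1) ^ (card F + 1)" by simp
  also have "\<dots> \<le> (t + 1) ^ N" unfolding N_def by (rule power_increasing[OF less]) simp
  also have "\<dots> = card S" unfolding S_def N_def using J by (simp add: card_PiE)
  finally have card: "card T < card S" .
  define b where "b = lead_prod ^ (n * t * N)"
  have "\<exists>c. \<forall>x\<in>X. (b * (\<Prod>j\<in>J. y j ^ \<alpha> j)) x = (\<Sum>s\<in>T. c s * s x)" if "\<alpha> \<in> S" for \<alpha>
  proof (rule span_on_coeffs[OF finT])
    have \<alpha>_le: "\<alpha> j \<le> t" if "j \<in> J" for j using \<open>\<alpha> \<in> S\<close> that unfolding S_def by (auto dest: PiE_mem)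
    have "lead_prod ^ (n * t * card J) * (\<Prod>j\<in>J. y j ^ \<alpha> j) \<in> box_span (e * t * card J)"
      by (rule prods[OF subset_refl \<alpha>_le])
    then show "b * (\<Prod>j\<in>J. y j ^ \<alpha> j) \<in> span_on X T"
      unfolding b_def T_def N_def .
  qed
  then have "\<forall>\<alpha>\<in>S. \<exists>c. \<forall>x\<in>X. (b * (\<Prod>j\<in>J. y j ^ \<alpha> j)) x = (\<Sum>s\<in>T. c s * s x)" by blast
  from bchoice[OF this] obtain c where
    c: "\<forall>\<alpha>\<in>S. \<forall>x\<in>X. (b * (\<Prod>j\<in>J. y j ^ \<alpha> j)) x = (\<Sum>s\<in>T. c \<alpha> s * s x)" by (elim exE)
  obtain l where l: "\<exists>\<alpha>\<in>S. l \<alpha> \<noteq> 0" "\<forall>s\<in>T. (\<Sum>\<alpha>\<in>S. l \<alpha> * c \<alpha> s) = 0"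
    using nontrivial_relation[OF finT finS card, of c] by (elim exE conjE)
  define q where "q = (\<Sum>\<alpha>\<in>S. (\<lambda>_. l \<alpha>) * (\<Prod>j\<in>J. (\<lambda>w. w j) ^ \<alpha> j))"
  have q: "q \<in> poly_fun_in J" unfolding q_def by (intro poly_fun_in_closed) auto
  have q_eq: "q w = (\<Sum>\<alpha>\<in>S. l \<alpha> * (\<Prod>j\<in>J. w j ^ \<alpha> j))" for w
    by (simp add: q_def sum_fun_apply prod_fun_apply power_fun_apply)
  \<comment> \<open>The relation \<open>l\<close> kills every coefficient at a box monomial. The
    factor \<open>b\<close> is cancelled afterwards by irreducibility, leaving a polynomial relation
    among the \<open>y j\<close>.\<close>
  have van: "vanishes_on X (\<lambda>x. b x * q (\<lambda>j. y j x))"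
  proof
    fix x assume x: "x \<in> X"
    have "b x * q (\<lambda>j. y j x) = (\<Sum>\<alpha>\<in>S. l \<alpha> * (b * (\<Prod>j\<in>J. y j ^ \<alpha> j)) x)"
      by (simp add: q_eq sum_distrib_left prod_fun_apply power_fun_apply mult_ac)
    also have "\<dots> = (\<Sum>\<alpha>\<in>S. \<Sum>s\<in>T. l \<alpha> * c \<alpha> s * s x)"
      using c x by (intro sum.cong) (auto simp: sum_distrib_left mult.assoc)
    also have "\<dots> = (\<Sum>s\<in>T. (\<Sum>\<alpha>\<in>S. l \<alpha> * c \<alpha> s) * s x)"
      by (subst sum.swap) (simp add: sum_distrib_right)
    also have "\<dots> = 0" using l(2) by simp
    finally show "b x * q (\<lambda>j. y j x) = 0" .
  qed
  have Apf: "lead_prod \<in> poly_fun" using prod_lead_coeff_in[of UNIV] by (rule poly_fun_in_poly_fun)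
  have "\<not> vanishes_on X lead_prod"
    using poly_fun_in_poly_fun[OF lead_in] P_lead by (intro irr_prod[OF irr]) auto
  then have "\<not> vanishes_on X b" unfolding b_def by (rule irr_power[OF irr Apf])
  moreover have "b \<in> poly_fun" unfolding b_def by (rule poly_fun_closed(9)[OF Apf])
  moreover have "(\<lambda>x. q (\<lambda>j. y j x)) \<in> poly_fun"
    by (rule poly_fun_subst[OF poly_fun_in_poly_fun[OF q]]) (simp add: y)
  ultimately have "vanishes_on X (\<lambda>x. q (\<lambda>j. y j x))" using irrD[OF irr _ _ van] by blast
  then have "vanishes_on ((\<lambda>x j. y j x) ` X) q" by blast
  then have "q = 0" using ind q unfolding independent_coords_def by blast
  have "l \<alpha> = 0" if "\<alpha> \<in> S" for \<alpha>
  proof (rule monomials_independent[OF J _ that[unfolded S_def]])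
    show "(\<Sum>\<alpha>\<in>PiE J (\<lambda>_. {..t}). l \<alpha> * (\<Prod>j\<in>J. w j ^ \<alpha> j)) = 0" for w
      using q_eq[of w] \<open>q = 0\<close> by (simp add: S_def)
  qed
  then show False using l(1) by blast
qed

end

section \<open>Transcendence bases consisting of coordinates\<close>

definition maximal_independent :: "'i set \<Rightarrow> ('i \<Rightarrow> 'k::comm_ring_1) set \<Rightarrow> bool" where
  "maximal_independent F X \<longleftrightarrow> independent_coords F X \<and> (\<forall>i. i \<notin> F \<longrightarrow> \<not> independent_coords (insert i F) X)"

lemma extend_to_maximal_independent:
  fixes X :: "('i::finite \<Rightarrow> 'k::comm_ring_1) set"
  assumes "independent_coords F0 X"
  obtains F where "F0 \<subseteq> F" "maximal_independent F X"
proof -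
  let ?S = "{F. F0 \<subseteq> F \<and> independent_coords F X}"
  have "?S \<noteq> {}" using assms by blast
  moreover have "finite ?S" by simp
  ultimately obtain F where F: "F \<in> ?S" "\<And>F'. F' \<in> ?S \<Longrightarrow> F \<subseteq> F' \<Longrightarrow> F = F'"
    using finite_has_maximal[of ?S] by metis
  have "\<not> independent_coords (insert i F) X" if "i \<notin> F" for i
    using F(1) F(2)[of "insert i F"] that by blast
  then show ?thesis using F(1) that unfolding maximal_independent_def by blast
qed

lemma algebraic_over_dependent:
  assumes "independent_coords F X" "\<not> independent_coords (insert i F) X"
  shows "\<exists>P\<in>coeffs_in (poly_fun_in F). vanishes_on X (at_coord P i) \<and> \<not> vanishes_on X (lead_coeff P)"
proof -
  obtain q where q: "q \<in> poly_fun_in (insert i F)" "vanishes_on X q" "q \<noteq> 0"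
    using assms(2) by (auto simp: independent_coords_def)
  obtain Q where Q: "Q \<in> coeffs_in (poly_fun_in F)" "q = at_coord Q i"
    using q(1) by (rule poly_fun_in_insertE)
  have "Q \<noteq> 0" using Q(2) q(3) by auto
  then have "lead_coeff Q \<noteq> 0" by simp
  then have "\<not> vanishes_on X (lead_coeff Q)"
    by (rule independent_coordsD[OF assms(1) lead_coeff_in[OF Q(1)]])
  then show ?thesis using Q q(2) by blast
qed

text \<open>Maximality of \<open>F\<close> makes every coordinate algebraic over the
  \<open>F\<close>-coordinates, which is what the counting argument asks for.\<close>

lemma card_independent_functions_le:
  fixes X :: "('i::finite \<Rightarrow> 'k::alg_closed_field) set" and y :: "'j \<Rightarrow> ('i \<Rightarrow> 'k) \<Rightarrow> 'k"
  assumes irr: "irr X" and F: "maximal_independent F X"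
    and "finite J" "\<And>j. y j \<in> poly_fun" "independent_coords J ((\<lambda>x j. y j x) ` X)"
  shows "card J \<le> card F"
proof -
  have "\<exists>P\<in>coeffs_in (poly_fun_in F). vanishes_on X (at_coord P i) \<and> \<not> vanishes_on X (lead_coeff P)" for i
  proof (cases "i \<in> F")
    case True
    \<comment> \<open>A coordinate in \<open>F\<close> gets the trivial relation of degree 1, so
      that relations are available for all coordinates alike.\<close>
    let ?P = "[:- (\<lambda>x. x i), 1:] :: (('i \<Rightarrow> 'k) \<Rightarrow> 'k) poly"
    have "?P \<in> coeffs_in (poly_fun_in F)"
      using True by (auto simp: coeffs_in_def coeff_pCons intro!: poly_fun_in_closed split: nat.splits)
    moreover have "vanishes_on X (at_coord ?P i)" by simp
    moreover have "\<not> vanishes_on X (lead_coeff ?P)" using irr by (auto simp: irr_def)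
    ultimately show ?thesis by blast
  next
    case False
    then have "independent_coords F X" "\<not> independent_coords (insert i F) X"
      using F unfolding maximal_independent_def by blast+
    then show ?thesis by (rule algebraic_over_dependent)
  qed
  then have "\<forall>i. \<exists>P. P \<in> coeffs_in (poly_fun_in F) \<and> vanishes_on X (at_coord P i) \<and>
    \<not> vanishes_on X (lead_coeff P)" by blast
  from choice[OF this] obtain P where P: "\<forall>i. P i \<in> coeffs_in (poly_fun_in F) \<and>
    vanishes_on X (at_coord (P i) i) \<and> \<not> vanishes_on X (lead_coeff (P i))" by (elim exE)
  have deg: "degree (P i) > 0" for i
  proof (rule ccontr)
    assume "\<not> degree (P i) > 0"
    then obtain c where "P i = [:c:]" by (auto elim: degree_eq_zeroE)
    then show False using P[rule_format, of i] by auto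
  qed
  show ?thesis
    by (rule card_le_of_algebraic[OF irr _ _ _ deg assms(3-5)]) (use P in blast)+
qed

text \<open>Nonzero polynomials in the \<open>y j\<close> give a multiplicative set of functions,
  none of which vanishes on \<open>A\<close>; \<open>minimal_closed_irr\<close> then yields the
  irreducible piece.\<close>

lemma independent_functions_obtain_irr:
  fixes A :: "('i::finite \<Rightarrow> 'k::alg_closed_field) set" and y :: "'j \<Rightarrow> ('i \<Rightarrow> 'k) \<Rightarrow> 'k"
  assumes "closedin zariski A" and y: "\<And>j. y j \<in> poly_fun"
    and ind: "independent_coords J ((\<lambda>x j. y j x) ` A)"
  obtains B where "B \<subseteq> A" "closedin zariski B" "irr B" "independent_coords J ((\<lambda>x j. y j x) ` B)"
proof -
  define M where "M = {(\<lambda>x. q (\<lambda>j. y j x)) | q. q \<in> poly_fun_in J \<and> q \<noteq> 0}"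
  have 1: "M \<subseteq> poly_fun"
  proof
    fix m assume "m \<in> M"
    then obtain q where q: "q \<in> poly_fun_in J" "m = (\<lambda>x. q (\<lambda>j. y j x))" unfolding M_def by blast
    show "m \<in> poly_fun" unfolding q(2)
      by (rule poly_fun_subst[OF poly_fun_in_poly_fun[OF q(1)]]) (simp add: y)
  qed
  have "(1 :: ('j \<Rightarrow> 'k) \<Rightarrow> 'k) \<noteq> 0" by simp
  then have 2: "M \<noteq> {}" unfolding M_def using poly_fun_in_1[of J] by blast
  have 3: "a * b \<in> M" if ab: "a \<in> M" "b \<in> M" for a b
  proof -
    obtain q r where e: "q \<in> poly_fun_in J" "q \<noteq> 0" "a = (\<lambda>x. q (\<lambda>j. y j x))"
      "r \<in> poly_fun_in J" "r \<noteq> 0" "b = (\<lambda>x. r (\<lambda>j. y j x))" using ab unfolding M_def by blast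
    obtain x where "q x \<noteq> 0" "r x \<noteq> 0"
      by (rule poly_fun_no_zero_divisors[OF _ _ e(2,5)]) (use e poly_fun_in_poly_fun in blast)+
    then have "(q * r) x \<noteq> 0" by simp
    then have "q * r \<noteq> 0" by (metis zero_fun_apply)
    moreover have "a * b = (\<lambda>x. (q * r) (\<lambda>j. y j x))" by (simp add: e fun_eq_iff)
    moreover have "q * r \<in> poly_fun_in J" using e by (intro poly_fun_in_times)
    ultimately show ?thesis unfolding M_def by blast
  qed
  have 4: "\<not> vanishes_on A m" if m: "m \<in> M" for m
  proof -
    obtain q where q: "q \<in> poly_fun_in J" "q \<noteq> 0" "m = (\<lambda>x. q (\<lambda>j. y j x))"
      using m unfolding M_def by blast
    show ?thesis using independent_coordsD[OF ind q(1,2)] unfolding q(3) by blast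
  qed
  obtain B where B: "B \<subseteq> A" "closedin zariski B" "irr B" "\<And>m. m \<in> M \<Longrightarrow> \<not> vanishes_on B m"
    by (rule minimal_closed_irr[OF assms(1) 1 2 3 4]) blast+
  show ?thesis
  proof (rule that[OF B(1-3)])
    show "independent_coords J ((\<lambda>x j. y j x) ` B)" unfolding independent_coords_def
    proof (intro ballI impI, rule ccontr)
      fix q assume q: "q \<in> poly_fun_in J" "vanishes_on ((\<lambda>x j. y j x) ` B) q" "q \<noteq> 0"
      then have "(\<lambda>x. q (\<lambda>j. y j x)) \<in> M" unfolding M_def by blast
      from B(4)[OF this] show False using q(2) by blast
    qed
  qed
qed

text \<open>Converts independent functions, such as those from a chain or a parametrisation, into at
  least as many independent coordinates, even on a reducible set.\<close>

lemma independent_coords_of_functions: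
  fixes A :: "('i::finite \<Rightarrow> 'k::alg_closed_field) set" and y :: "'j \<Rightarrow> ('i \<Rightarrow> 'k) \<Rightarrow> 'k"
  assumes "closedin zariski A" "finite J" "\<And>j. y j \<in> poly_fun"
    "independent_coords J ((\<lambda>x j. y j x) ` A)"
  obtains F where "independent_coords F A" "card J \<le> card F"
proof -
  obtain B where B: "B \<subseteq> A" "closedin zariski B" "irr B" "independent_coords J ((\<lambda>x j. y j x) ` B)"
    by (rule independent_functions_obtain_irr[OF assms(1,3,4)])
  then have "B \<noteq> {}" by (auto simp: irr_def)
  then obtain F where F: "maximal_independent F B"
    using extend_to_maximal_independent[OF independent_coords_empty] by blast
  have "card J \<le> card F" by (rule card_independent_functions_le[OF B(3) F assms(2,3) B(4)])
  moreover have "independent_coords F A"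
    using F B(1) unfolding maximal_independent_def by (blast intro: independent_coords_mono)
  ultimately show ?thesis using that by blast
qed


section \<open>Fibres of regular maps\<close>

lemma closedin_preimage:
  assumes "closedin zariski Z" "\<And>i. (\<lambda>x. g x i) \<in> poly_fun"
  shows "closedin zariski {x. g x \<in> Z}"
proof -
  obtain P where P: "P \<subseteq> poly_fun" "Z = zero_locus P" using assms(1) by (auto simp: closedin_zariski)
  have "{x. g x \<in> Z} = zero_locus ((\<lambda>p x. p (g x)) ` P)"
    unfolding P(2) zero_locus_def by auto
  moreover have "(\<lambda>p x. p (g x)) ` P \<subseteq> poly_fun"
  proof
    fix q assume "q \<in> (\<lambda>p x. p (g x)) ` P"
    then obtain p where "p \<in> P" "q = (\<lambda>x. p (g x))" by blast
    then show "q \<in> poly_fun" using P(1) poly_fun_subst[of p g, OF _ assms(2)] by auto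
  qed
  ultimately show ?thesis unfolding closedin_zariski by blast
qed

text \<open>The product of the functions \<open>w i - r\<close> over the finitely many roots
  \<open>r\<close> of \<open>Q\<close> vanishes on \<open>X\<close>, so one factor does.\<close>

lemma irr_coord_constant:
  fixes X :: "('i \<Rightarrow> 'k::alg_closed_field) set"
  assumes "irr X" "Q \<noteq> 0" "\<And>w. w \<in> X \<Longrightarrow> poly Q (w i) = 0" "x \<in> X" "y \<in> X"
  shows "x i = y i"
proof -
  define R where "R = {r. poly Q r = 0}"
  have fin: "finite R" unfolding R_def by (rule poly_roots_finite[OF assms(2)])
  define f where "f = (\<lambda>r (w :: 'i \<Rightarrow> 'k). w i + (- r))"
  have "\<exists>r\<in>R. vanishes_on X (f r)"
  proof (rule ccontr)
    assume *: "\<not> ?thesis"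
    have "\<not> vanishes_on X (prod f R)"
    proof (rule irr_prod[OF assms(1) fin])
      show "f s \<in> poly_fun" for s unfolding f_def by (intro poly_fun.intros)
      show "\<not> vanishes_on X (f s)" if "s \<in> R" for s using * that by blast
    qed
    then obtain w where w: "w \<in> X" "prod f R w \<noteq> 0" by blast
    have "w i \<in> R" using assms(3)[OF w(1)] by (simp add: R_def)
    then have "prod f R w = 0" using fin by (auto simp: prod_fun_apply f_def)
    then show False using w by simp
  qed
  then obtain r where "vanishes_on X (f r)" by blast
  then have "f r x = 0" "f r y = 0" using assms(4,5) by blast+
  then show ?thesis by (simp add: f_def)
qed

lemma regular_map_onE:
  assumes "regular_map_on S f"
  obtains s where "\<forall>i. s i \<in> poly_fun \<and> (\<forall>x\<in>S. f x i = s i x)"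
proof -
  have "\<forall>i. \<exists>q. q \<in> poly_fun \<and> (\<forall>x\<in>S. f x i = q x)"
    using assms unfolding regular_map_on_def by blast
  from choice[OF this] show ?thesis using that by blast
qed

text \<open>Fix the \<open>Inl\<close>-coordinates on which the others depend: this leaves an irreducible closed
  piece of a fibre on which the remaining \<open>Inr\<close>-coordinates are still independent.\<close>

lemma generic_fibre:
  fixes X :: "('a::finite + 'b::finite \<Rightarrow> 'k::alg_closed_field) set"
  assumes X: "closedin zariski X" "irr X"
  obtains F1 F2 X' where "maximal_independent (Inl ` F1 \<union> Inr ` F2) X"
    "X' \<subseteq> X" "X' \<noteq> {}" "\<forall>w\<in>X'. \<forall>w'\<in>X'. w \<circ> Inl = w' \<circ> Inl"
    "independent_coords (Inr ` F2) X'"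
proof -
  have ne: "X \<noteq> {}" using X(2) by (auto simp: irr_def)
  \<comment> \<open>\<open>F1\<close> is first made maximal among the independent sets of
    \<open>Inl\<close>-coordinates and only then extended. This order makes every other
    \<open>Inl\<close>-coordinate algebraic over \<open>F1\<close> alone.\<close>
  let ?S = "{F. F \<subseteq> range Inl \<and> independent_coords F X}"
  have "{} \<in> ?S" using independent_coords_empty[OF ne] by simp
  then have "?S \<noteq> {}" by blast
  moreover have "finite ?S" by simp
  ultimately have "\<exists>F1\<in>?S. \<forall>F'\<in>?S. F1 \<le> F' \<longrightarrow> F1 = F'"
    by (intro finite_has_maximal)
  then obtain F1 where F1: "F1 \<in> ?S" and max: "\<forall>F'\<in>?S. F1 \<le> F' \<longrightarrow> F1 = F'" by (elim bexE)
  have dep: "\<not> independent_coords (insert i F1) X" if "i \<in> range Inl - F1" for i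
  proof
    assume "independent_coords (insert i F1) X"
    then have "insert i F1 \<in> ?S" using F1 that by blast
    from max[rule_format, OF this] show False using that by blast
  qed
  have indF1: "independent_coords F1 X" using F1 by blast
  obtain F where F: "F1 \<subseteq> F" "maximal_independent F X"
    using extend_to_maximal_independent[OF indF1] .
  have F_Inl: "F \<inter> range Inl = F1"
  proof -
    have "independent_coords (F \<inter> range Inl) X"
      using F(2) unfolding maximal_independent_def by (blast intro: independent_coords_mono)
    then have "F \<inter> range Inl \<in> ?S" by blast
    moreover have "F1 \<subseteq> F \<inter> range Inl" using F1 F(1) by blast
    ultimately have "F1 = F \<inter> range Inl" by (rule max[rule_format])
    then show ?thesis by (rule sym)
  qed
  define F2 where "F2 = F - F1"
  have F2: "F = F1 \<union> F2" "F1 \<inter> F2 = {}" "F2 \<subseteq> range Inr"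
    using F(1) F_Inl UNIV_sum by (auto simp: F2_def)
  have "\<forall>i\<in>range Inl - F1. \<exists>P. P \<in> coeffs_in (poly_fun_in F1) \<and>
      vanishes_on X (at_coord P i) \<and> \<not> vanishes_on X (lead_coeff P)"
    using algebraic_over_dependent[OF indF1 dep] by blast
  from bchoice[OF this] obtain P where P: "\<forall>i\<in>range Inl - F1. P i \<in> coeffs_in (poly_fun_in F1) \<and>
      vanishes_on X (at_coord (P i) i) \<and> \<not> vanishes_on X (lead_coeff (P i))" by (elim exE)
  \<comment> \<open>Kept from vanishing on the section, so that each \<open>P i\<close> remains a
    nonzero polynomial once the \<open>F1\<close>-coordinates are fixed.\<close>
  define v where "v = (\<Prod>i\<in>range Inl - F1. lead_coeff (P i))"
  have lead: "lead_coeff (P i) \<in> poly_fun_in F1" if "i \<in> range Inl - F1" for i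
    using P that lead_coeff_in by blast
  have v: "v \<in> poly_fun"
    unfolding v_def using poly_fun_in_poly_fun[OF lead] by (rule poly_fun_closed)
  have vX: "\<not> vanishes_on X v"
    unfolding v_def
  proof (rule irr_prod[OF X(2)])
    show "lead_coeff (P i) \<in> poly_fun" if "i \<in> range Inl - F1" for i
      by (rule poly_fun_in_poly_fun[OF lead[OF that]])
    show "\<not> vanishes_on X (lead_coeff (P i))" if "i \<in> range Inl - F1" for i
      using P that by blast
  qed simp
  have "independent_coords (F1 \<union> F2) X" using F(2) F2(1) by (simp add: maximal_independent_def)
  from hyperplane_sections[OF X F2(2) this v vX]
  obtain X' where X': "X' \<subseteq> X" "irr X'" "\<forall>i\<in>F1. \<forall>x\<in>X'. \<forall>y\<in>X'. x i = y i"
    "independent_coords F2 X'" "\<not> vanishes_on X' v" by blast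
  obtain w0 where w0: "w0 \<in> X'" "v w0 \<noteq> 0" using X'(5) by blast
  have const: "p w = p w0" if "p \<in> poly_fun_in F1" "w \<in> X'" for p w
    using that X'(3) w0(1) by (intro poly_fun_in_cong[of p F1]) auto
  \<comment> \<open>On \<open>X'\<close> the coefficients of \<open>P i\<close> are constant, so the
    coordinate \<open>i\<close> takes its values among the roots of one polynomial
    \<open>Q\<close>.\<close>
  have Inl_const: "w i = w' i" if i: "i \<in> range Inl" and w: "w \<in> X'" "w' \<in> X'" for i w w'
  proof (cases "i \<in> F1")
    case True
    then show ?thesis using X'(3) w by blast
  next
    case False
    then have i: "i \<in> range Inl - F1" using i by blast
    define Q where "Q = eval_coeffs w0 (P i)"
    have "lead_coeff (P i) w0 \<noteq> 0"
      using w0(2) i unfolding v_def prod_fun_apply by (auto simp: prod_zero_iff)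
    then have "coeff Q (degree (P i)) \<noteq> 0" by (simp add: Q_def)
    then have "Q \<noteq> 0" by auto
    moreover have "poly Q (u i) = 0" if u: "u \<in> X'" for u
    proof -
      have "coeff (P i) k u = coeff (P i) k w0" for k
        using P i by (intro const u) (auto simp: coeffs_in_def)
      then have "eval_coeffs u (P i) = Q" unfolding Q_def by (intro poly_eqI) simp
      moreover have "at_coord (P i) i u = 0" using P i u X'(1) by blast
      ultimately show ?thesis by (simp add: poly_fun_apply)
    qed
    ultimately show ?thesis by (rule irr_coord_constant[OF X'(2) _ _ w])
  qed
  have F1_img: "F1 = Inl ` (Inl -` F1)" using F1 by blast
  have F2_img: "F2 = Inr ` (Inr -` F2)" using F2(3) by blast
  show ?thesis
  proof (rule that[of "Inl -` F1" "Inr -` F2" X'])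
    show "maximal_independent (Inl ` (Inl -` F1) \<union> Inr ` (Inr -` F2)) X"
      unfolding F1_img[symmetric] F2_img[symmetric] using F(2) F2(1) by simp
    show "X' \<noteq> {}" using w0 by blast
    show "\<forall>w\<in>X'. \<forall>w'\<in>X'. w \<circ> Inl = w' \<circ> Inl"
      using Inl_const by (auto simp: fun_eq_iff)
    show "independent_coords (Inr ` (Inr -` F2)) X'" unfolding F2_img[symmetric] by (rule X'(4))
  qed (rule X'(1))
qed

text \<open>On the graph of \<open>f\<close> the map becomes a coordinate projection, so
  \<open>generic_fibre\<close> applies: \<open>F1\<close> is independent on \<open>C\<close>,
  \<open>F2\<close> on a fibre, and together they have at least \<open>card E\<close> elements
  because the graph projects onto \<open>X\<close>.\<close>

lemma fibre_dimension:
  fixes X :: "('b::finite \<Rightarrow> 'k::alg_closed_field) set" and f :: "('b \<Rightarrow> 'k) \<Rightarrow> ('a::finite \<Rightarrow> 'k)"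
  assumes X: "closedin zariski X" "irr X" and f: "regular_map_on X f" "f ` X \<subseteq> C"
    and E: "independent_coords E X"
    and fibre: "\<And>x F. x \<in> X \<Longrightarrow> independent_coords F {y\<in>X. f y = f x} \<Longrightarrow> card F \<le> d"
  obtains F where "independent_coords F C" "card E \<le> card F + d"
proof -
  obtain s where s: "\<forall>a. s a \<in> poly_fun \<and> (\<forall>x\<in>X. f x a = s a x)"
    by (rule regular_map_onE[OF f(1)])
  have f_s: "f x = (\<lambda>a. s a x)" if "x \<in> X" for x using s that by auto
  define \<gamma> where "\<gamma> = (\<lambda>x. case_sum (\<lambda>a. s a x) x)"
  define \<Gamma> where "\<Gamma> = \<gamma> ` X"
  have \<gamma>_Inl: "\<gamma> x \<circ> Inl = (\<lambda>a. s a x)" and \<gamma>_Inr: "\<gamma> x \<circ> Inr = x" for x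
    by (auto simp: \<gamma>_def)
  have irr: "irr \<Gamma>"
    unfolding \<Gamma>_def
  proof (rule irr_image[OF X(2)])
    fix i :: "'a + 'b"
    have "(\<lambda>x. \<gamma> x i) \<in> poly_fun" using s by (cases i) (auto simp: \<gamma>_def intro: poly_fun.intros)
    then show "\<exists>p\<in>poly_fun. \<forall>x\<in>X. \<gamma> x i = p x" by (intro bexI[of _ "\<lambda>x. \<gamma> x i"]) simp
  qed
  have coord_Inr: "(\<lambda>w :: 'a + 'b \<Rightarrow> 'k. (w \<circ> Inr) i) \<in> poly_fun" for i
    using poly_fun.coord[of "Inr i"] by simp
  have closed: "closedin zariski \<Gamma>"
  proof -
    define D where "D = (\<lambda>a (w :: 'a + 'b \<Rightarrow> 'k). w (Inl a) + (- 1) * s a (w \<circ> Inr))"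
    have "D a \<in> poly_fun" for a
    proof -
      have "(\<lambda>w :: 'a + 'b \<Rightarrow> 'k. s a (w \<circ> Inr)) \<in> poly_fun"
        by (rule poly_fun_subst[OF _ coord_Inr]) (use s in blast)
      from poly_fun.add[OF poly_fun.coord poly_fun.mult[OF poly_fun.const this]]
      show ?thesis unfolding D_def .
    qed
    then have "closedin zariski (\<Inter>a. {w. D a w = 0})"
      by (intro closedin_INT closedin_zariski_vanishing) auto
    moreover have "closedin zariski {w :: 'a + 'b \<Rightarrow> 'k. w \<circ> Inr \<in> X}"
      using X(1) coord_Inr by (rule closedin_preimage)
    moreover have "\<Gamma> = {w. w \<circ> Inr \<in> X} \<inter> (\<Inter>a. {w. D a w = 0})"
    proof (intro equalityI subsetI)
      fix w assume "w \<in> \<Gamma>"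
      then obtain x where x: "x \<in> X" "w = \<gamma> x" unfolding \<Gamma>_def by blast
      have "D a w = 0" for a using \<gamma>_Inr[of x] by (simp add: D_def x(2)) (simp add: \<gamma>_def)
      then show "w \<in> {w. w \<circ> Inr \<in> X} \<inter> (\<Inter>a. {w. D a w = 0})" using x \<gamma>_Inr by simp
    next
      fix w assume w: "w \<in> {w. w \<circ> Inr \<in> X} \<inter> (\<Inter>a. {w. D a w = 0})"
      have "w i = \<gamma> (w \<circ> Inr) i" for i
      proof (cases i)
        case (Inl a)
        have "D a w = 0" using w by blast
        then show ?thesis by (simp add: Inl D_def \<gamma>_def)
      qed (simp add: \<gamma>_def)
      then have "w = \<gamma> (w \<circ> Inr)" by auto
      then show "w \<in> \<Gamma>" using w unfolding \<Gamma>_def by blast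
    qed
    ultimately show ?thesis by (simp add: closedin_Int)
  qed
  obtain F1 F2 \<Gamma>' where F: "maximal_independent (Inl ` F1 \<union> Inr ` F2) \<Gamma>" and
    \<Gamma>': "\<Gamma>' \<subseteq> \<Gamma>" "\<Gamma>' \<noteq> {}" "\<forall>w\<in>\<Gamma>'. \<forall>w'\<in>\<Gamma>'. w \<circ> Inl = w' \<circ> Inl"
    "independent_coords (Inr ` F2) \<Gamma>'" by (rule generic_fibre[OF closed irr])
  have indC: "independent_coords F1 C" unfolding independent_coords_def
  proof (intro ballI impI ext)
    fix q and u :: "'a \<Rightarrow> 'k" assume q: "q \<in> poly_fun_in F1" "vanishes_on C q"
    define q' where "q' = (\<lambda>w :: 'a + 'b \<Rightarrow> 'k. q (w \<circ> Inl))"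
    have "q' \<in> poly_fun_in (Inl ` F1)"
      unfolding q'_def
    proof (rule poly_fun_in_subst[OF q(1)])
      show "(\<lambda>w :: 'a + 'b \<Rightarrow> 'k. (w \<circ> Inl) i) \<in> poly_fun_in (Inl ` F1)" if "i \<in> F1" for i
        using that poly_fun_in.coord[of "Inl i" "Inl ` F1"] by simp
    qed
    moreover have "independent_coords (Inl ` F1) \<Gamma>"
      using F unfolding maximal_independent_def by (blast intro: independent_coords_mono)
    moreover have "vanishes_on \<Gamma> q'"
    proof
      fix w assume "w \<in> \<Gamma>"
      then obtain x where x: "x \<in> X" "w = \<gamma> x" unfolding \<Gamma>_def by blast
      have "w \<circ> Inl = f x" unfolding x(2) \<gamma>_Inl f_s[OF x(1)] ..
      moreover have "f x \<in> C" using f(2) x(1) by blast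
      ultimately show "q' w = 0" using q(2) by (simp add: q'_def)
    qed
    ultimately have "q' = 0" unfolding independent_coords_def by blast
    from fun_cong[OF this, of "case_sum u (\<lambda>_. 0)"]
    show "q u = 0 u" by (simp add: q'_def comp_def)
  qed
  obtain w0 where w0: "w0 \<in> \<Gamma>'" using \<Gamma>'(2) by blast
  then obtain x0 where x0: "x0 \<in> X" "w0 = \<gamma> x0" using \<Gamma>'(1) unfolding \<Gamma>_def by blast
  have "independent_coords F2 {y\<in>X. f y = f x0}" unfolding independent_coords_def
  proof (intro ballI impI ext)
    fix q and u :: "'b \<Rightarrow> 'k" assume q: "q \<in> poly_fun_in F2" "vanishes_on {y\<in>X. f y = f x0} q"
    define q' where "q' = (\<lambda>w :: 'a + 'b \<Rightarrow> 'k. q (w \<circ> Inr))"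
    have "q' \<in> poly_fun_in (Inr ` F2)"
      unfolding q'_def
    proof (rule poly_fun_in_subst[OF q(1)])
      show "(\<lambda>w :: 'a + 'b \<Rightarrow> 'k. (w \<circ> Inr) i) \<in> poly_fun_in (Inr ` F2)" if "i \<in> F2" for i
        using that poly_fun_in.coord[of "Inr i" "Inr ` F2"] by simp
    qed
    moreover have "vanishes_on \<Gamma>' q'"
    proof
      fix w assume w: "w \<in> \<Gamma>'"
      then obtain x where x: "x \<in> X" "w = \<gamma> x" using \<Gamma>'(1) unfolding \<Gamma>_def by blast
      have "f x = f x0"
        using \<Gamma>'(3)[rule_format, OF w w0] unfolding x(2) x0(2) \<gamma>_Inl f_s[OF x(1)] f_s[OF x0(1)] .
      moreover have "w \<circ> Inr = x" unfolding x(2) by (rule \<gamma>_Inr)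
      ultimately show "q' w = 0" using q(2) x(1) by (simp add: q'_def)
    qed
    ultimately have "q' = 0" using \<Gamma>'(4) unfolding independent_coords_def by blast
    from fun_cong[OF this, of "case_sum (\<lambda>_. 0) u"]
    show "q u = 0 u" by (simp add: q'_def comp_def)
  qed
  then have card2: "card F2 \<le> d" by (rule fibre[OF x0(1)])
  have "(\<lambda>w j. w (Inr j)) ` \<Gamma> = X" unfolding \<Gamma>_def by (auto simp: image_image \<gamma>_def)
  then have "card E \<le> card (Inl ` F1 \<union> Inr ` F2)"
    using E by (intro card_independent_functions_le[OF irr F, of E "\<lambda>j w. w (Inr j)"])
      (auto intro: poly_fun.coord)
  also have "\<dots> \<le> card F1 + card F2"
    by (metis card_Un_le card_image inj_Inl inj_Inr)
  finally show ?thesis using that[OF indC] card2 by linarith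
qed

section \<open>Degrees of the unknowns from the rank condition\<close>

lemma rank_deficient_kernel_rat:
  fixes A :: "'s \<Rightarrow> 'm::finite \<Rightarrow> int"
  assumes "matrix_rank I A < CARD('m)"
  obtains c :: "'m \<Rightarrow> rat" where "\<exists>j. c j \<noteq> 0" "\<forall>i\<in>I. (\<Sum>j\<in>UNIV. of_int (A i j) * c j) = 0"
proof -
  define S where "S = (\<lambda>i. (\<chi> j. of_int (A i j)) :: rat ^ 'm) ` I"
  obtain B where B: "B \<subseteq> S" "vec.independent B" "S \<subseteq> vec.span B"
    using vec.maximal_independent_subset[of S] by blast
  have "vec.span B \<noteq> UNIV"
  proof
    assume "vec.span B = UNIV"
    moreover have "vec.span S = vec.span B"
      using vec.span_minimal[OF B(3) vec.subspace_span] vec.span_mono[OF B(1)] by blast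
    ultimately have "vec.dim S = CARD('m)"
      using vec.dim_span[of S] vec_dim_card[where 'a = rat and 'n = 'm] by metis
    then show False using assms unfolding matrix_rank_def S_def by simp
  qed
  then obtain e where e: "e \<notin> vec.span B" by blast
  have ins: "vec.independent (insert e B)" using e B(2) by (simp add: vec.independent_insert)
  have "e \<notin> B" using e vec.span_base by blast
  \<comment> \<open>What is wanted is a linear form that vanishes on \<open>B\<close> but not at
    \<open>e\<close>. It is read off from one coordinate of a map of \<open>rat ^ 'm\<close> to
    itself; \<open>undefined\<close> is just some fixed index.\<close>
  obtain g where g: "Vector_Spaces.linear (*s) (*s) g" "\<forall>x\<in>insert e B. g x = (if x = e then axis undefined 1 else 0 :: rat ^ 'm)"
    using vec.linear_independent_extend[OF ins, of "\<lambda>x. if x = e then axis undefined 1 else 0"] by blast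
  interpret g: Vector_Spaces.linear "(*s)" "(*s)" g by (rule g(1))
  define c where "c = (\<lambda>j. g (axis j 1) $ undefined)"
  have expand: "g x $ undefined = (\<Sum>j\<in>UNIV. x $ j * c j)" for x
  proof -
    have "x = (\<Sum>j\<in>UNIV. x $ j *s axis j 1)" by (simp add: basis_expansion)
    then have "g x = (\<Sum>j\<in>UNIV. x $ j *s g (axis j 1))" by (metis (no_types, lifting) g.scale g.sum sum.cong)
    then show ?thesis by (simp add: c_def)
  qed
  have "g e $ undefined = 1" using g(2) by (simp add: axis_def)
  then have "\<exists>j. c j \<noteq> 0" unfolding expand by (metis (no_types, lifting) mult_zero_right sum.neutral zero_neq_one)
  moreover have "(\<Sum>j\<in>UNIV. of_int (A i j) * c j) = 0" if "i \<in> I" for i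
  proof -
    have "(\<chi> j. of_int (A i j)) \<in> vec.span B" using B(3) that unfolding S_def by blast
    moreover have "g b = 0" if "b \<in> B" for b using g(2) that \<open>e \<notin> B\<close> by auto
    ultimately have "g (\<chi> j. of_int (A i j)) = 0" by (rule g.eq_0_on_span[rotated])
    then show ?thesis using expand[of "\<chi> j. of_int (A i j)"] by simp
  qed
  then have "\<forall>i\<in>I. (\<Sum>j\<in>UNIV. of_int (A i j) * c j) = 0" by blast
  ultimately show ?thesis by (rule that)
qed

lemma rank_deficient_kernel:
  fixes A :: "'s \<Rightarrow> 'm::finite \<Rightarrow> int"
  assumes "matrix_rank I A < CARD('m)"
  obtains a :: "'m \<Rightarrow> int" where "\<exists>j. a j \<noteq> 0" "\<forall>i\<in>I. (\<Sum>j\<in>UNIV. A i j * a j) = 0"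
proof -
  from rank_deficient_kernel_rat[OF assms] obtain c :: "'m \<Rightarrow> rat" where c: "\<exists>j. c j \<noteq> 0"
    "\<forall>i\<in>I. (\<Sum>j\<in>UNIV. of_int (A i j) * c j) = 0" .
  define N where "N = (\<Prod>j\<in>UNIV. snd (quotient_of (c j)))"
  have pos: "snd (quotient_of (c j)) > 0" for j by (rule quotient_of_denom_pos')
  then have N: "N > 0" unfolding N_def by (intro prod_pos) auto
  have "\<exists>z. of_int N * c j = of_int z" for j
  proof -
    have "c j = of_int (fst (quotient_of (c j))) / of_int (snd (quotient_of (c j)))"
      by (rule quotient_of_div) simp
    moreover have "N = snd (quotient_of (c j)) * (\<Prod>k\<in>UNIV - {j}. snd (quotient_of (c k)))"
      unfolding N_def by (rule prod.remove) auto
    ultimately have "of_int N * c j = of_int (fst (quotient_of (c j)) * (\<Prod>k\<in>UNIV - {j}. snd (quotient_of (c k))))"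
      using pos[of j] by (simp add: field_simps)
    then show ?thesis by blast
  qed
  then obtain a where a: "\<And>j. of_int N * c j = of_int (a j)" by metis
  show ?thesis
  proof (rule that[of a])
    obtain j where "c j \<noteq> 0" using c(1) by blast
    then have "of_int (a j) \<noteq> (0 :: rat)" using a[of j] N by (metis less_irrefl mult_eq_0_iff of_int_eq_0_iff)
    then show "\<exists>j. a j \<noteq> 0" by auto
    show "\<forall>i\<in>I. (\<Sum>j\<in>UNIV. A i j * a j) = 0"
    proof
      fix i assume "i \<in> I"
      have "of_int (\<Sum>j\<in>UNIV. A i j * a j) = (\<Sum>j\<in>UNIV. of_int (A i j) * (of_int N * c j))"
        by (simp add: a)
      also have "\<dots> = of_int N * (\<Sum>j\<in>UNIV. of_int (A i j) * c j)"
        by (simp add: sum_distrib_left mult_ac)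
      also have "\<dots> = 0" using c(2) \<open>i \<in> I\<close> by simp
      finally show "(\<Sum>j\<in>UNIV. A i j * a j) = 0" by (simp only: of_int_eq_0_iff)
    qed
  qed
qed


section \<open>Twisting solutions of equations\<close>

text \<open>\<open>deg_rel G S X a g d\<close>: some word with coefficients in \<open>S\<close> takes the value \<open>g\<close> at \<open>X\<close> and has
  degree \<open>d\<close>, the unknown \<open>x\<^sub>j\<close> having degree \<open>a j\<close>.  The degree need not be determined by \<open>g\<close>.\<close>

inductive deg_rel :: "('g, 'b) monoid_scheme \<Rightarrow> 'g set \<Rightarrow> ('m \<Rightarrow> 'g) \<Rightarrow> ('m \<Rightarrow> int) \<Rightarrow> 'g \<Rightarrow> int \<Rightarrow> bool"
  for G S X a where
  one: "deg_rel G S X a \<one>\<^bsub>G\<^esub> 0"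
| coeff: "s \<in> S \<Longrightarrow> deg_rel G S X a s 0"
| unknown: "deg_rel G S X a (X j) (a j)"
| mult: "deg_rel G S X a g d \<Longrightarrow> deg_rel G S X a g' d' \<Longrightarrow> deg_rel G S X a (g \<otimes>\<^bsub>G\<^esub> g') (d + d')"
| inv: "deg_rel G S X a g d \<Longrightarrow> deg_rel G S X a (inv\<^bsub>G\<^esub> g) (- d)"

definition word_degree :: "('m::finite \<Rightarrow> int) \<Rightarrow> ('g, 'm) letter list \<Rightarrow> int" where
  "word_degree a w = (\<Sum>j\<in>UNIV. exponent_sum w j * a j)"

lemma word_degree_simps:
  "word_degree a [] = 0"
  "word_degree a (Unknown j # w) = a j + word_degree a w"
  "word_degree a (Inv_Unknown j # w) = - a j + word_degree a w"
  "word_degree a (Coeff s # w) = word_degree a w"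
proof -
  have 1: "(\<Sum>k\<in>UNIV. (if k = j then c else 0) * a k) = c * a j" for c :: int and j
    by (simp add: if_distrib[of "\<lambda>c. c * _"] cong: if_cong)
  have U: "exponent_sum (Unknown j # w) k = (if k = j then 1 else 0) + exponent_sum w k" for k
    by (simp add: exponent_sum_def)
  have V: "exponent_sum (Inv_Unknown j # w) k = (if k = j then - 1 else 0) + exponent_sum w k" for k
    by (simp add: exponent_sum_def)
  show "word_degree a (Unknown j # w) = a j + word_degree a w"
    unfolding word_degree_def U by (simp add: distrib_right sum.distrib 1[of j 1, simplified])
  show "word_degree a (Inv_Unknown j # w) = - a j + word_degree a w"
    unfolding word_degree_def V by (simp only: distrib_right sum.distrib 1[of j "- 1"])
  show "word_degree a [] = 0" "word_degree a (Coeff s # w) = word_degree a w"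
    by (simp_all add: word_degree_def exponent_sum_def)
qed

section \<open>Graded homomorphisms and twists in an abstract group\<close>

context group
begin

lemma inv_cancel_left:
  "x \<in> carrier G \<Longrightarrow> y \<in> carrier G \<Longrightarrow> inv x \<otimes> (x \<otimes> y) = y"
  "x \<in> carrier G \<Longrightarrow> y \<in> carrier G \<Longrightarrow> x \<otimes> (inv x \<otimes> y) = y"
  by (simp_all add: m_assoc[symmetric])

lemma centraliser_mult:
  assumes "S \<subseteq> carrier G" "x \<in> centraliser G S" "y \<in> centraliser G S"
  shows "x \<otimes> y \<in> centraliser G S"
  unfolding centraliser_def
proof safe
  have x: "x \<in> carrier G" and y: "y \<in> carrier G" using assms by (auto simp: centraliser_def)
  then show "x \<otimes> y \<in> carrier G" by simp
  fix s assume "s \<in> S"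
  then have s: "s \<in> carrier G" "x \<otimes> s = s \<otimes> x" "y \<otimes> s = s \<otimes> y"
    using assms by (auto simp: centraliser_def)
  have "x \<otimes> y \<otimes> s = x \<otimes> (s \<otimes> y)" using x y s by (simp add: m_assoc)
  also have "\<dots> = s \<otimes> (x \<otimes> y)" using x y s by (simp add: m_assoc[symmetric])
  finally show "x \<otimes> y \<otimes> s = s \<otimes> (x \<otimes> y)" .
qed

lemma centraliser_inv:
  assumes "S \<subseteq> carrier G" "x \<in> centraliser G S"
  shows "inv x \<in> centraliser G S"
  unfolding centraliser_def
proof safe
  have x: "x \<in> carrier G" using assms by (auto simp: centraliser_def)
  then show "inv x \<in> carrier G" by simp
  fix s assume "s \<in> S"
  then have s: "s \<in> carrier G" "x \<otimes> s = s \<otimes> x" using assms by (auto simp: centraliser_def)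
  have "inv x \<otimes> s = inv x \<otimes> (s \<otimes> x) \<otimes> inv x" using x s(1) by (simp add: m_assoc)
  also have "\<dots> = s \<otimes> inv x" unfolding s(2)[symmetric] using x s(1) by (simp add: m_assoc inv_cancel_left)
  finally show "inv x \<otimes> s = s \<otimes> inv x" .
qed

lemma centraliser_one: "S \<subseteq> carrier G \<Longrightarrow> \<one> \<in> centraliser G S"
  by (auto simp: centraliser_def)

context
  fixes S :: "'a set" and X :: "'m::finite \<Rightarrow> 'a"
  assumes S: "S \<subseteq> carrier G" and X: "\<forall>j. X j \<in> carrier G"
begin

lemma deg_rel_carrier: "deg_rel G S X a g d \<Longrightarrow> g \<in> carrier G"
  by (induction rule: deg_rel.induct) (use S X in auto)

lemma deg_rel_int_pow:
  assumes "deg_rel G S X a g d"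
  shows "deg_rel G S X a (g [^] (n :: int)) (n * d)"
proof -
  have nat: "deg_rel G S X a (g [^] (k :: nat)) (int k * d)" for k
  proof (induction k)
    case 0
    show ?case using deg_rel.one[of G S X a] by simp
  next
    case (Suc k)
    from deg_rel.mult[OF this assms] show ?case by (simp add: algebra_simps)
  qed
  show ?thesis
  proof (cases n)
    case (nonneg k)
    then show ?thesis using nat[of k] by (simp add: int_pow_int)
  next
    case (neg k)
    have "g [^] n = inv (g [^] Suc k)" unfolding neg using deg_rel_carrier[OF assms]
      by (rule int_pow_neg_int)
    then show ?thesis using deg_rel.inv[OF nat[of "Suc k"]] by (simp only: neg mult_minus_left)
  qed
qed

text \<open>The degrees of words form a subgroup of the integers, generated by its least positive
  element \<open>d0\<close>. As \<open>d0\<close> divides them all, dividing by \<open>d0\<close> is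
  compatible with \<open>deg_rel\<close> and turns degree \<open>d0\<close> into degree 1.\<close>

lemma normalise_degrees:
  assumes "a j0 \<noteq> 0"
  obtains d0 a' t where "d0 \<noteq> 0" "\<forall>j. a j = d0 * a' j" "deg_rel G S X a' t 1"
proof -
  define P where "P = (\<lambda>n :: nat. n > 0 \<and> (\<exists>g. deg_rel G S X a g (int n)))"
  have "\<exists>n. P n"
  proof (cases "a j0 > 0")
    case True
    then show ?thesis using deg_rel.unknown[of G S X a j0]
      by (intro exI[of _ "nat (a j0)"]) (auto simp: P_def)
  next
    case False
    then show ?thesis using deg_rel.inv[OF deg_rel.unknown[of G S X a j0]] assms
      by (intro exI[of _ "nat (- a j0)"]) (auto simp: P_def)
  qed
  define n where "n = (LEAST n. P n)"
  have n: "P n" unfolding n_def by (rule LeastI_ex[OF \<open>\<exists>n. P n\<close>])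
  have least: "n \<le> m" if "P m" for m unfolding n_def using that by (rule Least_le)
  define d0 where "d0 = int n"
  obtain t where t: "deg_rel G S X a t d0" and d0: "d0 > 0" using n by (auto simp: P_def d0_def)
  have dvd: "d0 dvd d" if "deg_rel G S X a g d" for g d
  proof (rule ccontr)
    assume "\<not> d0 dvd d"
    then have r: "d mod d0 > 0" "d mod d0 < d0" using d0 by (auto simp: dvd_eq_mod_eq_0 order.not_eq_order_implies_strict)
    have "d + (- (d div d0)) * d0 = d mod d0" by (simp add: minus_mult_div_eq_mod[symmetric] mult.commute)
    with deg_rel.mult[OF that deg_rel_int_pow[OF t, of "- (d div d0)"]]
    have "deg_rel G S X a (g \<otimes> t [^] (- (d div d0))) (d mod d0)" by simp
    then have "P (nat (d mod d0))" using r(1) by (auto simp: P_def)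
    from least[OF this] show False using r by (simp add: d0_def)
  qed
  define a' where "a' = (\<lambda>j. a j div d0)"
  have "deg_rel G S X a' g (d div d0)" if "deg_rel G S X a g d" for g d
    using that
  proof (induction rule: deg_rel.induct)
    case one
    show ?case using deg_rel.one[of G S X a'] by simp
  next
    case (coeff s)
    then show ?case using deg_rel.coeff[of s S G X a'] by simp
  next
    case (unknown j)
    show ?case using deg_rel.unknown[of G S X a' j] by (simp add: a'_def)
  next
    case (mult g d g' d')
    then show ?case using deg_rel.mult[OF mult.IH] dvd[OF mult.hyps(1)]
      by (simp add: div_plus_div_distrib_dvd_left)
  next
    case (inv g d)
    then show ?case using deg_rel.inv[OF inv.IH] dvd[OF inv.hyps(1)]
      by (simp add: dvd_neg_div)
  qed
  from this[OF t] have "deg_rel G S X a' t 1" using d0 by simp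
  moreover have "\<forall>j. a j = d0 * a' j"
    using dvd[OF deg_rel.unknown] by (simp add: a'_def)
  ultimately show ?thesis using d0 by (intro that[of d0 a' t]) auto
qed

text \<open>A graded homomorphism stands for a homomorphism from the group of words that fixes the
  coefficients and factors through the pairs of the value at \<open>X\<close> and the degree.\<close>

definition graded_hom :: "('m \<Rightarrow> int) \<Rightarrow> ('a \<Rightarrow> int \<Rightarrow> 'a) \<Rightarrow> bool" where
  "graded_hom a F \<longleftrightarrow> (\<forall>g d. deg_rel G S X a g d \<longrightarrow> F g d \<in> carrier G) \<and>
    (\<forall>g d g' d'. deg_rel G S X a g d \<longrightarrow> deg_rel G S X a g' d' \<longrightarrow>
      F (g \<otimes> g') (d + d') = F g d \<otimes> F g' d') \<and> (\<forall>s\<in>S. F s 0 = s)"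

context
  fixes a :: "'m \<Rightarrow> int" and F :: "'a \<Rightarrow> int \<Rightarrow> 'a"
  assumes F: "graded_hom a F"
begin

lemma graded_hom_carrier: "deg_rel G S X a g d \<Longrightarrow> F g d \<in> carrier G"
  using F by (auto simp: graded_hom_def)

lemma graded_hom_mult:
  "deg_rel G S X a g d \<Longrightarrow> deg_rel G S X a g' d' \<Longrightarrow> F (g \<otimes> g') (d + d') = F g d \<otimes> F g' d'"
  using F by (auto simp: graded_hom_def)

lemma graded_hom_one: "F \<one> 0 = \<one>"
proof -
  have c: "F \<one> 0 \<in> carrier G" by (rule graded_hom_carrier[OF deg_rel.one])
  have "F \<one> 0 \<otimes> F \<one> 0 = F \<one> 0" using graded_hom_mult[OF deg_rel.one deg_rel.one] by simp
  then show ?thesis using c by (simp add: r_cancel_one')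
qed

lemma graded_hom_inv: "deg_rel G S X a g d \<Longrightarrow> F (inv g) (- d) = inv (F g d)"
proof -
  assume g: "deg_rel G S X a g d"
  have "F (inv g) (- d) \<otimes> F g d = \<one>"
    using graded_hom_mult[OF deg_rel.inv[OF g] g] graded_hom_one deg_rel_carrier[OF g] by simp
  then show ?thesis
    using graded_hom_carrier[OF g] graded_hom_carrier[OF deg_rel.inv[OF g]]
    by (metis inv_equality)
qed

text \<open>This produces new solutions: for an equation of degree 0 solved by \<open>X\<close>, the
  images of the unknowns give the value \<open>F \<one> 0\<close>, which is \<one>.\<close>

lemma word_value_graded_hom:
  assumes "word_coeffs w \<subseteq> S"
  shows "deg_rel G S X a (word_value G X w) (word_degree a w) \<and>
    word_value G (\<lambda>j. F (X j) (a j)) w = F (word_value G X w) (word_degree a w)"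
  using assms
proof (induction w)
  case Nil
  show ?case using deg_rel.one[of G S X a] graded_hom_one
    by (simp add: word_value_def word_degree_simps)
next
  case (Cons l w)
  then have IH: "deg_rel G S X a (word_value G X w) (word_degree a w)"
    "word_value G (\<lambda>j. F (X j) (a j)) w = F (word_value G X w) (word_degree a w)"
    by (auto simp: word_coeffs_def)
  have wv: "word_value G Y (l # w) = letter_value G Y l \<otimes> word_value G Y w" for Y
    by (simp add: word_value_def)
  obtain e where e: "word_degree a (l # w) = e + word_degree a w"
    "deg_rel G S X a (letter_value G X l) e"
    "letter_value G (\<lambda>j. F (X j) (a j)) l = F (letter_value G X l) e"
  proof (cases l)
    case (Unknown j)
    then show ?thesis using that[of "a j"] deg_rel.unknown[of G S X a j] by (simp add: word_degree_simps)
  next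
    case (Inv_Unknown j)
    then show ?thesis using that[of "- a j"] deg_rel.inv[OF deg_rel.unknown[of G S X a j]]
      graded_hom_inv[OF deg_rel.unknown[of G S X a j]] by (simp add: word_degree_simps)
  next
    case (Coeff s)
    then have "s \<in> S" using Cons.prems by (auto simp: word_coeffs_def)
    then have "deg_rel G S X a s 0" "F s 0 = s" using F by (auto simp: graded_hom_def intro: deg_rel.coeff)
    then show ?thesis using that[of 0] Coeff by (simp add: word_degree_simps)
  qed
  show ?case unfolding wv e(1) e(3) IH(2)
    using deg_rel.mult[OF e(2) IH(1)] graded_hom_mult[OF e(2) IH(1)] by simp
qed

end

text \<open>Passes from the equality of two solutions to that of the homomorphisms behind them,
  whose values in degree 0 and at \<open>t\<close> determine the fibres.\<close>

lemma graded_hom_unique: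
  assumes "graded_hom a F" "graded_hom a F'" "\<And>j. F (X j) (a j) = F' (X j) (a j)"
    "deg_rel G S X a g d"
  shows "F g d = F' g d"
  using assms(4)
proof (induction rule: deg_rel.induct)
  case one
  show ?case using graded_hom_one[OF assms(1)] graded_hom_one[OF assms(2)] by simp
next
  case (coeff s)
  then show ?case using assms(1,2) by (simp add: graded_hom_def)
next
  case (unknown j)
  show ?case by (rule assms(3))
next
  case (mult g d g' d')
  then show ?case
    using graded_hom_mult[OF assms(1) mult.hyps] graded_hom_mult[OF assms(2) mult.hyps] by simp
next
  case (inv g d)
  then show ?case
    using graded_hom_inv[OF assms(1) inv.hyps] graded_hom_inv[OF assms(2) inv.hyps] by simp
qed

definition degree_kernel :: "('m \<Rightarrow> int) \<Rightarrow> 'a set" where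
  "degree_kernel a = {g. deg_rel G S X a g 0}"

lemma degree_kernel_carrier: "degree_kernel a \<subseteq> carrier G"
  using deg_rel_carrier by (auto simp: degree_kernel_def)

lemma centraliser_kernel_subset: "centraliser G (degree_kernel a) \<subseteq> centraliser G S"
  using deg_rel.coeff[of _ S G X a] by (auto simp: centraliser_def degree_kernel_def)

context
  fixes a :: "'m \<Rightarrow> int" and t :: 'a
  assumes t: "deg_rel G S X a t 1"
begin

abbreviation (input) "kernel_centraliser \<equiv> centraliser G (degree_kernel a)"

lemma t_carrier: "t \<in> carrier G" by (rule deg_rel_carrier[OF t])

lemma kernel_centraliser_carrier: "b \<in> kernel_centraliser \<Longrightarrow> b \<in> carrier G" by (auto simp: centraliser_def)

lemma kernel_centraliser_commute: "b \<in> kernel_centraliser \<Longrightarrow> k \<in> degree_kernel a \<Longrightarrow> b \<otimes> k = k \<otimes> b" by (auto simp: centraliser_def)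

text \<open>Conjugation by \<open>t\<close> preserves the values of degree 0, because the degrees
  add up to \<open>1 + 0 - 1\<close>, and hence preserves their centraliser.\<close>

lemma kernel_centraliser_conj:
  assumes b: "b \<in> kernel_centraliser"
  shows "inv t \<otimes> b \<otimes> t \<in> kernel_centraliser" "t \<otimes> b \<otimes> inv t \<in> kernel_centraliser"
proof -
  note c = t_carrier kernel_centraliser_carrier[OF b]
  have "inv t \<otimes> b \<otimes> t \<otimes> k = k \<otimes> (inv t \<otimes> b \<otimes> t)" if k: "k \<in> degree_kernel a" for k
  proof -
    have kc: "k \<in> carrier G" using degree_kernel_carrier k by blast
    have "deg_rel G S X a (t \<otimes> k \<otimes> inv t) (1 + 0 + - 1)"
      using k t by (intro deg_rel.mult deg_rel.inv) (auto simp: degree_kernel_def)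
    then have "t \<otimes> k \<otimes> inv t \<in> degree_kernel a" by (simp add: degree_kernel_def)
    from kernel_centraliser_commute[OF b this] have *: "b \<otimes> (t \<otimes> k \<otimes> inv t) = (t \<otimes> k \<otimes> inv t) \<otimes> b" .
    have "inv t \<otimes> b \<otimes> t \<otimes> k = inv t \<otimes> (b \<otimes> (t \<otimes> k \<otimes> inv t)) \<otimes> t"
      using c kc by (simp add: m_assoc)
    also have "\<dots> = k \<otimes> (inv t \<otimes> b \<otimes> t)"
      unfolding * using c kc by (simp add: m_assoc inv_cancel_left)
    finally show ?thesis .
  qed
  then show "inv t \<otimes> b \<otimes> t \<in> kernel_centraliser" using c by (simp add: centraliser_def)
  have "t \<otimes> b \<otimes> inv t \<otimes> k = k \<otimes> (t \<otimes> b \<otimes> inv t)" if k: "k \<in> degree_kernel a" for k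
  proof -
    have kc: "k \<in> carrier G" using degree_kernel_carrier k by blast
    have "deg_rel G S X a (inv t \<otimes> k \<otimes> t) (- 1 + 0 + 1)"
      using k t by (intro deg_rel.mult deg_rel.inv) (auto simp: degree_kernel_def)
    then have "inv t \<otimes> k \<otimes> t \<in> degree_kernel a" by (simp add: degree_kernel_def)
    from kernel_centraliser_commute[OF b this] have *: "b \<otimes> (inv t \<otimes> k \<otimes> t) = (inv t \<otimes> k \<otimes> t) \<otimes> b" .
    have "t \<otimes> b \<otimes> inv t \<otimes> k = t \<otimes> (b \<otimes> (inv t \<otimes> k \<otimes> t)) \<otimes> inv t"
      using c kc by (simp add: m_assoc)
    also have "\<dots> = k \<otimes> (t \<otimes> b \<otimes> inv t)"
      unfolding * using c kc by (simp add: m_assoc inv_cancel_left)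
    finally show ?thesis .
  qed
  then show "t \<otimes> b \<otimes> inv t \<in> kernel_centraliser" using c by (simp add: centraliser_def)
qed

text \<open>\<open>g \<mapsto> g \<otimes> twist b d\<close>, for \<open>g\<close> of degree \<open>d\<close>, is the homomorphism that replaces \<open>t\<close> by
  \<open>t \<otimes> b\<close> and does not change the elements of degree 0.\<close>

definition twist :: "'a \<Rightarrow> int \<Rightarrow> 'a" where
  "twist b d = t [^] (- d) \<otimes> (t \<otimes> b) [^] d"

lemma twist_0: "twist b 0 = \<one>"
  by (simp add: twist_def)

lemma twist_1: "b \<in> carrier G \<Longrightarrow> t \<otimes> twist b 1 = t \<otimes> b"
  using t_carrier by (simp add: twist_def int_pow_neg inv_cancel_left)

lemma twist_one: "twist \<one> d = \<one>"
  using t_carrier by (simp add: twist_def int_pow_neg)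

text \<open>\<open>twist b (d + 1)\<close> is \<open>twist b d\<close> conjugated by
  \<open>t\<close> and multiplied by \<open>b\<close>; a similar step leads downwards. So every
  twist is a product of conjugates of \<open>b\<close> or of its inverse by powers of
  \<open>t\<close>.\<close>

lemma twist_in_kernel_centraliser:
  assumes b: "b \<in> kernel_centraliser"
  shows "twist b d \<in> kernel_centraliser"
proof -
  note c = t_carrier kernel_centraliser_carrier[OF b]
  have K: "degree_kernel a \<subseteq> carrier G" by (rule degree_kernel_carrier)
  have pc: "t [^] e \<in> carrier G" "(t \<otimes> b) [^] e \<in> carrier G" for e :: int using c by simp_all
  show ?thesis
  proof (induction d rule: int_induct[where k = 0])
    case base
    show ?case unfolding twist_0 by (rule centraliser_one[OF K])
  next
    case (step1 d)
    have "twist b (d + 1) = (inv t \<otimes> twist b d \<otimes> t) \<otimes> b"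
    proof -
      have "- (d + 1) = - 1 + - d" by simp
      then have "t [^] (- (d + 1)) = inv t \<otimes> t [^] (- d)"
        using int_pow_mult[OF c(1), of "- 1" "- d"] c by (simp only:) (simp add: int_pow_neg)
      moreover have "(t \<otimes> b) [^] (d + 1) = (t \<otimes> b) [^] d \<otimes> (t \<otimes> b)"
        using int_pow_mult[of "t \<otimes> b" d 1] c by simp
      ultimately show ?thesis unfolding twist_def using c pc by (simp add: m_assoc)
    qed
    then show ?case using centraliser_mult[OF K kernel_centraliser_conj(1)[OF step1(2)] b] by simp
  next
    case (step2 d)
    have "twist b (d - 1) = t \<otimes> (twist b d \<otimes> inv b) \<otimes> inv t"
    proof -
      have "t [^] (- (d - 1)) = t \<otimes> t [^] (- d)"
        using int_pow_mult[OF c(1), of 1 "- d"] c by simp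
      moreover have "(t \<otimes> b) [^] (d - 1) = (t \<otimes> b) [^] d \<otimes> (inv b \<otimes> inv t)"
        using int_pow_mult[of "t \<otimes> b" d "- 1"] c by (simp add: int_pow_neg inv_mult_group)
      ultimately show ?thesis unfolding twist_def using c pc by (simp add: m_assoc)
    qed
    then show ?case
      using kernel_centraliser_conj(2)[OF centraliser_mult[OF K step2(2) centraliser_inv[OF K b]]] by simp
  qed
qed

text \<open>Conjugation by \<open>h\<close> fixes the coefficients. For multiplicativity
  \<open>twist b d\<close> has to pass \<open>g'\<close>: write \<open>g'\<close> as a value of
  degree 0 times \<open>t [^] d'\<close>. The first part commutes with \<open>twist b d\<close>, and
  the second is absorbed in the expansion of \<open>twist b (d + d')\<close>.\<close>

lemma graded_hom_twist:
  assumes h: "h \<in> centraliser G S" and b: "b \<in> kernel_centraliser"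
  shows "graded_hom a (\<lambda>g d. h \<otimes> (g \<otimes> twist b d) \<otimes> inv h)"
  unfolding graded_hom_def
proof (intro conjI allI impI ballI)
  have hc: "h \<in> carrier G" using h by (auto simp: centraliser_def)
  note c = t_carrier kernel_centraliser_carrier[OF b]
  have zc: "twist b d \<in> carrier G" for d by (rule kernel_centraliser_carrier[OF twist_in_kernel_centraliser[OF b]])
  have pc: "t [^] e \<in> carrier G" "(t \<otimes> b) [^] e \<in> carrier G" for e :: int using c by simp_all
  show "h \<otimes> (g \<otimes> twist b d) \<otimes> inv h \<in> carrier G" if "deg_rel G S X a g d" for g d
    using deg_rel_carrier[OF that] hc zc by simp
  show "h \<otimes> (s \<otimes> twist b 0) \<otimes> inv h = s" if "s \<in> S" for s
  proof -
    have "s \<in> carrier G" "h \<otimes> s = s \<otimes> h" using S h that by (auto simp: centraliser_def)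
    then show ?thesis using hc by (simp add: twist_0 m_assoc)
  qed
  fix g d g' d' assume g: "deg_rel G S X a g d" and g': "deg_rel G S X a g' d'"
  have gc: "g \<in> carrier G" "g' \<in> carrier G" using deg_rel_carrier g g' by blast+
  have "deg_rel G S X a (g' \<otimes> t [^] (- d')) (d' + (- d') * 1)"
    by (rule deg_rel.mult[OF g' deg_rel_int_pow[OF t]])
  then have k: "g' \<otimes> t [^] (- d') \<in> degree_kernel a" by (simp add: degree_kernel_def)
  have tt: "t [^] (- d') \<otimes> (t [^] d' \<otimes> y) = y" if "y \<in> carrier G" for y
    using c pc that by (simp add: int_pow_neg inv_cancel_left)
  have tt': "t [^] d' \<otimes> (t [^] (- d') \<otimes> y) = y" if "y \<in> carrier G" for y
    using c pc that by (simp add: int_pow_neg inv_cancel_left)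
  have "g' \<otimes> twist b (d + d') = (g' \<otimes> t [^] (- d')) \<otimes> twist b d \<otimes> (t [^] d' \<otimes> twist b d')"
  proof -
    have "- (d + d') = - d' + - d" by simp
    then have "t [^] (- (d + d')) = t [^] (- d') \<otimes> t [^] (- d)"
      using int_pow_mult[OF c(1), of "- d'" "- d"] by (simp only:)
    moreover have "(t \<otimes> b) [^] (d + d') = (t \<otimes> b) [^] d \<otimes> (t \<otimes> b) [^] d'"
      using int_pow_mult[of "t \<otimes> b" d d'] c by simp
    ultimately show ?thesis unfolding twist_def using c pc gc by (simp add: m_assoc tt')
  qed
  also have "(g' \<otimes> t [^] (- d')) \<otimes> twist b d = twist b d \<otimes> (g' \<otimes> t [^] (- d'))"
    by (rule kernel_centraliser_commute[OF twist_in_kernel_centraliser[OF b] k, symmetric])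
  also have "twist b d \<otimes> (g' \<otimes> t [^] (- d')) \<otimes> (t [^] d' \<otimes> twist b d') = twist b d \<otimes> (g' \<otimes> twist b d')"
    using c pc gc zc by (simp add: m_assoc tt)
  finally have *: "g' \<otimes> twist b (d + d') = twist b d \<otimes> (g' \<otimes> twist b d')" .
  have "h \<otimes> (g \<otimes> g' \<otimes> twist b (d + d')) \<otimes> inv h = h \<otimes> (g \<otimes> (g' \<otimes> twist b (d + d'))) \<otimes> inv h"
    using gc zc by (simp add: m_assoc)
  also have "\<dots> = h \<otimes> (g \<otimes> twist b d) \<otimes> inv h \<otimes> (h \<otimes> (g' \<otimes> twist b d') \<otimes> inv h)"
    unfolding * using gc zc hc by (simp add: m_assoc inv_cancel_left)
  finally show "h \<otimes> (g \<otimes> g' \<otimes> twist b (d + d')) \<otimes> inv h =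
    h \<otimes> (g \<otimes> twist b d) \<otimes> inv h \<otimes> (h \<otimes> (g' \<otimes> twist b d') \<otimes> inv h)" .
qed

text \<open>Put \<open>e = inv h \<otimes> h'\<close>. Equality at the unknowns extends to all
  values. In degree 0, where twists are trivial, it says that \<open>e\<close> commutes with the
  degree kernel; at \<open>t\<close>, which is sent to a conjugate of \<open>t \<otimes> b\<close>,
  it determines \<open>b'\<close> from \<open>e\<close>.\<close>

lemma twist_fibre:
  assumes h: "h \<in> centraliser G S" "h' \<in> centraliser G S" and b: "b \<in> kernel_centraliser" "b' \<in> kernel_centraliser"
    and eq: "\<And>j. h \<otimes> (X j \<otimes> twist b (a j)) \<otimes> inv h = h' \<otimes> (X j \<otimes> twist b' (a j)) \<otimes> inv h'"
  shows "\<exists>e\<in>kernel_centraliser. h' = h \<otimes> e \<and> b' = inv t \<otimes> (inv e \<otimes> (t \<otimes> (b \<otimes> e)))"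
proof (intro bexI conjI)
  have hc: "h \<in> carrier G" "h' \<in> carrier G" using h by (auto simp: centraliser_def)
  note c = t_carrier kernel_centraliser_carrier[OF b(1)] kernel_centraliser_carrier[OF b(2)]
  define e where "e = inv h \<otimes> h'"
  have ec: "e \<in> carrier G" using hc by (simp add: e_def)
  show h': "h' = h \<otimes> (inv h \<otimes> h')" using hc by (simp add: inv_cancel_left)
  have conj: "x = e \<otimes> y \<otimes> inv e"
    if "h \<otimes> x \<otimes> inv h = h' \<otimes> y \<otimes> inv h'" "x \<in> carrier G" "y \<in> carrier G" for x y
  proof -
    have "x = inv h \<otimes> (h \<otimes> x \<otimes> inv h) \<otimes> h" using hc that(2) by (simp add: m_assoc inv_cancel_left)
    also have "\<dots> = e \<otimes> y \<otimes> inv e"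
      unfolding that(1) using hc that(3) by (simp add: e_def m_assoc inv_mult_group)
    finally show ?thesis .
  qed
  have F: "h \<otimes> (g \<otimes> twist b d) \<otimes> inv h = h' \<otimes> (g \<otimes> twist b' d) \<otimes> inv h'"
    if "deg_rel G S X a g d" for g d
    using graded_hom_unique[OF graded_hom_twist[OF h(1) b(1)] graded_hom_twist[OF h(2) b(2)] eq that] .
  have "e \<otimes> k = k \<otimes> e" if "k \<in> degree_kernel a" for k
  proof -
    have kc: "k \<in> carrier G" using degree_kernel_carrier that by blast
    have "deg_rel G S X a k 0" using that by (simp add: degree_kernel_def)
    from F[OF this] have "h \<otimes> k \<otimes> inv h = h' \<otimes> k \<otimes> inv h'" using kc by (simp add: twist_0)
    from conj[OF this kc kc] have "k \<otimes> e = e \<otimes> k \<otimes> inv e \<otimes> e" by simp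
    then show ?thesis using kc ec by (simp add: m_assoc)
  qed
  then show eA: "inv h \<otimes> h' \<in> kernel_centraliser" using ec unfolding e_def[symmetric] by (simp add: centraliser_def)
  have "h \<otimes> (t \<otimes> b) \<otimes> inv h = h' \<otimes> (t \<otimes> b') \<otimes> inv h'"
    using F[OF t] c by (simp add: twist_1)
  from conj[OF this] have "t \<otimes> b = e \<otimes> (t \<otimes> b') \<otimes> inv e" using c by simp
  then have "inv t \<otimes> (inv e \<otimes> ((t \<otimes> b) \<otimes> e)) = b'"
    using c ec by (simp add: m_assoc inv_cancel_left)
  then show "b' = inv t \<otimes> (inv (inv h \<otimes> h') \<otimes> (t \<otimes> (b \<otimes> (inv h \<otimes> h'))))"
    using c ec unfolding e_def[symmetric] by (simp add: m_assoc)
qed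

end

end

end



section \<open>Regular maps of algebraic groups\<close>

context affine_algebraic_group
begin

lemma regular_map_on_mult:
  assumes f: "regular_map_on S f" "\<And>x. x \<in> S \<Longrightarrow> f x \<in> carrier G"
    and g: "regular_map_on S g" "\<And>x. x \<in> S \<Longrightarrow> g x \<in> carrier G"
  shows "regular_map_on S (\<lambda>x. f x \<otimes> g x)"
  unfolding regular_map_on_def
proof
  fix j
  from mult_regular[unfolded regular_map_on_def, rule_format, of j]
  obtain p where p: "p \<in> poly_fun" "\<forall>z\<in>{z. z \<circ> Inl \<in> carrier G \<and> z \<circ> Inr \<in> carrier G}.
    ((z \<circ> Inl) \<otimes> (z \<circ> Inr)) j = p z" by (elim bexE)
  obtain s where s: "\<forall>i. s i \<in> poly_fun \<and> (\<forall>x\<in>S. f x i = s i x)"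
    by (rule regular_map_onE[OF f(1)])
  obtain r where r: "\<forall>i. r i \<in> poly_fun \<and> (\<forall>x\<in>S. g x i = r i x)"
    by (rule regular_map_onE[OF g(1)])
  define z where "z = (\<lambda>x. case_sum (\<lambda>i. s i x) (\<lambda>i. r i x))"
  have "(\<lambda>x. p (z x)) \<in> poly_fun"
  proof (rule poly_fun_subst[OF p(1)])
    show "(\<lambda>x. z x i) \<in> poly_fun" for i using s r by (cases i) (simp_all add: z_def)
  qed
  moreover have "(f x \<otimes> g x) j = p (z x)" if x: "x \<in> S" for x
  proof -
    have "z x \<circ> Inl = f x" "z x \<circ> Inr = g x" using s r x by (auto simp: z_def)
    then show ?thesis using p(2) f(2)[OF x] g(2)[OF x] by (metis (mono_tags, lifting) mem_Collect_eq)
  qed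
  ultimately show "\<exists>p\<in>poly_fun. \<forall>x\<in>S. (f x \<otimes> g x) j = p x" by (intro bexI[of _ "\<lambda>x. p (z x)"]) blast
qed

lemma regular_map_on_inv:
  assumes f: "regular_map_on S f" "\<And>x. x \<in> S \<Longrightarrow> f x \<in> carrier G"
  shows "regular_map_on S (\<lambda>x. inv (f x))"
  unfolding regular_map_on_def
proof
  fix j
  from inv_regular[unfolded regular_map_on_def, rule_format, of j]
  obtain p where p: "p \<in> poly_fun" "\<forall>z\<in>carrier G. (inv z) j = p z" by (elim bexE)
  obtain s where s: "\<forall>i. s i \<in> poly_fun \<and> (\<forall>x\<in>S. f x i = s i x)"
    by (rule regular_map_onE[OF f(1)])
  have "(\<lambda>x. p (\<lambda>i. s i x)) \<in> poly_fun"
    by (rule poly_fun_subst[OF p(1)]) (use s in simp)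
  moreover have "(inv (f x)) j = p (\<lambda>i. s i x)" if x: "x \<in> S" for x
  proof -
    have "(\<lambda>i. s i x) = f x" using s x by auto
    then show ?thesis using p(2) f(2)[OF x] by simp
  qed
  ultimately show "\<exists>p\<in>poly_fun. \<forall>x\<in>S. (inv (f x)) j = p x" by (intro bexI[of _ "\<lambda>x. p (\<lambda>i. s i x)"]) blast
qed

lemma regular_map_on_const: "regular_map_on S (\<lambda>_. c)"
  unfolding regular_map_on_def by (auto intro: poly_fun.const)

lemma regular_map_on_int_pow:
  assumes f: "regular_map_on S f" "\<And>x. x \<in> S \<Longrightarrow> f x \<in> carrier G"
  shows "regular_map_on S (\<lambda>x. f x [^] (n :: int))"
proof -
  have nat: "regular_map_on S (\<lambda>x. f x [^] (k :: nat))" for k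
  proof (induction k)
    case 0
    show ?case by (simp add: regular_map_on_const)
  next
    case (Suc k)
    have "regular_map_on S (\<lambda>x. f x [^] k \<otimes> f x)"
      using f by (intro regular_map_on_mult Suc.IH) auto
    then show ?case by simp
  qed
  show ?thesis
  proof (cases n)
    case (nonneg k)
    then show ?thesis using nat[of k] by (simp only: int_pow_int)
  next
    case (neg k)
    have "regular_map_on S (\<lambda>x. inv (f x [^] Suc k))"
      by (rule regular_map_on_inv[OF nat]) (simp add: f(2))
    moreover have "inv (f x [^] Suc k) = f x [^] n" if "x \<in> S" for x
      unfolding neg using f(2)[OF that] by (rule int_pow_neg_int[symmetric])
    ultimately show ?thesis unfolding regular_map_on_def by simp
  qed
qed

end

lemma closedin_equaliser:
  fixes f g :: "('i \<Rightarrow> 'k::field) \<Rightarrow> ('j \<Rightarrow> 'k)"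
  assumes "closedin zariski S" "regular_map_on S f" "regular_map_on S g"
  shows "closedin zariski {x\<in>S. f x = g x}"
proof -
  obtain s where s: "\<forall>i. s i \<in> poly_fun \<and> (\<forall>x\<in>S. f x i = s i x)"
    by (rule regular_map_onE[OF assms(2)])
  obtain r where r: "\<forall>i. r i \<in> poly_fun \<and> (\<forall>x\<in>S. g x i = r i x)"
    by (rule regular_map_onE[OF assms(3)])
  have "closedin zariski (\<Inter>i. {x. (s i - r i) x = 0})"
    using s r by (intro closedin_INT closedin_zariski_vanishing poly_fun_closed) auto
  then have "closedin zariski (S \<inter> (\<Inter>i. {x. (s i - r i) x = 0}))"
    using assms(1) by (rule closedin_Int[rotated])
  also have "S \<inter> (\<Inter>i. {x. (s i - r i) x = 0}) = {x\<in>S. f x = g x}"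
    using s r by (auto simp: fun_eq_iff)
  finally show ?thesis .
qed

lemma closedin_Collect_ball:
  assumes "closedin X S" "\<And>i. i \<in> I \<Longrightarrow> closedin X {x\<in>S. P i x}"
  shows "closedin X {x\<in>S. \<forall>i\<in>I. P i x}"
proof (cases "I = {}")
  case True
  then show ?thesis using assms(1) by simp
next
  case False
  then have "closedin X (\<Inter>i\<in>I. {x\<in>S. P i x})" using assms(2) by (intro closedin_INT) auto
  also have "(\<Inter>i\<in>I. {x\<in>S. P i x}) = {x\<in>S. \<forall>i\<in>I. P i x}" using False by auto
  finally show ?thesis .
qed

context affine_algebraic_group
begin

lemma regular_map_on_id: "regular_map_on S (\<lambda>x. x)"
  unfolding regular_map_on_def by (auto intro: poly_fun.coord)

lemma closedin_centraliser:
  assumes "S \<subseteq> carrier G"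
  shows "closedin zariski (centraliser G S)"
  unfolding centraliser_def
proof (rule closedin_Collect_ball[OF closed])
  fix s assume "s \<in> S"
  then have "s \<in> carrier G" using assms by blast
  then show "closedin zariski {g\<in>carrier G. g \<otimes> s = s \<otimes> g}"
    by (intro closedin_equaliser closed regular_map_on_mult regular_map_on_id regular_map_on_const)
qed

lemma regular_map_on_word_value:
  fixes X :: "('i \<Rightarrow> 'k) \<Rightarrow> 'm \<Rightarrow> ('n \<Rightarrow> 'k)"
  assumes X: "\<And>j. regular_map_on S (\<lambda>x. X x j)" "\<And>x j. x \<in> S \<Longrightarrow> X x j \<in> carrier G"
    and "word_coeffs w \<subseteq> carrier G"
  shows "regular_map_on S (\<lambda>x. word_value G (X x) w) \<and> (\<forall>x\<in>S. word_value G (X x) w \<in> carrier G)"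
  using assms(3)
proof (induction w)
  case Nil
  show ?case by (simp add: word_value_def regular_map_on_const)
next
  case (Cons l w)
  then have IH: "regular_map_on S (\<lambda>x. word_value G (X x) w)" "\<And>x. x \<in> S \<Longrightarrow> word_value G (X x) w \<in> carrier G"
    by (auto simp: word_coeffs_def)
  have wv: "word_value G Y (l # w) = letter_value G Y l \<otimes> word_value G Y w" for Y
    by (simp add: word_value_def)
  have l: "regular_map_on S (\<lambda>x. letter_value G (X x) l) \<and> (\<forall>x\<in>S. letter_value G (X x) l \<in> carrier G)"
  proof (cases l)
    case (Unknown j)
    then show ?thesis using X by simp
  next
    case (Inv_Unknown j)
    then show ?thesis using X by (auto intro: regular_map_on_inv)
  next
    case (Coeff s)
    then show ?thesis using Cons.prems by (auto simp: word_coeffs_def regular_map_on_const)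
  qed
  show ?case unfolding wv using l IH by (auto intro!: regular_map_on_mult)
qed

lemma closedin_solution_variety:
  fixes v :: "'s \<Rightarrow> ('n \<Rightarrow> 'k, 'm) letter list"
  assumes "system_coeffs I v \<subseteq> carrier G"
  shows "closedin zariski (solution_variety G I v)"
proof -
  define W where "W = {x :: 'm \<times> 'n \<Rightarrow> 'k. \<forall>j. curry x j \<in> carrier G}"
  have reg: "regular_map_on T (\<lambda>x :: 'm \<times> 'n \<Rightarrow> 'k. curry x j)" for T j
    unfolding regular_map_on_def curry_def by (auto intro: poly_fun.coord)
  have "closedin zariski (\<Inter>j. {x :: 'm \<times> 'n \<Rightarrow> 'k. curry x j \<in> carrier G})"
    by (intro closedin_INT closedin_preimage[OF closed]) (auto simp: curry_def intro: poly_fun.coord)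
  also have "(\<Inter>j. {x :: 'm \<times> 'n \<Rightarrow> 'k. curry x j \<in> carrier G}) = W" by (auto simp: W_def)
  finally have W: "closedin zariski W" .
  have "closedin zariski {x\<in>W. \<forall>i\<in>I. word_value G (curry x) (v i) = \<one>}"
  proof (rule closedin_Collect_ball[OF W])
    fix i assume "i \<in> I"
    then have "word_coeffs (v i) \<subseteq> carrier G" using assms by (auto simp: system_coeffs_def)
    then have "regular_map_on W (\<lambda>x. word_value G (curry x) (v i)) \<and>
        (\<forall>x\<in>W. word_value G (curry x) (v i) \<in> carrier G)"
      by (intro regular_map_on_word_value reg) (simp_all add: W_def)
    then have "regular_map_on W (\<lambda>x. word_value G (curry x) (v i))" by (rule conjunct1)
    then show "closedin zariski {x\<in>W. word_value G (curry x) (v i) = \<one>}"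
      by (rule closedin_equaliser[OF W _ regular_map_on_const])
  qed
  then show ?thesis by (simp add: W_def solution_variety_def Collect_conj_eq)
qed

end


section \<open>The dimension of the components\<close>

text \<open>By maximality \<open>C\<close> is a piece of an irreducible decomposition and is not
  covered by the other pieces. An irreducible set through a point outside those lies in some piece,
  which can only be \<open>C\<close>.\<close>

lemma component_point:
  fixes V :: "('i::finite \<Rightarrow> 'k::field) set"
  assumes V: "closedin zariski V" and C: "irreducible_component_of (subtopology zariski V) C"
  obtains x where "closedin zariski C" "irr C" "C \<subseteq> V" "x \<in> C"
    "\<forall>T. irr T \<longrightarrow> x \<in> T \<longrightarrow> T \<subseteq> V \<longrightarrow> T \<subseteq> C"
proof -
  have C1: "irr C" "C \<subseteq> V" and C2: "\<And>D. irr D \<Longrightarrow> D \<subseteq> V \<Longrightarrow> C \<subseteq> D \<Longrightarrow> D = C"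
    using C by (auto simp: irreducible_component_of_def irreducible_in_subtopology_zariski)
  obtain \<V> where \<V>: "finite \<V>" "\<forall>W\<in>\<V>. closedin zariski W \<and> irr W" "V = \<Union>\<V>"
    using irreducible_decomposition[OF V] by blast
  have eq: "W = C" if "W \<in> \<V>" "C \<subseteq> W" for W
    using C2[of W] \<V> that by blast
  have "\<exists>W\<in>\<V>. C \<subseteq> W" by (rule irr_subset_Union[OF C1(1) \<V>(1)]) (use \<V> C1 in blast)+
  then have CV: "C \<in> \<V>" using eq by blast
  have "\<not> C \<subseteq> \<Union>(\<V> - {C})"
  proof
    assume "C \<subseteq> \<Union>(\<V> - {C})"
    then have "\<exists>W\<in>\<V> - {C}. C \<subseteq> W"
      by (intro irr_subset_Union[OF C1(1)]) (use \<V> in auto)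
    then show False using eq by blast
  qed
  then obtain x where x: "x \<in> C" "x \<notin> \<Union>(\<V> - {C})" by blast
  have "T \<subseteq> C" if T: "irr T" "x \<in> T" "T \<subseteq> V" for T
  proof -
    have "\<exists>W\<in>\<V>. T \<subseteq> W" by (rule irr_subset_Union[OF T(1) \<V>(1)]) (use \<V> T in blast)+
    then show ?thesis using T(2) x(2) by blast
  qed
  then show ?thesis using that \<V>(2) CV C1 x(1) by blast
qed

lemma independent_coords_zero:
  "independent_coords F X \<Longrightarrow> q \<in> poly_fun_in F \<Longrightarrow> vanishes_on X q \<Longrightarrow> q = 0"
  using independent_coordsD by blast

text \<open>With \<open>b\<close> in \<open>B\<close> fixed, independence on \<open>Z\<close> frees
  the first half of the coordinates; independence on \<open>B\<close> then frees the second.\<close>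

lemma independent_coords_Times:
  fixes Z :: "('i \<Rightarrow> 'k::comm_ring_1) set" and B :: "('j \<Rightarrow> 'k) set"
  assumes Z: "independent_coords E Z" and B: "independent_coords F B"
  shows "independent_coords (Inl ` E \<union> Inr ` F) {z. z \<circ> Inl \<in> Z \<and> z \<circ> Inr \<in> B}"
  unfolding independent_coords_def
proof (intro ballI impI ext)
  fix q and u :: "'i + 'j \<Rightarrow> 'k"
  assume q: "q \<in> poly_fun_in (Inl ` E \<union> Inr ` F)"
    and van: "vanishes_on {z. z \<circ> Inl \<in> Z \<and> z \<circ> Inr \<in> B} q"
  have van': "q (case_sum a b) = 0" if "a \<in> Z" "b \<in> B" for a b
    using van that by (auto simp: comp_def)
  have 1: "q (case_sum a b) = 0" if "b \<in> B" for a b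
  proof -
    have "(\<lambda>a. q (case_sum a b)) \<in> poly_fun_in E"
    proof (rule poly_fun_in_subst[OF q])
      show "(\<lambda>a. case_sum a b i) \<in> poly_fun_in E" if "i \<in> Inl ` E \<union> Inr ` F" for i
        using that by (auto intro: poly_fun_in.intros)
    qed
    then have "(\<lambda>a. q (case_sum a b)) = 0"
      by (rule independent_coords_zero[OF Z]) (simp add: van' that)
    from fun_cong[OF this, of a] show ?thesis by simp
  qed
  have "q (case_sum a b) = 0" for a b
  proof -
    have "(\<lambda>b. q (case_sum a b)) \<in> poly_fun_in F"
    proof (rule poly_fun_in_subst[OF q])
      show "(\<lambda>b. case_sum a b i) \<in> poly_fun_in F" if "i \<in> Inl ` E \<union> Inr ` F" for i
        using that by (auto intro: poly_fun_in.intros)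
    qed
    then have "(\<lambda>b. q (case_sum a b)) = 0"
      by (rule independent_coords_zero[OF B]) (simp add: 1)
    from fun_cong[OF this, of b] show ?thesis by simp
  qed
  from this[of "u \<circ> Inl" "u \<circ> Inr"] show "q u = 0 u"
    by (simp add: case_sum_o_inj sum.case_eq_if comp_def) (metis surjective_sum)
qed

lemma krull_dim_zariski_le:
  fixes C :: "('i::finite \<Rightarrow> 'k::alg_closed_field) set"
  assumes "closedin zariski C" "irr C" "independent_coords F C"
  shows "enat (card F) \<le> zariski_dim C"
proof -
  obtain Z where Z: "\<forall>j\<le>card F. closedin zariski (Z j) \<and> irr (Z j)"
    "\<forall>j<card F. Z j \<subset> Z (Suc j)" "Z (card F) = C"
    using chain_of_independent_coords[OF assms] by blast
  have sub: "Z j \<subseteq> C" if "j \<le> card F" for j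
    using that
  proof (induction rule: inc_induct)
    case base
    show ?case using Z(3) by simp
  next
    case (step k)
    then show ?case using Z(2) by blast
  qed
  have "closedin (subtopology zariski C) (Z j)" if "j \<le> card F" for j
    unfolding closedin_subtopology using Z(1) sub that by blast
  then have "\<exists>Z :: nat \<Rightarrow> ('i \<Rightarrow> 'k) set. (\<forall>i\<le>card F. closedin (subtopology zariski C) (Z i) \<and>
      irreducible_in (subtopology zariski C) (Z i)) \<and> (\<forall>i<card F. Z i \<subset> Z (Suc i))"
    using Z sub by (intro exI[of _ Z]) (auto simp: irreducible_in_subtopology_zariski)
  then show ?thesis unfolding krull_dim_def by (intro Sup_upper) blast
qed

lemma (in affine_algebraic_group) dim_component_ge:
  fixes I :: "'s set"
    and v :: "'s \<Rightarrow> ('n \<Rightarrow> 'k, 'm::finite) letter list"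
    and C :: "('m \<times> 'n \<Rightarrow> 'k) set"
  assumes "system_coeffs I v \<subseteq> carrier G"
    and "matrix_rank I (system_matrix v) < CARD('m)"
    and "irreducible_component_of (subtopology zariski (solution_variety G I v)) C"
  shows "zariski_dim C \<ge> zariski_dim (centraliser G (system_coeffs I v))"
proof -
  define S where "S = system_coeffs I v"
  have S: "S \<subseteq> carrier G" using assms(1) by (simp add: S_def)
  define H where "H = centraliser G S"
  define V where "V = solution_variety G I v"
  have V: "closedin zariski V" unfolding V_def by (rule closedin_solution_variety[OF assms(1)])
  from component_point[OF V assms(3)[folded V_def]]
  obtain x where C: "closedin zariski C" "irr C" "C \<subseteq> V" and x: "x \<in> C"
    "\<forall>T. irr T \<longrightarrow> x \<in> T \<longrightarrow> T \<subseteq> V \<longrightarrow> T \<subseteq> C" .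
  define X where "X = curry x"
  have xV: "x \<in> V" using x(1) C(3) by blast
  have X: "\<forall>j. X j \<in> carrier G" using xV by (simp add: V_def solution_variety_def X_def)
  have X_sol: "word_value G X (v i) = \<one>" if "i \<in> I" for i
    using xV that by (simp add: V_def solution_variety_def X_def)

  from rank_deficient_kernel[OF assms(2)] obtain a0 :: "'m \<Rightarrow> int" where a0: "\<exists>j. a0 j \<noteq> 0"
    "\<forall>i\<in>I. (\<Sum>j\<in>UNIV. system_matrix v i j * a0 j) = 0" .
  obtain j0 where "a0 j0 \<noteq> 0" using a0(1) by blast
  from normalise_degrees[OF S X, of a0 j0, OF this] obtain d0 a t where a: "d0 \<noteq> 0" "\<forall>j. a0 j = d0 * a j"
    and t: "deg_rel G S X a t 1" .
  have deg0: "word_degree a (v i) = 0" if "i \<in> I" for i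
  proof -
    have "d0 * word_degree a (v i) = (\<Sum>j\<in>UNIV. system_matrix v i j * a0 j)"
      using a(2) by (simp add: word_degree_def system_matrix_def sum_distrib_left mult_ac)
    also have "\<dots> = 0" using a0(2) that by blast
    finally show ?thesis using a(1) by simp
  qed
  have coeffs: "word_coeffs (v i) \<subseteq> S" if "i \<in> I" for i
    using that by (auto simp: S_def system_coeffs_def)

  define A where "A = centraliser G (degree_kernel S X a)"
  have AH: "A \<subseteq> H" unfolding A_def H_def by (rule centraliser_kernel_subset[OF S X])
  have Kc: "degree_kernel S X a \<subseteq> carrier G" by (rule degree_kernel_carrier[OF S X])
  have A_closed: "closedin zariski A" and H_closed: "closedin zariski H"
    unfolding A_def H_def using Kc S by (auto intro: closedin_centraliser)
  have A_car: "b \<in> carrier G" if "b \<in> A" for b using that by (auto simp: A_def centraliser_def)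
  have H_car: "h \<in> carrier G" if "h \<in> H" for h using that by (auto simp: H_def centraliser_def)
  have tc: "t \<in> carrier G" by (rule t_carrier[OF S X t])
  define \<Theta> where "\<Theta> = (\<lambda>h b j. h \<otimes> (X j \<otimes> twist t b (a j)) \<otimes> inv h)"
  have hom: "graded_hom S X a (\<lambda>g d. h \<otimes> (g \<otimes> twist t b d) \<otimes> inv h)" if "h \<in> H" "b \<in> A" for h b
    using graded_hom_twist[OF S X t] that unfolding H_def A_def by blast
  have \<Theta>_car: "\<Theta> h b j \<in> carrier G" if "h \<in> H" "b \<in> A" for h b j
    using graded_hom_carrier[OF S X hom[OF that] deg_rel.unknown] unfolding \<Theta>_def .
  have \<Theta>_sol: "word_value G (\<Theta> h b) (v i) = \<one>" if hb: "h \<in> H" "b \<in> A" and i: "i \<in> I" for h b i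
  proof -
    have "word_value G (\<Theta> h b) (v i) =
        h \<otimes> (word_value G X (v i) \<otimes> twist t b (word_degree a (v i))) \<otimes> inv h"
      using word_value_graded_hom[OF S X hom[OF hb] coeffs[OF i]] unfolding \<Theta>_def by blast
    also have "\<dots> = \<one>"
      using H_car[OF hb(1)] by (simp add: X_sol[OF i] deg0[OF i] twist_0[OF S X t])
    finally show ?thesis .
  qed

  \<comment> \<open>The chain enters only through its top member \<open>Z n\<close>, which carries
    at least \<open>n\<close> independent coordinates.\<close>
  have "enat n \<le> zariski_dim C" if chain: "\<forall>i\<le>n. closedin (subtopology zariski H) (Z i) \<and>
      irreducible_in (subtopology zariski H) (Z i)" "\<forall>i<n. Z i \<subset> Z (Suc i)" for n Z
  proof -
    have Z: "\<forall>i\<le>n. closedin zariski (Z i) \<and> irr (Z i)"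
      using chain(1) H_closed
      by (auto simp: irreducible_in_subtopology_zariski closedin_closed_subtopology)
    have ZH: "Z n \<subseteq> H" using chain(1) by (auto simp: irreducible_in_subtopology_zariski)
    have Zn: "closedin zariski (Z n)" "irr (Z n)" using Z by auto
    obtain y where y: "\<forall>j::nat. y j \<in> poly_fun" "independent_coords {..<n} ((\<lambda>x j. y j x) ` Z n)"
      using independent_functions_of_chain[OF Z chain(2)] by blast
    obtain E where E: "independent_coords E (Z n)" "n \<le> card E"
      using independent_coords_of_functions[OF Zn(1) _ _ y(2)] y(1) by auto
    \<comment> \<open>The largest size of an independent set stands for the dimension of
      \<open>A\<close>. As \<open>A\<close> may be reducible, an irreducible piece \<open>B\<close>
      with the same independent set \<open>F\<close> is used.\<close>
    define \<F> where "\<F> = {F :: 'n set. independent_coords F A}"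
    have "\<one> \<in> A" unfolding A_def by (rule centraliser_one[OF Kc])
    then have "{} \<in> \<F>" using independent_coords_empty[of A] by (auto simp: \<F>_def)
    then obtain F where F: "F \<in> \<F>" "\<And>F'. F' \<in> \<F> \<Longrightarrow> card F' \<le> card F"
      using obtains_MAX[of \<F> card] by (metis Max_ge empty_iff finite finite_imageI imageI)
    have indF: "independent_coords F ((\<lambda>x j. x j) ` A)" using F(1) by (simp add: \<F>_def)
    obtain B where B: "B \<subseteq> A" "closedin zariski B" "irr B" "independent_coords F B"
      using independent_functions_obtain_irr[OF A_closed poly_fun.coord indF] by auto
    define Y where "Y = {z :: 'n + 'n \<Rightarrow> 'k. z \<circ> Inl \<in> Z n \<and> z \<circ> Inr \<in> B}"
    have Y_irr: "irr Y" unfolding Y_def by (rule irr_Times[OF Zn(2) B(3)])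
    have Y_closed: "closedin zariski Y"
    proof -
      have "closedin zariski {z :: 'n + 'n \<Rightarrow> 'k. z \<circ> Inl \<in> Z n}"
        by (rule closedin_preimage[OF Zn(1)]) (simp add: poly_fun.coord)
      moreover have "closedin zariski {z :: 'n + 'n \<Rightarrow> 'k. z \<circ> Inr \<in> B}"
        by (rule closedin_preimage[OF B(2)]) (simp add: poly_fun.coord)
      ultimately show ?thesis unfolding Y_def Collect_conj_eq by (rule closedin_Int)
    qed
    have Y_ind: "independent_coords (Inl ` E \<union> Inr ` F) Y"
      unfolding Y_def by (rule independent_coords_Times[OF E(1) B(4)])
    obtain z0 b0 where z0: "z0 \<in> Z n" and b0: "b0 \<in> B" using Zn(2) B(3) by (auto simp: irr_def)
    have z0H: "z0 \<in> H" and b0A: "b0 \<in> A" using z0 b0 ZH B(1) by auto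
    \<comment> \<open>\<open>Z n\<close> and \<open>B\<close> need not contain the unit. Left
      translation by the inverses of \<open>z0\<close> and \<open>b0\<close> makes this pair of
      points correspond to the solution \<open>x\<close> itself.\<close>
    define h where "h = (\<lambda>z :: 'n + 'n \<Rightarrow> 'k. inv z0 \<otimes> (z \<circ> Inl))"
    define b where "b = (\<lambda>z :: 'n + 'n \<Rightarrow> 'k. inv b0 \<otimes> (z \<circ> Inr))"
    have hH: "h z \<in> H" and bA: "b z \<in> A" if "z \<in> Y" for z
    proof -
      have "z \<circ> Inl \<in> H" "z \<circ> Inr \<in> A" using that ZH B(1) by (auto simp: Y_def)
      then show "h z \<in> H" "b z \<in> A"
        using z0H b0A S Kc unfolding h_def b_def H_def A_def
        by (auto intro!: centraliser_mult centraliser_inv)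
    qed
    define f where "f = (\<lambda>z (j, l). \<Theta> (h z) (b z) j l)"
    have f_curry: "curry (f z) j = \<Theta> (h z) (b z) j" for z j by (simp add: f_def curry_def)
    have reg: "regular_map_on Y f"
    proof -
      have i1: "regular_map_on Y (\<lambda>z. z \<circ> Inl)" and i2: "regular_map_on Y (\<lambda>z. z \<circ> Inr)"
        unfolding regular_map_on_def by (auto intro: poly_fun.coord)
      have c1: "z \<circ> Inl \<in> carrier G" "z \<circ> Inr \<in> carrier G" if "z \<in> Y" for z
        using that ZH B(1) H_car A_car by (auto simp: Y_def)
      have rh: "regular_map_on Y h" and rb: "regular_map_on Y b" unfolding h_def b_def
        using i1 i2 c1 H_car[OF z0H] A_car[OF b0A]
        by (auto intro!: regular_map_on_mult regular_map_on_const)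
      have hc: "h z \<in> carrier G" and bc: "b z \<in> carrier G" if "z \<in> Y" for z
        using hH[OF that] bA[OF that] H_car A_car by auto
      have "regular_map_on Y (\<lambda>z. \<Theta> (h z) (b z) j)" for j
        unfolding \<Theta>_def twist_def[OF S X t]
        using rh rb hc bc X tc
        by (intro regular_map_on_mult regular_map_on_inv regular_map_on_int_pow regular_map_on_const) auto
      then show ?thesis unfolding regular_map_on_def f_def by (auto split: prod.splits)
    qed
    have fV: "f ` Y \<subseteq> V"
    proof
      fix w assume "w \<in> f ` Y"
      then obtain z where z: "z \<in> Y" "w = f z" by blast
      have "curry w = \<Theta> (h z) (b z)" using f_curry by (auto simp: z(2))
      then show "w \<in> V" using \<Theta>_car \<Theta>_sol hH[OF z(1)] bA[OF z(1)]
        by (simp add: V_def solution_variety_def)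
    qed
    have x_img: "x \<in> f ` Y"
    proof -
      define z where "z = case_sum z0 b0"
      have z: "z \<circ> Inl = z0" "z \<circ> Inr = b0" by (auto simp: z_def)
      have "\<Theta> \<one> \<one> j = X j" for j
        using X by (simp add: \<Theta>_def twist_one[OF S X t])
      moreover have "h z = \<one>" "b z = \<one>"
        using H_car[OF z0H] A_car[OF b0A] by (simp_all add: h_def b_def z)
      ultimately have "f z = x" by (auto simp: f_def X_def)
      moreover have "z \<in> Y" using z z0 b0 by (simp add: Y_def)
      ultimately show ?thesis by blast
    qed
    have "irr (f ` Y)"
      using reg unfolding regular_map_on_def by (intro irr_image[OF Y_irr]) auto
    then have fC: "f ` Y \<subseteq> C" using x(2) x_img fV by blast
    have fibre: "card F' \<le> card F" if z: "z \<in> Y" and F': "independent_coords F' {z'\<in>Y. f z' = f z}" for z F'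
    proof -
      \<comment> \<open>The pairs found in \<open>twist_fibre\<close>, with the translations by
        \<open>z0\<close> and \<open>b0\<close> undone. The fibre lies in this regular image of
        \<open>A\<close>, which bounds its independent coordinates by \<open>card F\<close>.\<close>
      define \<rho> where "\<rho> = (\<lambda>e. case_sum (z0 \<otimes> (h z \<otimes> e)) (b0 \<otimes> (inv t \<otimes> (inv e \<otimes> (t \<otimes> (b z \<otimes> e))))))"
      have car: "z0 \<in> carrier G" "b0 \<in> carrier G" "h z \<in> carrier G" "b z \<in> carrier G"
        using z0H b0A hH[OF z] bA[OF z] H_car A_car by auto
      have sub: "{z'\<in>Y. f z' = f z} \<subseteq> \<rho> ` A"
      proof
        fix z' assume "z' \<in> {z'\<in>Y. f z' = f z}"
        then have z': "z' \<in> Y" "f z = f z'" by auto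
        have "\<Theta> (h z) (b z) j = \<Theta> (h z') (b z') j" for j
          unfolding f_curry[symmetric] z'(2) ..
        then have "\<exists>e\<in>A. h z' = h z \<otimes> e \<and> b z' = inv t \<otimes> (inv e \<otimes> (t \<otimes> (b z \<otimes> e)))"
          using hH[OF z] bA[OF z] hH[OF z'(1)] bA[OF z'(1)] unfolding \<Theta>_def H_def A_def
          by (intro twist_fibre[OF S X t])
        then obtain e where e: "e \<in> A" "h z' = h z \<otimes> e" "b z' = inv t \<otimes> (inv e \<otimes> (t \<otimes> (b z \<otimes> e)))" by blast
        have "z' \<circ> Inl \<in> carrier G" "z' \<circ> Inr \<in> carrier G"
          using z'(1) ZH B(1) H_car A_car by (auto simp: Y_def)
        then have "z' \<circ> Inl = z0 \<otimes> h z'" "z' \<circ> Inr = b0 \<otimes> b z'"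
          using car by (simp_all add: h_def b_def inv_cancel_left)
        then have "z' i = \<rho> e i" for i
          unfolding \<rho>_def e(2,3)[symmetric] by (cases i) (auto dest: fun_cong)
        then show "z' \<in> \<rho> ` A" using e(1) by blast
      qed
      have "regular_map_on A \<rho>"
      proof -
        have r1: "regular_map_on A (\<lambda>e. z0 \<otimes> (h z \<otimes> e))"
          using car A_car by (intro regular_map_on_mult regular_map_on_const regular_map_on_id) auto
        have r2: "regular_map_on A (\<lambda>e. b0 \<otimes> (inv t \<otimes> (inv e \<otimes> (t \<otimes> (b z \<otimes> e)))))"
          using car A_car tc
          by (intro regular_map_on_mult regular_map_on_inv regular_map_on_const regular_map_on_id) auto
        show ?thesis unfolding regular_map_on_def
        proof
          fix i
          show "\<exists>p\<in>poly_fun. \<forall>e\<in>A. \<rho> e i = p e"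
            using r1 r2 by (cases i) (auto simp: regular_map_on_def \<rho>_def)
        qed
      qed
      then have "\<forall>i. \<exists>p. p \<in> poly_fun \<and> (\<forall>e\<in>A. \<rho> e i = p e)" unfolding regular_map_on_def by blast
      from choice[OF this] obtain s where s: "\<forall>i. s i \<in> poly_fun \<and> (\<forall>e\<in>A. \<rho> e i = s i e)" by (elim exE)
      have "\<rho> ` A = (\<lambda>e i. s i e) ` A" using s by (intro image_cong) auto
      then have "independent_coords F' ((\<lambda>e i. s i e) ` A)"
        using independent_coords_mono[OF F' subset_refl sub] by simp
      then obtain F'' where "independent_coords F'' A" "card F' \<le> card F''"
        using independent_coords_of_functions[OF A_closed, of F' s] s by auto
      then show ?thesis using F(2)[of F''] by (simp add: \<F>_def)
    qed
    obtain F' where F': "independent_coords F' C" "card (Inl ` E \<union> Inr ` F) \<le> card F' + card F"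
      by (rule fibre_dimension[OF Y_closed Y_irr reg fC Y_ind fibre])
    have "card (Inl ` E \<union> Inr ` F) = card E + card F"
      by (subst card_Un_disjoint) (auto simp: card_image)
    then have "n \<le> card F'" using E(2) F'(2) by simp
    then have "enat n \<le> enat (card F')" by simp
    also have "\<dots> \<le> zariski_dim C" by (rule krull_dim_zariski_le[OF C(1,2) F'(1)])
    finally show ?thesis .
  qed
  then show ?thesis
    unfolding S_def[symmetric] H_def[symmetric] krull_dim_def[of "subtopology zariski H"]
    by (intro Sup_least) blast
qed

theorem theorem1:
  fixes G :: "('n::finite \<Rightarrow> 'k::alg_closed_field) monoid"
    and I :: "'s set"
    and v :: "'s \<Rightarrow> ('n \<Rightarrow> 'k, 'm::finite) letter list"
    and C :: "('m \<times> 'n \<Rightarrow> 'k) set"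
  assumes "affine_algebraic_group G"
    and "system_coeffs I v \<subseteq> carrier G"
    and "matrix_rank I (system_matrix v) < CARD('m)"
    and "irreducible_component_of (subtopology zariski (solution_variety G I v)) C"
  shows "zariski_dim C \<ge> zariski_dim (centraliser G (system_coeffs I v))"
  using assms by (rule affine_algebraic_group.dim_component_ge)

end
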